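(* A finite group $G$ acts effectively by homeomorphisms on the torus $T^n$ if and only if there exists an abelian normal subgroup $A\trianglelefteq G$ with quotient $Q=G/A$ such that: (i) $Q$ is isomorphic to a subgroup of $\mathrm{GL}_n(\mathbb{Z})$ (fix such an embedding, giving $\mathbb{Z}^n$ the structure of a $Q$-module); (ii) there is a $Q$-equivariant surjective homomorphism $\alpha:\mathbb{Z}^n\to A$ (where $Q$ acts on $A$ by conjugation in $G$) such that the cohomology class in $H^2(Q;A)$ of the extension $1\to A\to G\to Q\to 1$ lies in the image of the induced map $\alpha_*:H^2(Q;\mathbb{Z}^n)\to H^2(Q;A)$. *)

theory Defs
  imports "HOL-Analysis.Analysis" "HOL-Algebra.Coset"
begin

text \<open>The torus T^n, modelled as the product of n unit circles in complex^'n
  (n = CARD('n)).\<close>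
definition torus :: "(complex^'n) set" where
  "torus = {z. \<forall>i. cmod (z $ i) = 1}"

text \<open>An effective action of the group G on the torus by homeomorphisms.\<close>
definition effective_torus_action ::
  "('g, 'c) monoid_scheme \<Rightarrow> ('g \<Rightarrow> complex^'n \<Rightarrow> complex^'n) \<Rightarrow> bool" where
  "effective_torus_action G \<phi> \<longleftrightarrow>
     (\<forall>g\<in>carrier G. \<exists>\<psi>. homeomorphism torus torus (\<phi> g) \<psi>) \<and>
     (\<forall>g\<in>carrier G. \<forall>h\<in>carrier G. \<forall>x\<in>torus. \<phi> (g \<otimes>\<^bsub>G\<^esub> h) x = \<phi> g (\<phi> h x)) \<and>
     (\<forall>x\<in>torus. \<phi> \<one>\<^bsub>G\<^esub> x = x) \<and>
     (\<forall>g\<in>carrier G. (\<forall>x\<in>torus. \<phi> g x = x) \<longrightarrow> g = \<one>\<^bsub>G\<^esub>)"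

text \<open>GL_n(Z) as a group under matrix multiplication.\<close>
definition GLZ :: "(int^'n^'n) monoid" where
  "GLZ = \<lparr>carrier = {M. invertible M}, mult = (**), one = mat 1\<rparr>"

text \<open>The additive group Z^n.\<close>
definition Zn :: "(int^'n) monoid" where
  "Zn = \<lparr>carrier = UNIV, mult = (+), one = 0\<rparr>"

text \<open>Inhomogeneous 2-cocycles and 2-coboundaries of a group Q with coefficients
  in an abelian group M (written multiplicatively) with Q-action act.\<close>
definition cocycle2 ::
  "('q, 'a) monoid_scheme \<Rightarrow> ('m, 'b) monoid_scheme \<Rightarrow> ('q \<Rightarrow> 'm \<Rightarrow> 'm)
   \<Rightarrow> ('q \<Rightarrow> 'q \<Rightarrow> 'm) \<Rightarrow> bool" where
  "cocycle2 Q M act f \<longleftrightarrow>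
     (\<forall>x\<in>carrier Q. \<forall>y\<in>carrier Q. f x y \<in> carrier M) \<and>
     (\<forall>x\<in>carrier Q. \<forall>y\<in>carrier Q. \<forall>z\<in>carrier Q.
        act x (f y z) \<otimes>\<^bsub>M\<^esub> f x (y \<otimes>\<^bsub>Q\<^esub> z)
          = f x y \<otimes>\<^bsub>M\<^esub> f (x \<otimes>\<^bsub>Q\<^esub> y) z)"

definition coboundary2 ::
  "('q, 'a) monoid_scheme \<Rightarrow> ('m, 'b) monoid_scheme \<Rightarrow> ('q \<Rightarrow> 'm \<Rightarrow> 'm)
   \<Rightarrow> ('q \<Rightarrow> 'q \<Rightarrow> 'm) \<Rightarrow> bool" where
  "coboundary2 Q M act f \<longleftrightarrow>
     (\<exists>h. (\<forall>x\<in>carrier Q. h x \<in> carrier M) \<and>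
          (\<forall>x\<in>carrier Q. \<forall>y\<in>carrier Q.
             f x y = act x (h y) \<otimes>\<^bsub>M\<^esub> inv\<^bsub>M\<^esub> (h (x \<otimes>\<^bsub>Q\<^esub> y)) \<otimes>\<^bsub>M\<^esub> h x))"

text \<open>For a normal subgroup A of G: a chosen representative of a coset,
  the conjugation action of G/A on A, and the 2-cocycle of the extension
  1 \<rightarrow> A \<rightarrow> G \<rightarrow> G/A \<rightarrow> 1 attached to the section C \<mapsto> rep C.\<close>
definition coset_rep :: "'g set \<Rightarrow> 'g" where
  "coset_rep C = (SOME g. g \<in> C)"

definition conj_act :: "('g, 'c) monoid_scheme \<Rightarrow> 'g set \<Rightarrow> 'g \<Rightarrow> 'g" where
  "conj_act G C a = coset_rep C \<otimes>\<^bsub>G\<^esub> a \<otimes>\<^bsub>G\<^esub> inv\<^bsub>G\<^esub> (coset_rep C)"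

definition ext_cocycle :: "('g, 'c) monoid_scheme \<Rightarrow> 'g set \<Rightarrow> 'g set \<Rightarrow> 'g" where
  "ext_cocycle G C1 C2 =
     coset_rep C1 \<otimes>\<^bsub>G\<^esub> coset_rep C2 \<otimes>\<^bsub>G\<^esub> inv\<^bsub>G\<^esub> (coset_rep (C1 <#>\<^bsub>G\<^esub> C2))"

end

theory Submission
  imports Defs "HOL-Homology.Homology" "HOL-Computational_Algebra.Primes"
    "HOL-Algebra.Multiplicative_Group"
begin

text \<open>Lift an action of G on the torus to the group E of all lifts to Euclidean space; it is an extension
  of G by the lattice of translations. Let A consist of the elements acting trivially on the
  fundamental group, and let L be the preimage of A in E, in which the translations are central and
  of finite index. A homeomorphism of Euclidean space of finite order and bounded displacement is the
  identity (Newman's theorem, after Dress: for prime order p, the average h of its iterates has degree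
  1, yet over a point moved by the map the fibre of a small perturbation of h splits into p pieces
  that are permuted cyclically, so p divides the degree). Hence L is torsion free, and the transfer
  embeds L in the lattice; so L is itself a lattice, E is an extension of G/A by L, and pushing its
  cocycle forward along L \<rightarrow> A gives the cocycle of G.

  Conversely, a cocycle with values in \<open>\<int>\<^sup>n\<close> is the coboundary over \<open>\<real>\<^sup>n\<close> of its average. This
  makes the extension of G/A by \<open>\<int>\<^sup>n\<close> act affinely on \<open>\<real>\<^sup>n\<close>, and G acts on the quotient by the
  kernel of \<alpha>.\<close>

section \<open>Relative homology of complements of compact sets\<close>

text \<open>The degree argument uses homology relative to complements of compact sets: there a map
  of bounded displacement can be joined to the identity by straight segments that avoid the fibre,
  and disjoint pieces of the fibre contribute separately. For composite order a moved point may be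
  fixed by a proper power; for prime order its orbit is free. The perturbation is needed because the
  fibre of the average comes with no decomposition into translates of one open piece. Torsion
  freeness excludes a finite factor in L: it makes the transfer injective, so that L, and with it A,
  comes out abelian. Unless A is trivial, L is strictly larger than the lattice of translations. In
  a basis of L the action of G/A is conjugate over the rationals, but not necessarily over the
  integers, to the action on the fundamental group; the embedding into GL_n is the action on L. The
  converse changes the lattice in the opposite direction: matrices and translation parts are
  rewritten in a basis of the kernel of \<alpha>. A group element determines its lattice vector only
  modulo this kernel, so the affine maps compose only up to kernel translations.\<close>

lemma continuous_on_funpow:
  fixes f :: "'a::topological_space \<Rightarrow> 'a"
  assumes "continuous_on UNIV f"
  shows "continuous_on UNIV (f ^^ i)"
  by (induction i) (auto simp: o_def intro: continuous_on_compose2 [OF assms])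

lemma funpow_displacement:
  fixes f :: "'a::real_normed_vector \<Rightarrow> 'a"
  assumes "\<And>x. norm (f x - x) \<le> D"
  shows "norm ((f ^^ i) x - x) \<le> real i * D"
proof (induction i)
  case (Suc i)
  have "norm ((f ^^ Suc i) x - x) \<le> norm (f ((f ^^ i) x) - (f ^^ i) x) + norm ((f ^^ i) x - x)"
    using norm_triangle_ineq[of "f ((f ^^ i) x) - (f ^^ i) x" "(f ^^ i) x - x"] by simp
  then show ?case using Suc assms[of "(f ^^ i) x"] by (simp add: algebra_simps)
qed simp

lemma iso_surjD: "h \<in> iso G H \<Longrightarrow> y \<in> carrier H \<Longrightarrow> \<exists>x\<in>carrier G. h x = y"
  by (metis Group.iso_iff imageE)

lemma contractible_space_euclidean:
  "contractible_space (euclidean :: 'a::real_normed_vector topology)"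
  by (metis contractible_UNIV contractible_space_top_of_set subtopology_UNIV)

text \<open>Contractibility of the whole space makes the boundary map an isomorphism onto the
  reduced homology of the punctured space, which is homotopy equivalent to a sphere of dimension
  \<open>DIM('a) - 1\<close>. Reduced groups cover dimension one as well.\<close>

lemma isomorphic_local_homology_integer_group:
  fixes y :: "'a::euclidean_space"
  shows "relative_homology_group (int DIM('a)) euclidean (-{y}) \<cong> integer_group"
proof -
  obtain b :: 'a where b: "b \<in> Basis"
    using nonempty_Basis by blast
  have ne: "topspace euclidean \<inter> -{y} \<noteq> {}"
  proof -
    have "y + b \<in> topspace euclidean \<inter> -{y}" using b nonzero_Basis by auto
    then show ?thesis by (metis empty_iff)
  qed
  have 1: "relative_homology_group (int DIM('a)) euclidean (-{y})
        \<cong> reduced_homology_group (int DIM('a) - 1) (top_of_set (-{y}))"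
    by (rule isomorphic_group_relative_homology_of_contractible [OF contractible_space_euclidean ne])
  have [simp]: "y \<in> rel_interior (cball y 1)"
    by (simp add: rel_interior_nonempty_interior)
  have [simp]: "affine hull cball y 1 - {y} = -{y}"
    by (metis Compl_eq_Diff_UNIV aff_dim_cball aff_dim_lt_full not_less_iff_gr_or_eq zero_less_one)
  have "sphere y 1 homotopy_eqv - {y}"
    using homotopy_eqv_rel_frontier_punctured_affine_hull [of "cball y 1" y] by auto
  moreover have "sphere (0::'a) 1 homotopy_eqv sphere y 1"
    by (intro homeomorphic_imp_homotopy_eqv homeomorphic_spheres) auto
  moreover obtain f g where "homeomorphic_maps (nsphere(DIM('a) - 1)) (top_of_set (sphere (0::'a) 1 \<inter> span Basis)) f g"
    using homeomorphic_maps_nsphere_euclidean_sphere [of "Basis :: 'a set" "DIM('a)"]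
    by (metis DIM_positive independent_Basis less_numeral_extra(3) norm_Basis orthogonal_Basis)
  then have "nsphere(DIM('a) - 1) homotopy_equivalent_space top_of_set (sphere (0::'a) 1)"
    by (metis homeomorphic_imp_homotopy_equivalent_space homeomorphic_space_def inf_top_right span_Basis)
  ultimately have "nsphere(DIM('a) - 1) homotopy_equivalent_space top_of_set (-{y})"
    by (meson homotopy_eqv_trans)
  then have 2: "reduced_homology_group (int DIM('a) - 1) (nsphere (DIM('a) - 1))
      \<cong> reduced_homology_group (int DIM('a) - 1) (top_of_set (-{y}))"
    by (rule homotopy_equivalent_space_imp_isomorphic_reduced_homology_groups)
  have 3: "reduced_homology_group (int DIM('a) - 1) (nsphere (DIM('a) - 1)) \<cong> integer_group"
    using reduced_homology_group_nsphere(1)[of "DIM('a) - 1"]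
    by (simp add: of_nat_diff Suc_le_eq)
  show ?thesis
    by (rule iso_trans [OF 1 iso_trans [OF group.iso_sym [OF group_reduced_homology_group 2] 3]])
qed

text \<open>Radial expansion by \<open>r\<close> is a homotopy inverse to the inclusion of the
  complement of the ball into the punctured space. This provides a generator whose boundary lies
  outside a prescribed ball, where maps of bounded displacement can be compared with the
  identity.\<close>

lemma surj_local_homology_cball:
  fixes y :: "'a::euclidean_space"
  assumes r: "r > 0" and c: "c \<in> carrier (relative_homology_group n euclidean (-{y}))"
  obtains d where "d \<in> carrier (relative_homology_group n euclidean (-cball y r))"
    "hom_induced n euclidean (-cball y r) euclidean (-{y}) id d = c"
proof -
  let ?X = "euclidean :: 'a topology"
  define g where "g = (\<lambda>x. x + (r / norm (x - y)) *\<^sub>R (x - y))"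
  have gy: "g x - y = (1 + r / norm (x - y)) *\<^sub>R (x - y)" for x
    by (simp add: g_def algebra_simps)
  have ng: "norm (g x - y) = norm (x - y) + r" if "x \<noteq> y" for x
  proof -
    have "norm (g x - y) = (1 + r / norm (x - y)) * norm (x - y)"
      unfolding gy using r by (simp add: abs_of_nonneg)
    also have "\<dots> = norm (x - y) + r"
      using that by (simp add: distrib_right)
    finally show ?thesis .
  qed
  have contg: "continuous_on (-{y}) g"
    unfolding g_def by (intro continuous_intros) auto
  \<comment> \<open>Along the segment the distance from \<open>y\<close> never drops below its
    initial value, so one linear homotopy serves both the punctured space and the complement of the
    ball.\<close>
  have seg: "closed_segment x (g x) \<subseteq> -ball y (norm (x - y))" for x
  proof
    fix z assume "z \<in> closed_segment x (g x)"
    then obtain u where u: "0 \<le> u" "u \<le> 1" "z = (1 - u) *\<^sub>R x + u *\<^sub>R g x"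
      by (auto simp: closed_segment_def)
    have "z - y = (1 + u * (r / norm (x - y))) *\<^sub>R (x - y)"
      unfolding u g_def by (simp add: algebra_simps)
    then have "norm (z - y) = (1 + u * (r / norm (x - y))) * norm (x - y)"
      using u r by (simp add: abs_of_nonneg)
    also have "\<dots> \<ge> 1 * norm (x - y)"
      using u r by (intro mult_right_mono) auto
    finally show "z \<in> -ball y (norm (x - y))"
      by (auto simp: dist_norm norm_minus_commute)
  qed
  have sub: "-cball y r \<subseteq> -{y}" using r by auto
  have iso: "hom_induced (n-1) (top_of_set (-cball y r)) {} (top_of_set (-{y})) {} id
      \<in> iso (reduced_homology_group (n-1) (top_of_set (-cball y r))) (reduced_homology_group (n-1) (top_of_set (-{y})))"
  proof (rule homotopy_equivalence_reduced_homology_group_isomorphism)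
    show "continuous_map (top_of_set (-cball y r)) (top_of_set (-{y})) id"
      using sub by auto
    show "continuous_map (top_of_set (-{y})) (top_of_set (-cball y r)) g"
      using contg ng r by (auto simp: dist_norm norm_minus_commute)
    have "homotopic_with (\<lambda>h. True) (top_of_set (- cball y r)) (top_of_set (- cball y r)) id g"
    proof (rule homotopic_with_linear)
      show "continuous_on (- cball y r) g"
        using contg sub continuous_on_subset by blast
      show "closed_segment (id x) (g x) \<subseteq> - cball y r" if "x \<in> - cball y r" for x
        using seg[of x] that by (force simp: dist_norm norm_minus_commute)
    qed auto
    then show "homotopic_with (\<lambda>h. True) (top_of_set (- cball y r)) (top_of_set (- cball y r)) (g \<circ> id) id"
      by (simp add: homotopic_with_symD)
    have "homotopic_with (\<lambda>h. True) (top_of_set (- {y})) (top_of_set (- {y})) id g"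
    proof (rule homotopic_with_linear)
      show "closed_segment (id x) (g x) \<subseteq> - {y}" if "x \<in> - {y}" for x
        using seg[of x] that by (force simp: dist_norm norm_minus_commute)
    qed (use contg in auto)
    then show "homotopic_with (\<lambda>h. True) (top_of_set (- {y})) (top_of_set (- {y})) (id \<circ> g) id"
      by (simp add: homotopic_with_symD)
  qed
  have ne: "- cball y r \<noteq> {}" 
    using bounded_cball[of y r] not_bounded_UNIV[where 'a='a] by (metis Compl_empty_eq double_compl)
  then have ne': "-{y} \<noteq> {}" using sub by blast
  have bd1: "hom_boundary n ?X (-cball y r) \<in> iso (relative_homology_group n ?X (-cball y r))
      (reduced_homology_group (n-1) (top_of_set (-cball y r)))"
    by (rule iso_relative_homology_of_contractible [OF contractible_space_euclidean]) (use ne in simp)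
  have bd2: "hom_boundary n ?X (-{y}) \<in> iso (relative_homology_group n ?X (-{y}))
      (reduced_homology_group (n-1) (top_of_set (-{y})))"
    by (rule iso_relative_homology_of_contractible [OF contractible_space_euclidean]) (use ne' in simp)
  have nat: "hom_boundary n ?X (-{y}) (hom_induced n ?X (-cball y r) ?X (-{y}) id d)
     = hom_induced (n - 1) (subtopology ?X (-cball y r)) {} (subtopology ?X (-{y})) {} id (hom_boundary n ?X (-cball y r) d)" for d
    using naturality_hom_induced[of ?X ?X id "-cball y r" "-{y}" n] sub
    by (force simp: fun_eq_iff)
  have "hom_boundary n ?X (-{y}) c \<in> carrier (reduced_homology_group (n-1) (top_of_set (-{y})))"
    using bd2 c unfolding iso_def bij_betw_def by blast
  then obtain e where e: "e \<in> carrier (reduced_homology_group (n-1) (top_of_set (-cball y r)))"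
     "hom_induced (n-1) (top_of_set (-cball y r)) {} (top_of_set (-{y})) {} id e = hom_boundary n ?X (-{y}) c"
    using iso_surjD [OF iso] by blast
  obtain d where d: "d \<in> carrier (relative_homology_group n ?X (-cball y r))" "hom_boundary n ?X (-cball y r) d = e"
    using iso_surjD [OF bd1 e(1)] by blast
  have "hom_induced n ?X (-cball y r) ?X (-{y}) id d = c"
  proof (rule inj_onD)
    show "inj_on (hom_boundary n ?X (-{y})) (carrier (relative_homology_group n ?X (-{y})))"
      using bd2 unfolding iso_def bij_betw_def by blast
    show "hom_boundary n ?X (-{y}) (hom_induced n ?X (-cball y r) ?X (-{y}) id d) = hom_boundary n ?X (-{y}) c"
      using nat d e by simp
  qed (use c hom_induced_carrier in auto)
  with d show thesis using that by blast
qed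

lemma hom_induced_one:
  "hom_induced p X S Y T f \<one>\<^bsub>relative_homology_group p X S\<^esub> = \<one>\<^bsub>relative_homology_group p Y T\<^esub>"
  using hom_one[OF hom_induced_hom] by simp

text \<open>As \<open>c\<close> dies along \<open>K\<close>, exactness of the triple makes it come
  from a class of the pair inside the complement of \<open>K\<close>. Excision of \<open>K\<close>
  identifies the homology of that pair with the homology along \<open>L\<close>, where
  \<open>c\<close> vanishes too.\<close>

lemma local_homology_Un_injective:
  fixes K L :: "'a::topological_space set"
  assumes "closed K" "closed L" "K \<inter> L = {}"
    and c: "c \<in> carrier (relative_homology_group p euclidean (-(K \<union> L)))"
    and cK: "hom_induced p euclidean (-(K \<union> L)) euclidean (-K) id c = \<one>\<^bsub>relative_homology_group p euclidean (-K)\<^esub>"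
    and cL: "hom_induced p euclidean (-(K \<union> L)) euclidean (-L) id c = \<one>\<^bsub>relative_homology_group p euclidean (-L)\<^esub>"
  shows "c = \<one>\<^bsub>relative_homology_group p euclidean (-(K \<union> L))\<^esub>"
proof -
  let ?X = "euclidean :: 'a topology"
  let ?i = "hom_induced p (subtopology ?X (-K)) (-(K \<union> L)) ?X (-(K \<union> L)) id"
  have "c \<in> kernel (relative_homology_group p ?X (-(K \<union> L))) (relative_homology_group p ?X (-K))
       (hom_induced p ?X (-(K \<union> L)) ?X (-K) id)"
    using c cK by (simp add: kernel_def)
  then obtain d where d: "d \<in> carrier (relative_homology_group p (subtopology ?X (-K)) (-(K \<union> L)))" "?i d = c"
    using homology_exactness_triple_3[of "-(K \<union> L)" "-K" p ?X] by auto
  have eq: "-(K \<union> L) = -L - K" "UNIV - K = -K" by auto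
  have ex: "hom_induced p (subtopology ?X (UNIV - K)) (-L - K) (subtopology ?X UNIV) (-L) id
    \<in> iso (relative_homology_group p (subtopology ?X (UNIV - K)) (-L - K))
          (relative_homology_group p (subtopology ?X UNIV) (-L))"
  proof (rule homology_excision_axiom)
    have "interior (-L) = -L" using assms by (simp add: interior_open open_Compl)
    then show "euclidean closure_of K \<subseteq> euclidean interior_of (-L)"
      using assms by auto
  qed auto
  have "hom_induced p (subtopology ?X (-K)) (-(K \<union> L)) ?X (-L) id d
      = hom_induced p ?X (-(K \<union> L)) ?X (-L) id (?i d)"
    by (subst hom_induced_compose') auto
  also have "\<dots> = \<one>\<^bsub>relative_homology_group p ?X (-L)\<^esub>"
    using cL d by simp
  finally have *: "hom_induced p (subtopology ?X (-K)) (-(K \<union> L)) ?X (-L) id d = \<one>\<^bsub>relative_homology_group p ?X (-L)\<^esub>" .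
  have "d = \<one>\<^bsub>relative_homology_group p (subtopology ?X (-K)) (-(K \<union> L))\<^esub>"
  proof (rule inj_onD [rotated])
    show "hom_induced p (subtopology ?X (-K)) (-(K \<union> L)) ?X (-L) id d
      = hom_induced p (subtopology ?X (-K)) (-(K \<union> L)) ?X (-L) id \<one>\<^bsub>relative_homology_group p (subtopology ?X (-K)) (-(K \<union> L))\<^esub>"
      using * by (simp add: hom_induced_one)
    show "inj_on (hom_induced p (subtopology ?X (-K)) (-(K \<union> L)) ?X (-L) id)
      (carrier (relative_homology_group p (subtopology ?X (-K)) (-(K \<union> L))))"
      using ex by (simp only: eq iso_def bij_betw_def subtopology_UNIV mem_Collect_eq)
  qed (use d monoid.one_closed [OF group.is_monoid [OF group_relative_homology_group]] in auto)
  then show ?thesis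
    using d(2) by (simp add: hom_induced_one)
qed

lemma local_homology_UN_injective:
  fixes K :: "'i \<Rightarrow> 'a::topological_space set"
  assumes "finite I" "\<And>i. i \<in> I \<Longrightarrow> closed (K i)" "disjoint_family_on K I"
    and "c \<in> carrier (relative_homology_group p euclidean (-(\<Union>i\<in>I. K i)))"
    and "\<And>i. i \<in> I \<Longrightarrow> hom_induced p euclidean (-(\<Union>i\<in>I. K i)) euclidean (-K i) id c
           = \<one>\<^bsub>relative_homology_group p euclidean (-K i)\<^esub>"
  shows "c = \<one>\<^bsub>relative_homology_group p euclidean (-(\<Union>i\<in>I. K i))\<^esub>"
  using assms
proof (induction I arbitrary: c rule: finite_induct)
  case empty
  have "trivial_group (relative_homology_group p (euclidean :: 'a topology) (topspace euclidean))"
    by (rule trivial_relative_homology_group_topspace)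
  with empty show ?case by (auto simp: trivial_group_def)
next
  case (insert j I)
  let ?X = "euclidean :: 'a topology"
  let ?L = "\<Union>i\<in>I. K i"
  let ?d = "hom_induced p ?X (-(\<Union>i\<in>insert j I. K i)) ?X (-?L) id c"
  have dis: "disjoint_family_on K I" "K j \<inter> ?L = {}"
    using insert.prems(2) insert.hyps by (auto simp: disjoint_family_on_def)
  have "?d = \<one>\<^bsub>relative_homology_group p ?X (-?L)\<^esub>"
  proof (rule insert.IH [OF _ dis(1)])
    show "?d \<in> carrier (relative_homology_group p ?X (-?L))"
      by (rule hom_induced_carrier)
    fix i assume i: "i \<in> I"
    have "hom_induced p ?X (-?L) ?X (-K i) id ?d = hom_induced p ?X (-(\<Union>i\<in>insert j I. K i)) ?X (-K i) id c"
      using i by (subst hom_induced_compose') auto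
    also have "\<dots> = \<one>\<^bsub>relative_homology_group p ?X (-K i)\<^esub>"
      by (rule insert.prems(4)) (use i in simp)
    finally show "hom_induced p ?X (-?L) ?X (-K i) id ?d = \<one>\<^bsub>relative_homology_group p ?X (-K i)\<^esub>" .
  qed (use insert.prems in auto)
  moreover have "hom_induced p ?X (-(\<Union>i\<in>insert j I. K i)) ?X (-K j) id c = \<one>\<^bsub>relative_homology_group p ?X (-K j)\<^esub>"
    using insert.prems(4) by blast
  moreover have "closed ?L" "closed (K j)" using insert.prems(1) insert.hyps(1) by auto
  ultimately show ?case
    using local_homology_Un_injective[of "K j" ?L c p] insert.prems(3) dis unfolding UN_insert by blast
qed

lemma hom_induced_mult:
  assumes "a \<in> carrier (relative_homology_group p X S)" "b \<in> carrier (relative_homology_group p X S)"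
  shows "hom_induced p X S Y T f (a \<otimes>\<^bsub>relative_homology_group p X S\<^esub> b)
    = hom_induced p X S Y T f a \<otimes>\<^bsub>relative_homology_group p Y T\<^esub> hom_induced p X S Y T f b"
  using hom_mult[OF hom_induced_hom] assms by blast

lemma hom_induced_inv:
  assumes "a \<in> carrier (relative_homology_group p X S)"
  shows "hom_induced p X S Y T f (inv\<^bsub>relative_homology_group p X S\<^esub> a)
    = inv\<^bsub>relative_homology_group p Y T\<^esub> (hom_induced p X S Y T f a)"
proof -
  interpret group_hom "relative_homology_group p X S" "relative_homology_group p Y T" "hom_induced p X S Y T f"
    by (simp add: group_hom_axioms_def group_hom_def hom_induced_hom)
  show ?thesis using assms by simp
qed

text \<open>Let b be the part of the invariant class carried by K0. Both the class and the sum of the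
  translates of b restrict to the same class along each translate of K0, so they agree; and h maps
  all translates of b to the same element.\<close>
lemma local_homology_invariant_class_power:
  fixes f :: "'a::topological_space \<Rightarrow> 'a" and h :: "'a \<Rightarrow> 'b::topological_space"
  assumes contf: "continuous_on UNIV f" and fm: "f ^^ m = id" and m: "m > 0"
    and clK: "\<And>i. closed ((f ^^ i) ` K0)" and W: "open W" "K0 \<subseteq> W"
    and disj: "\<And>i. 0 < i \<Longrightarrow> i < m \<Longrightarrow> (f ^^ i) ` W \<inter> W = {}"
    and K: "K = (\<Union>i<m. (f ^^ i) ` K0)"
    and conth: "continuous_on UNIV h" and hf: "h \<circ> f = h" and hS: "h \<in> -K \<rightarrow> S"
    and mu: "mu \<in> carrier (relative_homology_group q euclidean (-K))"
    and inv: "hom_induced q euclidean (-K) euclidean (-K) f mu = mu"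
  shows "\<exists>b\<in>carrier (relative_homology_group q euclidean S).
     hom_induced q euclidean (-K) euclidean S h mu = b [^]\<^bsub>relative_homology_group q euclidean S\<^esub> m"
proof -
  let ?X = "euclidean :: 'a topology" and ?Y = "euclidean :: 'b topology"
  let ?HK = "relative_homology_group q ?X (-K)" and ?HS = "relative_homology_group q ?Y S"
  define F where "F = (\<lambda>i. f ^^ i)"
  let ?r = "\<lambda>i. hom_induced q ?X (-K) ?X (-(F i ` K0)) id"
  let ?H = "\<lambda>i. relative_homology_group q ?X (-(F i ` K0))"
  have F0: "F 0 = id" and FS: "F (Suc i) = f \<circ> F i" for i by (simp_all add: F_def)
  have Fadd: "F (i + j) x = F i (F j x)" for i j x by (simp add: F_def funpow_add)
  have Fmod: "F (i mod m) x = F i x" for i x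
    unfolding F_def by (rule funpow_mod_eq) (simp add: fm)
  have injF: "inj (F i)" for i
  proof (rule inj_on_inverseI)
    fix x 
    have "F (m - i mod m) (F (i mod m) x) = F m x"
      unfolding Fadd[symmetric] using m by (simp add: less_imp_le)
    then show "F (m - i mod m) (F i x) = x" using Fmod fm by (simp add: F_def)
  qed
  have contF: "continuous_on UNIV (F i)" for i
    unfolding F_def by (rule continuous_on_funpow[OF contf])
  have Fdisj: "F i ` W \<inter> F j ` W = {}" if "i < m" "j < m" "i \<noteq> j" for i j
    using that
  proof (induction i j rule: linorder_wlog)
    case (le i j)
    show ?case
    proof (rule ccontr)
      assume "\<not> ?thesis"
      then obtain a b where ab: "a \<in> W" "b \<in> W" "F i a = F j b" by auto
      then have "F i a = F i (F (j - i) b)" using le by (simp flip: Fadd)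
      then have "a = F (j - i) b" using injF by (metis injD)
      moreover have "F (j - i) ` W \<inter> W = {}"
        unfolding F_def by (rule disj) (use le in auto)
      ultimately show False using ab by blast
    qed
  qed (use Int_commute in fast)
  have KF: "K = (\<Union>i<m. F i ` K0)" by (simp add: K F_def)
  have fK: "f x \<in> - K" if "x \<in> -K" for x
  proof
    assume "f x \<in> K"
    then obtain i k where ik: "i < m" "k \<in> K0" "f x = F i k" by (auto simp: KF)
    have "x = F m x" by (simp add: F_def fm)
    also have "\<dots> = F (m - 1) (f x)" using m Fadd[of "m - 1" 1 x] by (simp add: F_def)
    also have "\<dots> = F ((m - 1 + i) mod m) k" by (simp add: ik Fmod Fadd)
    finally show False using that ik m by (auto simp: KF)
  qed
  have FK: "F i \<in> -K \<rightarrow> -K" for i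
    using fK by (induction i) (simp_all add: F0 FS Pi_iff)
  have Fmu: "hom_induced q ?X (-K) ?X (-K) (F i) mu = mu" for i
  proof (induction i)
    case 0
    show ?case unfolding F0 by (rule hom_induced_id [OF mu])
  next
    case (Suc i)
    have "hom_induced q ?X (-K) ?X (-K) (F (Suc i)) mu 
      = hom_induced q ?X (-K) ?X (-K) f (hom_induced q ?X (-K) ?X (-K) (F i) mu)"
      unfolding FS using contF FK contf fK by (subst hom_induced_compose') (auto intro: continuous_on_subset)
    then show ?case using Suc inv by simp
  qed
  have sub: "W - K0 \<subseteq> -K"
    using Fdisj[of 0] W by (force simp: KF F0)
  have K0K: "F i ` K0 \<subseteq> K" if "i < m" for i
    using that by (auto simp: KF)
  have exc: "hom_induced q (subtopology ?X W) (W - K0) ?X (-K0) id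
     \<in> iso (relative_homology_group q (subtopology ?X W) (W - K0)) (relative_homology_group q ?X (-K0))"
  proof -
    have eq: "-K0 - (-W) = W - K0" "UNIV - (-W) = W" by auto
    have "hom_induced q (subtopology ?X (UNIV - (-W))) (-K0 - (-W)) (subtopology ?X UNIV) (-K0) id
      \<in> iso (relative_homology_group q (subtopology ?X (UNIV - (-W))) (-K0 - (-W)))
            (relative_homology_group q (subtopology ?X UNIV) (-K0))"
    proof (rule homology_excision_axiom)
      have "interior (-K0) = -K0" using clK[of 0] by (simp add: interior_open open_Compl)
      moreover have "closure (-W) = -W" using W by (simp add: closed_Compl closure_closed del: closure_complement)
      ultimately show "euclidean closure_of (-W) \<subseteq> euclidean interior_of (-K0)"
        using W by auto
    qed auto
    then show ?thesis unfolding eq subtopology_UNIV .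
  qed
  \<comment> \<open>By excision the part of \<open>mu\<close> along \<open>K0\<close> is represented
    inside \<open>W\<close>. Regarded as a class \<open>b0\<close> along all of \<open>K\<close>, it
    has no part along the other translates, which \<open>W\<close> misses.\<close>
  obtain \<beta> where \<beta>: "\<beta> \<in> carrier (relative_homology_group q (subtopology ?X W) (W - K0))"
    "hom_induced q (subtopology ?X W) (W - K0) ?X (-K0) id \<beta> = hom_induced q ?X (-K) ?X (-K0) id mu"
    using iso_surjD[OF exc hom_induced_carrier] by blast
  define b0 where "b0 = hom_induced q (subtopology ?X W) (W - K0) ?X (-K) id \<beta>"
  have b0: "b0 \<in> carrier ?HK" unfolding b0_def by (rule hom_induced_carrier)
  define t where "t = (\<lambda>i. hom_induced q ?X (-K) ?X (-K) (F i) b0)"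
  have t: "t i \<in> carrier ?HK" for i unfolding t_def by (rule hom_induced_carrier)
  have cW: "continuous_map (subtopology ?X W) ?X g" if "continuous_on UNIV g" for g :: "'a \<Rightarrow> 'a"
    using that by (auto intro: continuous_on_subset)
  have t_diag: "?r i (t i) = ?r i mu" if i: "i < m" for i
  proof -
    have F: "F i \<in> -K0 \<rightarrow> -(F i ` K0)" using injF[of i] by (auto dest: injD)
    have KK0: "id \<in> -K \<rightarrow> -K0" using K0K[of 0] m by (auto simp: F0)
    have *: "?r i (hom_induced q ?X (-K) ?X (-K) (F i) c) 
        = hom_induced q ?X (-K0) ?X (-(F i ` K0)) (F i) (hom_induced q ?X (-K) ?X (-K0) id c)" for c
    proof -
      have "?r i (hom_induced q ?X (-K) ?X (-K) (F i) c) = hom_induced q ?X (-K) ?X (-(F i ` K0)) (id \<circ> F i) c"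
        by (rule hom_induced_compose') (use contF FK K0K[OF i] in auto)
      also have "id \<circ> F i = F i \<circ> id" by simp
      also have "hom_induced q ?X (-K) ?X (-(F i ` K0)) (F i \<circ> id) c
         = hom_induced q ?X (-K0) ?X (-(F i ` K0)) (F i) (hom_induced q ?X (-K) ?X (-K0) id c)"
        by (rule hom_induced_compose'[symmetric]) (use contF F KK0 in auto)
      finally show ?thesis .
    qed
    have "hom_induced q ?X (-K) ?X (-K0) id b0 = hom_induced q (subtopology ?X W) (W - K0) ?X (-K0) (id \<circ> id) \<beta>"
      unfolding b0_def by (rule hom_induced_compose') (use sub KK0 in auto)
    also have "\<dots> = hom_induced q ?X (-K) ?X (-K0) id mu"
      using \<beta>(2) by simp
    finally have "?r i (t i) = ?r i (hom_induced q ?X (-K) ?X (-K) (F i) mu)"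
      unfolding t_def * by simp
    then show ?thesis by (simp only: Fmu)
  qed
  \<comment> \<open>\<open>F j\<close> sends all of \<open>W\<close> off the piece with index
    \<open>i\<close>, so the class factors through the homology of \<open>W\<close> relative to
    itself, which is trivial.\<close>
  have t_off: "?r i (t j) = \<one>\<^bsub>?H i\<^esub>" if ij: "i < m" "j < m" "i \<noteq> j" for i j
  proof -
    have FW: "F j \<in> W \<rightarrow> -(F i ` K0)" using Fdisj[OF ij] W by auto
    let ?W = "subtopology ?X W"
    have FKi: "id \<circ> F j \<in> -K \<rightarrow> -(F i ` K0)" using FK[of j] K0K[OF ij(1)] by auto
    have "?r i (t j) = hom_induced q ?X (-K) ?X (-(F i ` K0)) (id \<circ> F j) b0"
      unfolding t_def by (rule hom_induced_compose') (use contF FK K0K[OF ij(1)] in auto)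
    also have "\<dots> = hom_induced q ?W (W - K0) ?X (-(F i ` K0)) (id \<circ> F j \<circ> id) \<beta>"
      unfolding b0_def by (rule hom_induced_compose' [OF _ _ _ FKi]) (use contF sub in auto)
    also have "id \<circ> F j \<circ> id = F j \<circ> id" by simp
    also have "hom_induced q ?W (W - K0) ?X (-(F i ` K0)) (F j \<circ> id) \<beta>
       = hom_induced q ?W W ?X (-(F i ` K0)) (F j) (hom_induced q ?W (W - K0) ?W W id \<beta>)"
      by (rule hom_induced_compose'[symmetric]) (use cW[OF contF] FW in auto)
    also have "hom_induced q ?W (W - K0) ?W W id \<beta> = \<one>\<^bsub>relative_homology_group q ?W W\<^esub>"
      using trivial_relative_homology_group_topspace[of q ?W] hom_induced_carrier[of q ?W "W - K0" ?W W id \<beta>]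
      by (auto simp: trivial_group_def)
    finally show ?thesis by (simp only: hom_induced_one)
  qed
  define b where "b = hom_induced q ?X (-K) ?Y S h b0"
  have b: "b \<in> carrier ?HS" unfolding b_def by (rule hom_induced_carrier)
  have hF: "h \<circ> F i = h" for i
    by (induction i) (simp_all only: F0 FS hf comp_id flip: comp_assoc)
  have ht: "hom_induced q ?X (-K) ?Y S h (t i) = b" for i
  proof -
    have "hom_induced q ?X (-K) ?Y S h (t i) = hom_induced q ?X (-K) ?Y S (h \<circ> F i) b0"
      unfolding t_def by (rule hom_induced_compose') (use contF FK conth hS in auto)
    then show ?thesis by (simp add: hF b_def)
  qed
  interpret HK: group ?HK by simp
  interpret HS: group ?HS by simp
  have H1: "group (?H i)" for i by simp
  \<comment> \<open>Partial products of the translates: after \<open>k\<close> factors the class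
    agrees with \<open>mu\<close> along the first \<open>k\<close> pieces and is trivial along the
    remaining ones.\<close>
  have "\<exists>s\<in>carrier ?HK. hom_induced q ?X (-K) ?Y S h s = b [^]\<^bsub>?HS\<^esub> k \<and>
          (\<forall>i<m. ?r i s = (if i < k then ?r i mu else \<one>\<^bsub>?H i\<^esub>))" if "k \<le> m" for k
    using that
  proof (induction k)
    case 0
    show ?case by (rule bexI[of _ "\<one>\<^bsub>?HK\<^esub>"]) (simp_all add: hom_induced_one)
  next
    case (Suc k)
    from Suc.IH[OF Suc_leD[OF Suc.prems]]
    obtain s where s: "s \<in> carrier ?HK" "hom_induced q ?X (-K) ?Y S h s = b [^]\<^bsub>?HS\<^esub> k"
        "\<And>i. i < m \<Longrightarrow> ?r i s = (if i < k then ?r i mu else \<one>\<^bsub>?H i\<^esub>)"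
      by blast
    show ?case
    proof (intro bexI conjI allI impI)
      show "hom_induced q ?X (-K) ?Y S h (s \<otimes>\<^bsub>?HK\<^esub> t k) = b [^]\<^bsub>?HS\<^esub> Suc k"
        using s t by (simp add: hom_induced_mult ht)
      fix i assume i: "i < m"
      have "?r i (s \<otimes>\<^bsub>?HK\<^esub> t k) = ?r i s \<otimes>\<^bsub>?H i\<^esub> ?r i (t k)"
        using s t by (simp add: hom_induced_mult)
      also have "\<dots> = (if i < Suc k then ?r i mu else \<one>\<^bsub>?H i\<^esub>)"
        using s(3)[OF i] t_diag[OF i] t_off[OF i, of k] Suc.prems
          monoid.r_one[OF group.is_monoid[OF H1] hom_induced_carrier]
          monoid.l_one[OF group.is_monoid[OF H1] hom_induced_carrier]
          monoid.l_one[OF group.is_monoid[OF H1] monoid.one_closed[OF group.is_monoid[OF H1]]]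
        by (cases "i < k"; cases "i = k") (simp_all only: if_True if_False less_Suc_eq simp_thms less_irrefl Suc_le_eq)
      finally show "?r i (s \<otimes>\<^bsub>?HK\<^esub> t k) = (if i < Suc k then ?r i mu else \<one>\<^bsub>?H i\<^esub>)" .
    qed (use s t in auto)
  qed
  from this[of m] obtain s where s: "s \<in> carrier ?HK" "hom_induced q ?X (-K) ?Y S h s = b [^]\<^bsub>?HS\<^esub> m"
        "\<And>i. i < m \<Longrightarrow> ?r i s = ?r i mu"
    by auto
  have c: "s \<otimes>\<^bsub>?HK\<^esub> inv\<^bsub>?HK\<^esub> mu \<in> carrier ?HK"
    using s(1) mu by simp
  have "s \<otimes>\<^bsub>?HK\<^esub> inv\<^bsub>?HK\<^esub> mu = \<one>\<^bsub>?HK\<^esub>"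
    unfolding KF
  proof (rule local_homology_UN_injective)
    show "disjoint_family_on (\<lambda>i. F i ` K0) {..<m}"
      unfolding disjoint_family_on_def
    proof (intro ballI impI)
      fix i j assume "i \<in> {..<m}" "j \<in> {..<m}" "i \<noteq> j"
      then show "F i ` K0 \<inter> F j ` K0 = {}" using Fdisj[of i j] W(2) by blast
    qed
    fix i assume "i \<in> {..<m}"
    then have i: "i < m" by simp
    have "?r i (s \<otimes>\<^bsub>?HK\<^esub> inv\<^bsub>?HK\<^esub> mu) = ?r i mu \<otimes>\<^bsub>?H i\<^esub> inv\<^bsub>?H i\<^esub> ?r i mu"
      using s mu i by (simp add: hom_induced_mult hom_induced_inv)
    also have "\<dots> = \<one>\<^bsub>?H i\<^esub>"
      by (rule group.r_inv[OF H1 hom_induced_carrier])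
    finally show "hom_induced q euclidean (- (\<Union>i<m. F i ` K0)) euclidean (- F i ` K0) id
          (s \<otimes>\<^bsub>relative_homology_group q euclidean (- (\<Union>i<m. F i ` K0))\<^esub>
           inv\<^bsub>relative_homology_group q euclidean (- (\<Union>i<m. F i ` K0))\<^esub> mu) = \<one>\<^bsub>?H i\<^esub>"
      by (simp only: KF)
  qed (use clK c in \<open>simp_all add: F_def flip: KF[unfolded F_def]\<close>)
  then have "s = mu"
    by (metis HK.inv_equality HK.inv_inv HK.inv_closed mu s(1))
  with s b show ?thesis by blast
qed

section \<open>Homeomorphisms of finite order and bounded displacement\<close>

lemma hom_induced_linear_homotopy:
  fixes f g :: "'a::topological_space \<Rightarrow> 'b::real_normed_vector"
  assumes contf: "continuous_on UNIV f" and contg: "continuous_on UNIV g"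
    and seg: "\<And>x. x \<in> S \<Longrightarrow> closed_segment (f x) (g x) \<subseteq> T"
  shows "hom_induced p euclidean S euclidean T f = hom_induced p euclidean S euclidean T g"
proof (rule homology_homotopy_axiom)
  let ?H = "\<lambda>z. (1 - fst z) *\<^sub>R f (snd z) + fst z *\<^sub>R g (snd z)"
  have "continuous_map (prod_topology (top_of_set {0..1}) (top_of_set UNIV)) euclidean ?H"
    unfolding prod_topology_subtopology_eu
    by (simp, intro continuous_intros continuous_on_compose2 [OF contf] continuous_on_compose2 [OF contg]) auto
  moreover have "(\<lambda>x. ?H (t, x)) \<in> S \<rightarrow> T" if "t \<in> {0..1}" for t
  proof
    fix x assume "x \<in> S"
    then show "?H (t, x) \<in> T"
      using seg that by (force simp: closed_segment_def)
  qed
  ultimately show "homotopic_with (\<lambda>h. h \<in> S \<rightarrow> T) euclidean euclidean f g"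
    unfolding homotopic_with_def by (intro exI[of _ ?H]) (auto simp: subtopology_UNIV)
qed

text \<open>The degree of h is 1, because h has bounded displacement. As f also has degree 1 and h is
  f-invariant, the m translates of the part of the fibre in W contribute equally to the degree of h
  over y, so m divides it.\<close>
theorem no_invariant_map_with_split_fibre:
  fixes f h :: "'a::euclidean_space \<Rightarrow> 'a"
  assumes contf: "continuous_on UNIV f" and fm: "f ^^ m = id" and m: "m \<ge> 2"
    and Df: "\<And>x. norm (f x - x) \<le> D"
    and conth: "continuous_on UNIV h" and hf: "h \<circ> f = h" and Dh: "\<And>x. norm (h x - x) \<le> D"
    and W: "open W" and disj: "\<And>i. 0 < i \<Longrightarrow> i < m \<Longrightarrow> (f ^^ i) ` W \<inter> W = {}"
    and cover: "h -` {y} \<subseteq> (\<Union>i<m. (f ^^ i) ` W)"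
  shows False
proof -
  let ?X = "euclidean :: 'a topology" and ?q = "int DIM('a)"
  let ?Hy = "relative_homology_group ?q ?X (-{y})"
  define K where "K = h -` {y}"
  define K0 where "K0 = K \<inter> W"
  note contF = continuous_on_funpow[OF contf]
  have hF: "h ((f ^^ i) x) = h x" for i x
    using hf by (induction i) (auto simp: fun_eq_iff)
  \<comment> \<open>By periodicity the inverse of an iterate is an iterate, so forward images of
    open sets are preimages and therefore open.\<close>
  have img: "(f ^^ i) ` W = (f ^^ (m - i)) -` W" if "i < m" for i
  proof -
    have 1: "(f ^^ i) ((f ^^ (m - i)) x) = x" "(f ^^ (m - i)) ((f ^^ i) x) = x" for x
      using that fm by (metis funpow_add comp_apply id_apply le_add_diff_inverse less_imp_le,
          metis funpow_add comp_apply id_apply le_add_diff_inverse2 less_imp_le)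
    show ?thesis
    proof
      show "(f ^^ (m - i)) -` W \<subseteq> (f ^^ i) ` W"
        using 1(1) by (metis (no_types, opaque_lifting) image_eqI subsetI vimageE)
    qed (use 1(2) in auto)
  qed
  have opW: "open ((f ^^ i) ` W)" if "i < m" for i
    unfolding img[OF that] using W contF by (intro open_vimage) auto
  have clK: "closed K"
    unfolding K_def using conth by (intro closed_vimage) auto
  have KD: "K \<subseteq> cball y D"
  proof
    fix x assume "x \<in> K"
    then show "x \<in> cball y D" using Dh[of x] by (simp add: K_def dist_norm)
  qed
  \<comment> \<open>\<open>K0\<close> is cut out of \<open>K\<close> by an open set. It is also
    closed, because the translates of \<open>W\<close> cover \<open>K\<close> and the others miss
    \<open>W\<close>: it is what they leave over.\<close>
  have "K0 = K \<inter> - (\<Union>i\<in>{1..<m}. (f ^^ i) ` W)"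
  proof
    show "K0 \<subseteq> K \<inter> - (\<Union>i\<in>{1..<m}. (f ^^ i) ` W)"
    proof
      fix x assume x: "x \<in> K0"
      have "x \<notin> (f ^^ i) ` W" if "i \<in> {1..<m}" for i
        using disj[of i] that x unfolding K0_def by auto
      then show "x \<in> K \<inter> - (\<Union>i\<in>{1..<m}. (f ^^ i) ` W)"
        using x by (simp add: K0_def)
    qed
    show "K \<inter> - (\<Union>i\<in>{1..<m}. (f ^^ i) ` W) \<subseteq> K0"
    proof
      fix x assume x: "x \<in> K \<inter> - (\<Union>i\<in>{1..<m}. (f ^^ i) ` W)"
      then obtain i where i: "i < m" "x \<in> (f ^^ i) ` W" using cover by (auto simp: K_def)
      with x have "i \<notin> {1..<m}" by blast
      with i have "i = 0" by auto
      with i x show "x \<in> K0" by (simp add: K0_def)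
    qed
  qed
  then have "closed K0"
    using clK opW by (simp only:) (intro closed_Int closed_Compl open_UN ballI, auto)
  moreover have "bounded K0"
    using KD by (intro bounded_subset[OF bounded_cball[of y D]]) (auto simp: K0_def)
  ultimately have "compact K0" by (simp add: compact_eq_bounded_closed)
  then have clK0: "closed ((f ^^ i) ` K0)" for i
    by (intro compact_imp_closed compact_continuous_image continuous_on_subset[OF contF]) auto
  have KU: "K = (\<Union>i<m. (f ^^ i) ` K0)"
  proof
    show "K \<subseteq> (\<Union>i<m. (f ^^ i) ` K0)"
    proof
      fix x assume x: "x \<in> K"
      then obtain i w where i: "i < m" "w \<in> W" "x = (f ^^ i) w" using cover by (auto simp: K_def)
      then have "w \<in> K0" using x hF by (auto simp: K0_def K_def)
      with i show "x \<in> (\<Union>i<m. (f ^^ i) ` K0)" by auto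
    qed
    show "(\<Union>i<m. (f ^^ i) ` K0) \<subseteq> K"
      by (auto simp: K0_def K_def hF)
  qed
  have D0: "D \<ge> 0" using Df[of 0] norm_ge_zero order_trans by blast
  \<comment> \<open>If a point at distance more than \<open>2 * D\<close> from \<open>y\<close> is
    moved by at most \<open>D\<close>, the whole segment stays outside \<open>cball y D\<close>,
    which contains \<open>y\<close> and the fibre. The extra 1 keeps \<open>r\<close> positive when
    \<open>D\<close> is 0.\<close>
  define r where "r = 2 * D + 1"
  have r: "r > 0" using D0 by (simp add: r_def)
  obtain \<phi> where \<phi>: "\<phi> \<in> iso ?Hy integer_group"
    using isomorphic_local_homology_integer_group[of y] by (auto simp: is_iso_def)
  obtain \<tau> where \<tau>: "\<tau> \<in> carrier ?Hy" "\<phi> \<tau> = 1"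
    using iso_surjD[OF \<phi>, of 1] by auto
  obtain g where g: "g \<in> carrier (relative_homology_group ?q ?X (-cball y r))"
    "hom_induced ?q ?X (-cball y r) ?X (-{y}) id g = \<tau>"
    using surj_local_homology_cball[OF r \<tau>(1)] .
  \<comment> \<open>The orientation class along the fibre. It is taken from a class along the large
    ball so that \<open>f\<close> and \<open>h\<close> act on it as the identity would.\<close>
  define mu where "mu = hom_induced ?q ?X (-cball y r) ?X (-K) id g"
  have far: "z \<notin> cball y D" if "x \<notin> cball y r" "norm (u - x) \<le> D" "z \<in> closed_segment u x" for x u z
  proof -
    have "u \<in> cball x D" "x \<in> cball x D" using that D0 by (auto simp: dist_norm norm_minus_commute)
    then have "z \<in> cball x D"
      using that(3) closed_segment_subset[OF _ _ convex_cball] by blast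
    moreover have "dist y x \<le> dist y z + dist x z" by (metis dist_commute dist_triangle)
    ultimately show ?thesis using that(1) D0 by (auto simp: r_def)
  qed
  have Kr: "-cball y r \<subseteq> -K"
  proof -
    have "cball y D \<subseteq> cball y r" using D0 by (intro subset_cball) (simp add: r_def)
    then show ?thesis using KD by blast
  qed
  have cid: "continuous_on UNIV (id :: 'a \<Rightarrow> 'a)" by simp
  have fK: "f \<in> -K \<rightarrow> -K" using hf by (auto simp: K_def fun_eq_iff)
  have hK: "h \<in> -K \<rightarrow> -{y}" by (auto simp: K_def)
  have inv: "hom_induced ?q ?X (-K) ?X (-K) f mu = mu"
  proof -
    have "hom_induced ?q ?X (-K) ?X (-K) f mu = hom_induced ?q ?X (-cball y r) ?X (-K) (f \<circ> id) g"
      unfolding mu_def by (rule hom_induced_compose') (use contf fK Kr in auto)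
    also have "f \<circ> id = f" by simp
    also have "hom_induced ?q ?X (-cball y r) ?X (-K) f = hom_induced ?q ?X (-cball y r) ?X (-K) id"
    proof (rule hom_induced_linear_homotopy [OF contf cid])
      show "closed_segment (f x) (id x) \<subseteq> -K" if "x \<in> -cball y r" for x
      proof
        fix z assume "z \<in> closed_segment (f x) (id x)"
        then have "z \<notin> cball y D" using far[OF _ Df, of x z] that by simp
        then show "z \<in> -K" using KD by blast
      qed
    qed
    finally show ?thesis by (simp add: mu_def)
  qed
  have hmu: "hom_induced ?q ?X (-K) ?X (-{y}) h mu = \<tau>"
  proof -
    have "hom_induced ?q ?X (-K) ?X (-{y}) h mu = hom_induced ?q ?X (-cball y r) ?X (-{y}) (h \<circ> id) g"
      unfolding mu_def by (rule hom_induced_compose') (use conth hK Kr in auto)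
    also have "h \<circ> id = h" by simp
    also have "hom_induced ?q ?X (-cball y r) ?X (-{y}) h = hom_induced ?q ?X (-cball y r) ?X (-{y}) id"
    proof (rule hom_induced_linear_homotopy [OF conth cid])
      show "closed_segment (h x) (id x) \<subseteq> -{y}" if "x \<in> -cball y r" for x
      proof
        fix z assume "z \<in> closed_segment (h x) (id x)"
        then have "z \<notin> cball y D" using far[OF _ Dh, of x z] that by simp
        then show "z \<in> -{y}" using D0 by auto
      qed
    qed
    finally show ?thesis by (simp only: g)
  qed
  have "mu \<in> carrier (relative_homology_group ?q ?X (-K))"
    unfolding mu_def by (rule hom_induced_carrier)
  then obtain b where b: "b \<in> carrier ?Hy" "\<tau> = b [^]\<^bsub>?Hy\<^esub> m"
    using local_homology_invariant_class_power[OF contf fm _ clK0 W _ disj KU conth hf hK _ inv] m hmu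
    by (auto simp: K0_def)
  interpret group_hom ?Hy integer_group \<phi>
    using \<phi> by (simp add: group_hom_def group_hom_axioms_def iso_def)
  have "1 = int m * \<phi> b"
    using \<tau>(2) b by (simp add: hom_nat_pow)
  then have "int m dvd 1" by (metis dvd_triv_left)
  with m show False by simp
qed

section \<open>Orbits of a periodic map, free sets and the splitting of invariant fibres\<close>

locale periodic_map =
  fixes f :: "'a::euclidean_space \<Rightarrow> 'a" and m :: nat
  assumes contf: "continuous_on UNIV f" and fm: "f ^^ m = id" and mpos: "m > 0"
begin

definition orb :: "'a set \<Rightarrow> 'a set" where "orb S = (\<Union>i. (f ^^ i) ` S)"

definition free :: "'a set \<Rightarrow> bool"
  where "free S \<longleftrightarrow> (\<forall>i. 0 < i \<longrightarrow> i < m \<longrightarrow> (f ^^ i) ` S \<inter> S = {})"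

lemma free_subset: "free S \<Longrightarrow> T \<subseteq> S \<Longrightarrow> free T"
  unfolding free_def by blast

lemmas cont_funpow = continuous_on_funpow[OF contf]

lemma funpow_mod: "(f ^^ (i mod m)) x = (f ^^ i) x"
  by (rule funpow_mod_eq) (simp add: fm)

lemma orb_finite: "orb S = (\<Union>i<m. (f ^^ i) ` S)"
proof
  show "orb S \<subseteq> (\<Union>i<m. (f ^^ i) ` S)"
    unfolding orb_def
  proof safe
    fix i x assume "x \<in> S"
    then have "(f ^^ (i mod m)) x \<in> (\<Union>i<m. (f ^^ i) ` S)" using mpos by auto
    then show "(f ^^ i) x \<in> (\<Union>i<m. (f ^^ i) ` S)" by (simp add: funpow_mod)
  qed
qed (auto simp: orb_def)

lemma funpow_funpow: "(f ^^ i) ((f ^^ j) x) = (f ^^ (i + j)) x"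
  by (simp add: funpow_add)

lemma orb_iff: "x \<in> orb S \<longleftrightarrow> (\<exists>i. \<exists>s\<in>S. x = (f ^^ i) s)"
  by (auto simp: orb_def)

lemma subset_orb: "S \<subseteq> orb S"
  unfolding orb_def using UN_upper[of 0 UNIV "\<lambda>i. (f ^^ i) ` S"] by simp

lemma orb_funpow: "x \<in> orb S \<Longrightarrow> (f ^^ i) x \<in> orb S"
  unfolding orb_iff by (metis funpow_funpow)

lemma funpow_mult_period: "(f ^^ (m * k)) x = x"
  using funpow_mod[of "m * k" x] by simp

lemma orb_funpow_iff: "(f ^^ i) x \<in> orb S \<longleftrightarrow> x \<in> orb S"
proof
  assume "(f ^^ i) x \<in> orb S"
  \<comment> \<open>As \<open>m\<close> is positive, the natural difference \<open>m * i - i\<close>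
    is a true inverse exponent of \<open>i\<close> modulo \<open>m\<close>.\<close>
  then have "(f ^^ (m * i - i)) ((f ^^ i) x) \<in> orb S" by (rule orb_funpow)
  also have "(f ^^ (m * i - i)) ((f ^^ i) x) = (f ^^ (m * i)) x"
    using mpos by (simp add: funpow_funpow)
  finally show "x \<in> orb S" by (simp add: funpow_mult_period)
qed (rule orb_funpow)

lemma closed_orb: "compact S \<Longrightarrow> closed (orb S)"
  unfolding orb_finite
  by (intro closed_UN ballI compact_imp_closed compact_continuous_image continuous_on_subset[OF cont_funpow]) auto

lemma ex_free_cball:
  assumes "\<And>i. 0 < i \<Longrightarrow> i < m \<Longrightarrow> (f ^^ i) x \<noteq> x"
  obtains r where "r > 0" "free (cball x r)"
proof -
  have "\<forall>\<^sub>F r in at_right 0. (f ^^ i) ` cball x r \<inter> cball x r = {}" if "i \<in> {0<..<m}" for i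
  proof -
    obtain U V where UV: "open U" "open V" "(f ^^ i) x \<in> U" "x \<in> V" "U \<inter> V = {}"
      using hausdorff[OF assms[of i]] \<open>i \<in> _\<close> by auto
    have "open ((f ^^ i) -` U \<inter> V)"
      using UV cont_funpow by (intro open_Int open_vimage) auto
    then obtain e where e: "e > 0" "ball x e \<subseteq> (f ^^ i) -` U \<inter> V"
      using UV(3,4) unfolding open_contains_ball by blast
    have "(f ^^ i) ` cball x r \<inter> cball x r = {}" if "r < e" for r
    proof -
      have "cball x r \<subseteq> ball x e" using that by auto
      then show ?thesis using e(2) UV(5) by blast
    qed
    then show ?thesis using e(1) by (auto simp: eventually_at_right_field)
  qed
  then have "\<forall>\<^sub>F r in at_right 0. \<forall>i\<in>{0<..<m}. (f ^^ i) ` cball x r \<inter> cball x r = {}"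
    by (intro eventually_ball_finite) auto
  then have "\<forall>\<^sub>F r in at_right 0. r > 0 \<and> free (cball x r)"
    using eventually_at_right_less[of 0] by eventually_elim (auto simp: free_def)
  then show thesis
    using that eventually_happens'[OF trivial_limit_at_right_real] by blast
qed

text \<open>On the sphere the perturbed map is a translate of a polynomial map, which maps null sets to
  null sets.\<close>
lemma perturb_off_sphere:
  assumes conth: "continuous_on UNIV h" and hf: "h \<circ> f = h" and r: "r > 0"
    and free: "free (cball c r)" and e: "e > 0"
  obtains h' :: "'a \<Rightarrow> 'a" where "continuous_on UNIV h'" "h' \<circ> f = h'"
    "\<And>z. norm (h' z - h z) \<le> e" "y \<notin> h' ` sphere c (r/2)"
proof -
  \<comment> \<open>The final correction is a sum of \<open>m\<close> terms, each of norm at most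
    \<open>d\<close>.\<close>
  define d where "d = e / real m"
  have d: "d > 0" using e mpos by (simp add: d_def)
  obtain q where q: "polynomial_function q" "\<And>z. z \<in> cball c r \<Longrightarrow> norm (h z - q z) < d/2"
    using Stone_Weierstrass_polynomial_function[OF compact_cball continuous_on_subset[OF conth], of c r "d/2"] d
    by auto
  have "negligible (q ` sphere c (r/2))"
    using q(1) by (intro negligible_differentiable_image_negligible negligible_sphere
        differentiable_on_polynomial_function) auto
  moreover have "\<not> negligible (ball y (d/2))"
    using d by (intro open_not_negligible) auto
  \<comment> \<open>A value close to \<open>y\<close> that the polynomial misses on the sphere;
    adding \<open>y - v\<close> to the polynomial gives a map that misses \<open>y\<close> itself
    there.\<close>
  ultimately obtain v where v: "v \<in> ball y (d/2)" "v \<notin> q ` sphere c (r/2)"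
    using negligible_subset by blast
  define w where "w = y - v"
  have w: "norm w < d/2" using v(1) by (simp add: w_def dist_norm)
  \<comment> \<open>Equal to 1 at distance \<open>r/2\<close> from \<open>c\<close> and 0 from
    distance \<open>r\<close> on, so that the correction is supported in the free ball.\<close>
  define bump where "bump = (\<lambda>z. max 0 (min 1 (2 - 2 * dist c z / r)))"
  define E where "E = (\<lambda>z. bump z *\<^sub>R (q z + w - h z))"
  have contE: "continuous_on UNIV E"
    unfolding E_def bump_def using r continuous_on_polymonial_function[OF q(1)]
    by (intro continuous_intros conth) auto
  have E0: "E z = 0" if "z \<notin> cball c r" for z
    using that r by (auto simp: E_def bump_def field_simps max_def)
  have E1: "E z = q z + w - h z" if "z \<in> sphere c (r/2)" for z
    using that r by (auto simp: E_def bump_def)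
  have normE: "norm (E z) \<le> d" for z
  proof (cases "z \<in> cball c r")
    case True
    have "norm (q z + w - h z) \<le> norm (h z - q z) + norm w"
      using norm_triangle_ineq4[of w "h z - q z"] by (simp add: algebra_simps)
    also have "\<dots> \<le> d" using q(2)[OF True] w by linarith
    finally have "norm (q z + w - h z) \<le> d" .
    moreover have "0 \<le> bump z" "bump z \<le> 1" by (auto simp: bump_def)
    ultimately have "bump z * norm (q z + w - h z) \<le> 1 * d"
      by (intro mult_mono) auto
    then show ?thesis using \<open>0 \<le> bump z\<close> by (simp add: E_def)
  qed (use E0 d in auto)
  \<comment> \<open>Summing over the iterates makes the correction invariant under \<open>f\<close>.
    On the sphere only the term \<open>i = 0\<close> survives, because the ball is free.\<close>
  define h' where "h' = (\<lambda>z. h z + (\<Sum>i<m. E ((f ^^ i) z)))"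
  show thesis
  proof
    show "continuous_on UNIV h'"
      unfolding h'_def
      by (intro continuous_intros conth continuous_on_compose2[OF contE cont_funpow]) auto
    show "h' \<circ> f = h'"
    proof
      fix z
      have "(\<Sum>i<m. E ((f ^^ i) (f z))) + E z = (\<Sum>i<Suc m. E ((f ^^ i) z))"
        unfolding sum.lessThan_Suc_shift by (simp add: funpow_swap1)
      also have "\<dots> = (\<Sum>i<m. E ((f ^^ i) z)) + E z"
        by (simp add: fm)
      finally show "(h' \<circ> f) z = h' z"
        using hf by (simp add: h'_def fun_eq_iff)
    qed
    fix z
    have "norm (\<Sum>i<m. E ((f ^^ i) z)) \<le> real m * d"
      using sum_norm_bound[of "{..<m}" "\<lambda>i. E ((f ^^ i) z)" d] normE by simp
    then show "norm (h' z - h z) \<le> e"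
      using mpos by (simp add: h'_def d_def)
  next
    show "y \<notin> h' ` sphere c (r/2)"
    proof
      assume "y \<in> h' ` sphere c (r/2)"
      then obtain s where s: "s \<in> sphere c (r/2)" "y = h' s" by auto
      have sc: "s \<in> cball c r" using s r by auto
      have "(\<Sum>i<m. E ((f ^^ i) s)) = (\<Sum>i\<in>{0}. E ((f ^^ i) s))"
      proof (rule sum.mono_neutral_right)
        show "\<forall>i\<in>{..<m} - {0}. E ((f ^^ i) s) = 0"
        proof
          fix i assume "i \<in> {..<m} - {0}"
          then have "(f ^^ i) s \<notin> cball c r"
            using free sc unfolding free_def by blast
          then show "E ((f ^^ i) s) = 0" by (rule E0)
        qed
      qed (use mpos in auto)
      then have "h' s = q s + w" by (simp add: h'_def E1[OF s(1)])
      then have "v = q s" using s(2) by (simp add: w_def)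
      then show False using v(2) s(1) by blast
    qed
  qed
qed

text \<open>The spheres are cleared one after another. Those already cleared have compact images at
  some distance \<open>\<eta>\<close> from \<open>y\<close>, and the next perturbation moves values
  by at most \<open>\<eta>/2\<close>, so they stay clear.\<close>

lemma perturb_off_spheres:
  assumes "finite J" and conth: "continuous_on UNIV h" and hf: "h \<circ> f = h"
    and "\<And>c. c \<in> J \<Longrightarrow> r c > 0 \<and> free (cball c (r c))" and "e > 0"
  shows "\<exists>h'::'a \<Rightarrow> 'a. continuous_on UNIV h' \<and> h' \<circ> f = h' \<and> (\<forall>z. norm (h' z - h z) \<le> e) \<and>
     (\<forall>c\<in>J. y \<notin> h' ` sphere c (r c/2))"
  using assms(1,4,5)
proof (induction J arbitrary: e rule: finite_induct)
  case empty
  then show ?case by (intro exI[of _ h]) (use conth hf in auto)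
next
  case (insert c J)
  obtain h1 :: "'a \<Rightarrow> 'a" where h1: "continuous_on UNIV h1" "h1 \<circ> f = h1" "\<And>z. norm (h1 z - h z) \<le> e/2"
     "\<And>c. c \<in> J \<Longrightarrow> y \<notin> h1 ` sphere c (r c/2)"
    using insert.IH[of "e/2"] insert.prems half_gt_zero by blast
  have "closed (\<Union>c\<in>J. h1 ` sphere c (r c/2))"
    using insert.hyps
    by (intro closed_UN ballI compact_imp_closed compact_continuous_image continuous_on_subset[OF h1(1)]) auto
  moreover have "y \<notin> (\<Union>c\<in>J. h1 ` sphere c (r c/2))"
    using h1(4) by (simp only: UN_iff) metis
  ultimately obtain \<eta> where \<eta>: "\<eta> > 0" "\<And>x. x \<in> (\<Union>c\<in>J. h1 ` sphere c (r c/2)) \<Longrightarrow> \<eta> \<le> dist y x"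
    using separate_point_closed by metis
  obtain h2 :: "'a \<Rightarrow> 'a" where h2: "continuous_on UNIV h2" "h2 \<circ> f = h2"
     "\<And>z. norm (h2 z - h1 z) \<le> min (e/2) (\<eta>/2)" "y \<notin> h2 ` sphere c (r c/2)"
    using perturb_off_sphere[OF h1(1,2), of "r c" c "min (e/2) (\<eta>/2)"] insert.prems \<eta>(1) by auto
  show ?case
  proof (intro exI[of _ h2] conjI allI ballI)
    fix z
    have "norm (h2 z - h z) \<le> norm (h2 z - h1 z) + norm (h1 z - h z)"
      using norm_triangle_ineq[of "h2 z - h1 z" "h1 z - h z"] by simp
    then show "norm (h2 z - h z) \<le> e" using h2(3)[of z] h1(3)[of z] by simp
  next
    fix c' assume c': "c' \<in> insert c J"
    show "y \<notin> h2 ` sphere c' (r c'/2)"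
    proof (cases "c' = c")
      case False
      show ?thesis
      proof
        assume "y \<in> h2 ` sphere c' (r c'/2)"
        then obtain s where s: "s \<in> sphere c' (r c'/2)" "y = h2 s" by auto
        then have "\<eta> \<le> norm (h2 s - h1 s)" using \<eta>(2)[of "h1 s"] c' False
            by (metis (no_types, lifting) UN_iff dist_norm imageI insertE)
        then show False using h2(3)[of s] \<eta>(1) by simp
      qed
    qed (use h2 in simp)
  qed (use h2 in auto)
qed

text \<open>The balls and their translates may overlap, so they cannot simply be united. Each new
  ball takes its whole orbit away from the set built so far. Removing the orbit of the closed ball
  keeps that set open, and since \<open>K\<close> misses the bounding sphere, putting back the open
  ball recovers, up to translation, every point of \<open>K\<close> that was lost.\<close>

lemma split_by_balls:
  assumes "finite J" and "\<And>c. c \<in> J \<Longrightarrow> free (cball c (s c))"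
    and "\<And>c. c \<in> J \<Longrightarrow> K \<inter> sphere c (s c) = {}" and KI: "\<And>x i. (f ^^ i) x \<in> K \<Longrightarrow> x \<in> K"
  shows "\<exists>W. open W \<and> free W \<and> K \<inter> orb (\<Union>c\<in>J. ball c (s c)) \<subseteq> orb W"
  using assms(1-3)
proof (induction J rule: finite_induct)
  case empty
  show ?case by (intro exI[of _ "{}"]) (auto simp: free_def orb_def)
next
  case (insert c J)
  then obtain W where W: "open W" "free W" "K \<inter> orb (\<Union>c\<in>J. ball c (s c)) \<subseteq> orb W" by auto
  let ?C = "cball c (s c)" and ?B = "ball c (s c)"
  define W' where "W' = (W - orb ?C) \<union> ?B"
  have CB: "x \<in> ?B" if "x \<in> ?C" "x \<in> K" for x
    using insert.prems(2)[of c] that by fastforce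
  have fC: "free ?C" using insert.prems by auto
  have BC: "?B \<subseteq> ?C" by auto
  have "open W'"
    unfolding W'_def using W(1) closed_orb[of ?C] by (intro open_Un open_Diff) auto
  moreover have "free W'"
    unfolding free_def
  proof (intro allI impI)
    fix i assume i: "0 < i" "i < m"
    show "(f ^^ i) ` W' \<inter> W' = {}"
    proof (rule ccontr)
      assume "\<not> ?thesis"
      then obtain a where a: "a \<in> W'" "(f ^^ i) a \<in> W'" by auto
      have 1: "\<not> (a \<in> W \<and> (f ^^ i) a \<in> W)" using W(2) i unfolding free_def by blast
      have 2: "\<not> (a \<in> ?C \<and> (f ^^ i) a \<in> ?C)" using fC i unfolding free_def by blast
      \<comment> \<open>Excludes mixed pairs: a point of the new ball puts its whole orbit into
        \<open>orb ?C\<close>, which was removed from \<open>W\<close>.\<close>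
      have 3: "x \<in> orb ?C" if "x \<in> ?B" for x using that subset_orb BC by blast
      show False using a 1 2 3 orb_funpow_iff[of i a ?C] BC unfolding W'_def by blast
    qed
  qed
  moreover have "K \<inter> orb (\<Union>c\<in>insert c J. ball c (s c)) \<subseteq> orb W'"
  proof
    have *: "x \<in> orb W'" if x: "x \<in> K" "x \<in> orb ?C" for x
    proof -
      obtain i z where iz: "z \<in> ?C" "x = (f ^^ i) z" using x by (auto simp: orb_iff)
      then have "z \<in> ?B" using CB KI x by blast
      then have "z \<in> W'" by (simp add: W'_def)
      then show ?thesis using iz(2) unfolding orb_iff by blast
    qed
    fix x assume x: "x \<in> K \<inter> orb (\<Union>c\<in>insert c J. ball c (s c))"
    show "x \<in> orb W'"
    proof (cases "x \<in> orb ?C")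
      case False
      moreover have "x \<in> orb ?B \<or> x \<in> orb (\<Union>c\<in>J. ball c (s c))"
        using x unfolding UN_insert orb_def image_Un by blast
      moreover have "orb ?B \<subseteq> orb ?C" using BC unfolding orb_def by blast
      ultimately have "x \<in> orb W" using W(3) x by blast
      then obtain i z where iz: "z \<in> W" "x = (f ^^ i) z" by (auto simp: orb_iff)
      then have "z \<notin> orb ?C" using False orb_funpow_iff by blast
      then have "z \<in> W'" using iz(1) by (simp add: W'_def)
      then show ?thesis using iz(2) unfolding orb_iff by blast
    qed (use * x in auto)
  qed
  ultimately show ?case by blast
qed

end

text \<open>The average \<open>h\<close> fixes every fixed point of \<open>f\<close>, so the fibre
  over a moved point \<open>y\<close> contains no fixed point, and primality makes all of its orbits
  free. Finitely many free balls cover the compact fibre, and a perturbation that clears their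
  bounding spheres lets it split into \<open>p\<close> translates.\<close>

theorem prime_period_bounded_displacement:
  fixes f :: "'a::euclidean_space \<Rightarrow> 'a"
  assumes contf: "continuous_on UNIV f" and fp: "f ^^ p = id" and p: "prime p"
    and Df: "\<And>x. norm (f x - x) \<le> D"
  shows "f = id"
proof (rule ccontr)
  assume "f \<noteq> id"
  then obtain y where y: "f y \<noteq> y" by (auto simp: fun_eq_iff)
  have p2: "p \<ge> 2" using p by (simp add: prime_ge_2_nat)
  interpret periodic_map f p
    by unfold_locales (use contf fp p2 in auto)
  have D0: "D \<ge> 0" using Df[of 0] norm_ge_zero order_trans by blast
  note DF = funpow_displacement[OF Df]
  define h where "h = (\<lambda>x. (1 / real p) *\<^sub>R (\<Sum>i<p. (f ^^ i) x))"
  have conth: "continuous_on UNIV h"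
    unfolding h_def by (intro continuous_intros cont_funpow)
  have hf: "h \<circ> f = h"
  proof
    fix z
    have "(\<Sum>i<p. (f ^^ i) (f z)) + z = (\<Sum>i<Suc p. (f ^^ i) z)"
      unfolding sum.lessThan_Suc_shift by (simp add: funpow_swap1)
    also have "\<dots> = (\<Sum>i<p. (f ^^ i) z) + z" by (simp add: fp)
    finally show "(h \<circ> f) z = h z" by (simp add: h_def)
  qed
  \<comment> \<open>A common bound for \<open>f\<close> and for the perturbed average, whose
    displacement is at most \<open>p * D\<close> plus the size of the perturbation.\<close>
  define D' where "D' = real p * D + 1"
  have DD': "D \<le> D'" using D0 p2 mult_right_mono[of 1 "real p" D] by (simp add: D'_def)
  have Dh: "norm (h x - x) \<le> real p * D" for x
  proof -
    have "h x - x = (1 / real p) *\<^sub>R (\<Sum>i<p. (f ^^ i) x - x)"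
      using p2 sum_constant_scaleR[of x "{..<p}"]
      by (simp add: h_def sum_subtractf scaleR_diff_right del: sum_constant sum_constant_scaleR)
    also have "norm \<dots> = (1 / real p) * norm (\<Sum>i<p. (f ^^ i) x - x)" by simp
    also have "\<dots> \<le> (1 / real p) * (real p * (real p * D))"
    proof (intro mult_left_mono)
      have "norm ((f ^^ i) x - x) \<le> real p * D" if "i < p" for i
        using DF[of i x] that D0 by (meson less_imp_le mult_right_mono of_nat_mono order_trans)
      then show "norm (\<Sum>i<p. (f ^^ i) x - x) \<le> real p * (real p * D)"
        using sum_norm_bound[of "{..<p}" "\<lambda>i. (f ^^ i) x - x" "real p * D"] by simp
    qed simp
    finally show ?thesis using p2 by simp
  qed
  have hfix: "h x = x" if "f x = x" for x
  proof -
    have "(f ^^ i) x = x" for i using that by (induction i) auto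
    then have "h x = (1 / real p) *\<^sub>R (real p *\<^sub>R x)"
      unfolding h_def by (simp only: sum_constant_scaleR card_lessThan)
    then show ?thesis using p2 by simp
  qed
  have nofix: "(f ^^ i) x \<noteq> x" if x: "f x \<noteq> x" and i: "0 < i" "i < p" for x i
  proof (rule notI)
    assume fx: "(f ^^ i) x = x"
    \<comment> \<open>Bezout: some multiple of \<open>i\<close> exceeds a multiple of
      \<open>p\<close> by one, so a fixed point of the \<open>i\<close>-th iterate would be fixed by
      \<open>f\<close> itself.\<close>
    have "\<not> p dvd i" by (rule nat_dvd_not_less[OF i])
    then have "gcd i p = 1"
      using prime_imp_coprime_nat[OF p] by (simp add: coprime_iff_gcd_eq_1 gcd.commute)
    moreover have "i \<noteq> 0" using i by simp
    ultimately obtain a b where ab: "i * a = p * b + 1"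
      using bezout_nat[of i p] by metis
    have "(f ^^ (a * i)) x = x"
    proof (induction a)
      case (Suc a)
      then show ?case using fx funpow_funpow[of i "a * i" x] by simp
    qed simp
    moreover have "(f ^^ (i * a)) x = f ((f ^^ (p * b)) x)" unfolding ab by simp
    ultimately show False
      using x unfolding funpow_mult_period by (simp add: mult.commute)
  qed
  have hy: "f x \<noteq> x" if "h x = y" for x using that y hfix by metis
  have "\<exists>r>0. free (cball x r)" if "h x = y" for x
    using ex_free_cball[of x] nofix[OF hy[OF that]] by metis
  then obtain r where r: "\<And>x. h x = y \<Longrightarrow> r x > 0 \<and> free (cball x (r x))" by metis
  define K where "K = h -` {y}"
  have "closed K" unfolding K_def using conth by (intro closed_vimage) auto
  moreover have "K \<subseteq> cball y (real p * D)"
  proof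
    fix x assume "x \<in> K"
    then show "x \<in> cball y (real p * D)" using Dh[of x] by (simp add: K_def dist_norm)
  qed
  ultimately have "compact K"
    by (meson bounded_cball bounded_subset compact_eq_bounded_closed)
  moreover have "K \<subseteq> (\<Union>x\<in>K. ball x (r x / 2))"
  proof
    fix x assume "x \<in> K"
    then show "x \<in> (\<Union>x\<in>K. ball x (r x / 2))" using r[of x] by (intro UN_I[of x]) (simp_all add: K_def)
  qed
  ultimately obtain J where J: "J \<subseteq> K" "finite J" "K \<subseteq> (\<Union>x\<in>J. ball x (r x / 2))"
    using compactE_image[of K K "\<lambda>x. ball x (r x / 2)"] by (metis (no_types, lifting) open_ball)
  let ?B = "\<Union>x\<in>J. ball x (r x / 2)"
  \<comment> \<open>The perturbed fibre stays in the enlarged ball around \<open>y\<close>. On the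
    part of that ball outside the small balls, \<open>h\<close> keeps a distance
    \<open>\<delta>\<close> from \<open>y\<close>, so a perturbation below \<open>\<delta>\<close>
    leaves the fibre inside the small balls.\<close>
  let ?N = "cball y (real p * D + 1) - ?B"
  have "compact ?N" by (intro compact_diff) auto
  then have "closed (h ` ?N)"
    by (intro compact_imp_closed compact_continuous_image continuous_on_subset[OF conth]) auto
  moreover have "y \<notin> h ` ?N" using J(3) by (auto simp: K_def)
  ultimately obtain \<delta> where \<delta>: "\<delta> > 0" "\<And>x. x \<in> h ` ?N \<Longrightarrow> \<delta> \<le> dist y x"
    using separate_point_closed[of "h ` ?N" y] by auto
  define e where "e = min (\<delta>/2) (1/2)"
  have e: "e > 0" using \<delta> by (simp add: e_def)
  have rJ: "r c > 0 \<and> free (cball c (r c))" if "c \<in> J" for c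
    using r[of c] that J(1) by (auto simp: K_def)
  obtain h' :: "'a \<Rightarrow> 'a" where h': "continuous_on UNIV h'" "h' \<circ> f = h'" "\<And>z. norm (h' z - h z) \<le> e"
      "\<And>c. c \<in> J \<Longrightarrow> y \<notin> h' ` sphere c (r c/2)"
    using perturb_off_spheres[OF J(2) conth hf rJ e, of y] by metis
  define K' where "K' = h' -` {y}"
  have K'B: "K' \<subseteq> ?B"
  proof
    fix x assume "x \<in> K'"
    then have x: "norm (h x - y) \<le> e" using h'(3)[of x] by (auto simp: K'_def norm_minus_commute)
    have "norm (x - y) \<le> norm (h x - y) + norm (h x - x)"
      using norm_triangle_ineq4[of "h x - y" "h x - x"] by simp
    also have "\<dots> \<le> real p * D + 1" using x Dh[of x] by (simp add: e_def)
    finally have "x \<in> cball y (real p * D + 1)" by (simp add: dist_norm norm_minus_commute)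
    moreover have "\<not> \<delta> \<le> dist y (h x)"
      using x \<delta>(1) by (simp add: e_def dist_norm norm_minus_commute)
    ultimately show "x \<in> ?B" using \<delta>(2) by blast
  qed
  have h'F: "h' ((f ^^ i) x) = h' x" for i x
    using h'(2) by (induction i) (auto simp: fun_eq_iff)
  obtain W where W: "open W" "free W" "K' \<inter> orb ?B \<subseteq> orb W"
  proof -
    have "free (cball c (r c / 2))" if "c \<in> J" for c
    proof -
      have "cball c (r c / 2) \<subseteq> cball c (r c)" using rJ[OF that] by auto
      then show ?thesis using rJ[OF that] free_subset by blast
    qed
    moreover have "K' \<inter> sphere c (r c / 2) = {}" if "c \<in> J" for c
      using h'(4)[OF that] by (auto simp: K'_def)
    moreover have "x \<in> K'" if "(f ^^ i) x \<in> K'" for x i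
      using that h'F by (simp add: K'_def)
    ultimately show thesis
      using split_by_balls[OF J(2), of "\<lambda>c. r c / 2" K'] that by blast
  qed
  show False
  proof (rule no_invariant_map_with_split_fibre[OF contf fp p2 _ h'(1,2) _ W(1)])
    show "norm (f x - x) \<le> D'" for x using Df[of x] DD' by linarith
    show "norm (h' x - x) \<le> D'" for x
      using norm_triangle_ineq[of "h' x - h x" "h x - x"] h'(3)[of x] Dh[of x]
      by (simp add: D'_def e_def)
    show "(f ^^ i) ` W \<inter> W = {}" if "0 < i" "i < p" for i
      using W(2) that by (auto simp: free_def)
    have "K' \<subseteq> orb W" using W(3) K'B subset_orb by blast
    then show "h' -` {y} \<subseteq> (\<Union>i<p. (f ^^ i) ` W)"
      by (simp add: K'_def orb_finite)
  qed
qed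

text \<open>If a prime \<open>p\<close> divides \<open>m\<close>, the iterate of exponent
  \<open>m div p\<close> has period \<open>p\<close> and displacement at most \<open>m div p\<close>
  times \<open>D\<close>. The prime case makes it the identity, so \<open>m div p\<close> is a
  smaller period of \<open>f\<close>.\<close>

theorem finite_order_bounded_displacement:
  fixes f :: "'a::euclidean_space \<Rightarrow> 'a"
  assumes "continuous_on UNIV f" and "f ^^ m = id" and "m > 0"
    and "\<And>x. norm (f x - x) \<le> D"
  shows "f = id"
  using assms(2,3)
proof (induction m rule: less_induct)
  case (less m)
  show ?case
  proof (cases "m = 1")
    case False
    then obtain p where p: "prime p" "p dvd m" using prime_factor_nat by blast
    then obtain k where k: "m = p * k" by blast
    have k0: "k > 0" "k < m" using less.prems k p prime_gt_1_nat by (auto intro: Nat.gr0I)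
    note D = funpow_displacement[OF assms(4)]
    have "f ^^ k = id"
    proof (rule prime_period_bounded_displacement[OF _ _ p(1) D])
      show "continuous_on UNIV (f ^^ k)"
        by (rule continuous_on_funpow[OF assms(1)])
      show "(f ^^ k) ^^ p = id"
        using less.prems(1) unfolding k funpow_mult by (simp only: mult.commute)
    qed
    then show ?thesis using less.IH k0 by blast
  qed (use less.prems in simp)
qed

section \<open>Integer matrices and sublattices\<close>

definition rvec :: "int^'n \<Rightarrow> real^'n" where "rvec v = (\<chi> i. of_int (v $ i))"

definition rmat :: "int^'n^'m \<Rightarrow> real^'n^'m" where "rmat M = (\<chi> i j. of_int (M $ i $ j))"

lemma rvec_nth [simp]: "rvec v $ i = of_int (v $ i)"
  by (simp add: rvec_def)

lemma rmat_nth [simp]: "rmat M $ i $ j = of_int (M $ i $ j)"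
  by (simp add: rmat_def)

lemma rvec_add: "rvec (v + w) = rvec v + rvec w"
  and rvec_diff: "rvec (v - w) = rvec v - rvec w"
  and rvec_0 [simp]: "rvec 0 = 0"
  by (simp_all add: vec_eq_iff)

lemma rvec_inject [simp]: "rvec v = rvec w \<longleftrightarrow> v = w"
  by (simp add: vec_eq_iff)

lemma rmat_inject [simp]: "rmat M = rmat N \<longleftrightarrow> M = N"
  by (simp add: vec_eq_iff)

lemma rmat_mult: "rmat (M ** N) = rmat M ** rmat N"
  by (simp add: vec_eq_iff matrix_matrix_mult_def)

lemma rmat_mult_rvec: "rmat M *v rvec v = rvec (M *v v)"
  by (simp add: vec_eq_iff matrix_vector_mult_def)

lemma rmat_mat_1 [simp]: "rmat (mat 1) = mat 1"
  by (simp add: vec_eq_iff mat_def)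

lemma det_rmat: "det (rmat M) = of_int (det M)"
  by (simp add: det_def)

lemma minus_minus_smult: "- (- k *s v) = (k *s v :: int^'n)"
  by (simp add: vec_eq_iff)

lemma additive_int_matrix:
  fixes f :: "int^'n \<Rightarrow> int^'m"
  assumes add: "\<And>v w. f (v + w) = f v + f w"
  obtains M where "\<And>v. f v = M *v v"
proof -
  have f0: "f 0 = 0" using add[of 0 0] by simp
  have fneg: "f (-v) = - f v" for v
    using add[of v "-v"] f0 by (simp add: eq_neg_iff_add_eq_0 add.commute)
  have fnat: "f (of_nat k *s v) = of_nat k *s f v" for k v
    by (induction k) (simp_all add: f0 add algebra_simps)
  have fint: "f (k *s v) = k *s f v" for k :: int and v
  proof (cases "k \<ge> 0")
    case False
    then show ?thesis using fnat[of "nat (-k)" v] fneg[of "(-k) *s v"] by (simp add: minus_minus_smult)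
  qed (use fnat[of "nat k" v] in simp)
  have fsum: "f (\<Sum>i\<in>S. g i) = (\<Sum>i\<in>S. f (g i))" if "finite S" for S :: "'n set" and g
    using that by induction (simp_all add: f0 add)
  have "f v = (\<chi> i j. f (axis j 1) $ i) *v v" for v
  proof -
    have "f v = (\<Sum>j\<in>UNIV. v $ j *s f (axis j 1))"
      using fsum[of UNIV "\<lambda>j. v $ j *s axis j 1"] by (simp add: basis_expansion fint)
    then show ?thesis
      by (simp add: vec_eq_iff matrix_vector_mult_def sum_component mult.commute)
  qed
  then show thesis using that by blast
qed

text \<open>A basis is a tuple of vectors of K with nonzero determinant of least absolute value: by
  Cramer's rule, replacing a basis vector by the fractional part of some element of K would give
  a smaller nonzero determinant.\<close>
lemma finite_index_sublattice_basis:
  fixes K :: "(int^'n) set"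
  assumes add: "\<And>v w. v \<in> K \<Longrightarrow> w \<in> K \<Longrightarrow> v + w \<in> K" and neg: "\<And>v. v \<in> K \<Longrightarrow> - v \<in> K"
    and N: "N \<noteq> 0" "\<And>v. N *s v \<in> K"
  obtains B :: "int^'n^'n" where "det B \<noteq> 0" "K = range ((*v) B)"
proof -
  have zero: "0 \<in> K" using N(2)[of 0] by simp
  have mulnat: "of_nat k *s v \<in> K" if "v \<in> K" for k v
    using that by (induction k) (simp_all add: zero add algebra_simps)
  have mul: "k *s v \<in> K" if "v \<in> K" for k :: int and v
  proof (cases "k \<ge> 0")
    case False
    then show ?thesis using neg[OF mulnat[OF that, of "nat (-k)"]] by (simp add: minus_minus_smult)
  qed (use mulnat[OF that, of "nat k"] in simp)
  define P where "P = (\<lambda>B :: int^'n^'n. det B \<noteq> 0 \<and> range ((*v) B) \<subseteq> K)"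
  \<comment> \<open>\<open>N\<close> times the identity is admissible, so a least determinant
    exists.\<close>
  have "P (mat N)"
  proof -
    have "det (mat N :: int^'n^'n) = (\<Prod>i\<in>(UNIV::'n set). N)"
      by (subst det_diagonal) (simp_all add: mat_def)
    moreover have "mat N *v v = N *s v" for v :: "int^'n"
      by (simp add: vec_eq_iff mat_def matrix_vector_mult_def if_distrib [of "\<lambda>x. x * _"] cong: if_cong)
    ultimately show ?thesis using N by (auto simp: P_def)
  qed
  then obtain B where B: "P B" "\<And>B'. P B' \<Longrightarrow> nat \<bar>det B\<bar> \<le> nat \<bar>det B'\<bar>"
    using ex_has_least_nat[of P _ "\<lambda>B. nat \<bar>det B\<bar>"] by blast
  have detB: "det B \<noteq> 0" and BK: "B *v v \<in> K" for v using B(1) by (auto simp: P_def)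
  have "w \<in> range ((*v) B)" if w: "w \<in> K" for w
  proof -
    have dR: "det (rmat B) \<noteq> 0" using detB by (simp add: det_rmat)
    obtain x where x: "rmat B *v x = rvec w"
      using cramer[OF dR] by blast
    define q where "q = (\<chi> i. \<lfloor>x $ i\<rfloor>)"
    define u where "u = w - B *v q"
    define z where "z = x - rvec q"
    have uK: "u \<in> K" using add[OF w neg[OF BK[of q]]] by (simp add: u_def)
    have zu: "rmat B *v z = rvec u"
      by (simp add: z_def u_def matrix_vector_mult_diff_distrib x rmat_mult_rvec rvec_diff)
    have "z $ k = 0" for k
    proof -
      define C :: "int^'n^'n" where "C = (\<chi> i j. if j = k then u $ i else B $ i $ j)"
      have "rmat C = (\<chi> i j. if j = k then rvec u $ i else rmat B $ i $ j)"
        by (simp add: vec_eq_iff C_def)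
      then have "z $ k = det (rmat C) / det (rmat B)"
        using zu cramer[OF dR, of z "rvec u"] by simp
      then have zk: "z $ k * of_int (det B) = of_int (det C)"
        using dR by (simp add: det_rmat field_simps)
      have "0 \<le> z $ k" "z $ k < 1" by (simp_all add: z_def q_def) linarith+
      then have "\<bar>z $ k\<bar> * \<bar>of_int (det B)\<bar> < 1 * \<bar>real_of_int (det B)\<bar>"
        using detB by (intro mult_strict_right_mono) auto
      then have "\<bar>real_of_int (det C)\<bar> < \<bar>real_of_int (det B)\<bar>"
        by (simp flip: zk add: abs_mult)
      then have less: "\<bar>det C\<bar> < \<bar>det B\<bar>" by linarith
      \<comment> \<open>A value of \<open>C\<close> is a value of \<open>B\<close> plus a multiple
        of \<open>u\<close>, hence in \<open>K\<close>; so \<open>C\<close> would beat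
        \<open>B\<close> unless its determinant vanishes.\<close>
      have "C *v v = B *v (\<chi> j. if j = k then 0 else v $ j) + v $ k *s u" for v
      proof -
        have "(\<Sum>j\<in>UNIV. (if j = k then u $ i else B $ i $ j) * v $ j)
          = (\<Sum>j\<in>UNIV. B $ i $ j * (if j = k then 0 else v $ j) + (if j = k then v $ k * u $ i else 0))" for i
          by (rule sum.cong) auto
        then show ?thesis
          by (simp add: vec_eq_iff matrix_vector_mult_def C_def sum.distrib)
      qed
      then have "range ((*v) C) \<subseteq> K" using add BK mul uK by auto
      then have "det C = 0" using B(2)[of C] less by (fastforce simp: P_def)
      then show ?thesis using zk detB by simp
    qed
    then have "z = 0" by (simp add: vec_eq_iff)
    then have "rvec u = rvec 0" using zu by simp
    then have "w = B *v q" unfolding rvec_inject by (simp add: u_def)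
    then show ?thesis by blast
  qed
  then have "K = range ((*v) B)" using BK by blast
  then show thesis using that detB by blast
qed

text \<open>Over the integers a nonzero determinant does not give an inverse; the argument passes to
  the real matrix, which has one.\<close>

lemma inj_int_matrix:
  fixes B :: "int^'n^'n"
  assumes "det B \<noteq> 0"
  shows "B *v v = B *v w \<longleftrightarrow> v = w"
proof
  assume "B *v v = B *v w"
  then have "rmat B *v rvec v = rmat B *v rvec w" by (simp add: rmat_mult_rvec)
  moreover have "inj ((*v) (rmat B))"
    using assms by (simp add: inj_matrix_vector_mult invertible_det_nz det_rmat)
  ultimately show "v = w" by (simp add: inj_eq)
qed simp

lemma int_matrix_cancel_left:
  fixes B :: "int^'n^'n"
  assumes "det B \<noteq> 0" "B ** M = B ** N"
  shows "M = N"
  using assms inj_int_matrix unfolding matrix_eq by (metis matrix_vector_mul_assoc)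

lemma int_matrix_cancel_right:
  fixes B :: "int^'n^'n"
  assumes "det B \<noteq> 0" "M ** B = N ** B"
  shows "M = N"
proof -
  have "invertible (rmat B)" using assms by (simp add: invertible_det_nz det_rmat)
  then obtain B' where "rmat B ** B' = mat 1" by (auto simp: invertible_def)
  moreover have "rmat M ** rmat B = rmat N ** rmat B" using assms(2) by (simp flip: rmat_mult)
  ultimately have "rmat M = rmat N" by (metis matrix_mul_assoc matrix_mul_rid)
  then show ?thesis by simp
qed

text \<open>A matrix that preserves the lattice spanned by the columns of \<open>B\<close> has
  integer entries in that basis. Over the rationals \<open>M\<close> is the conjugate of
  \<open>N\<close> by \<open>B\<close>.\<close>

lemma ex_intertwining_int_matrix:
  fixes B N :: "int^'n^'n"
  assumes B: "det B \<noteq> 0" and inv: "\<And>v. N *v (B *v v) \<in> range ((*v) B)"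
  obtains M where "B ** M = N ** B"
proof -
  have "\<exists>u. B *v u = N *v (B *v v)" for v using inv[of v] by (metis rangeE)
  then obtain f where f: "\<And>v. B *v f v = N *v (B *v v)" by metis
  have "f (v + w) = f v + f w" for v w
  proof -
    have "B *v f (v + w) = B *v (f v + f w)"
      by (simp add: f matrix_vector_right_distrib)
    then show ?thesis by (simp add: inj_int_matrix B)
  qed
  then obtain M where "\<And>v. f v = M *v v" using additive_int_matrix by blast
  then have "B ** M = N ** B" using f by (simp add: matrix_eq flip: matrix_vector_mul_assoc)
  then show thesis using that by blast
qed

section \<open>Extensions of a finite group by a lattice\<close>

lemma coset_rep_factor_group:
  assumes "group G" and H: "subgroup H G" and C: "C \<in> carrier (G Mod H)"
  shows "coset_rep C \<in> carrier G" "C = H #>\<^bsub>G\<^esub> coset_rep C"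
proof -
  interpret group G by fact
  obtain x where x: "x \<in> carrier G" "C = H #>\<^bsub>G\<^esub> x"
    using C by (auto simp: FactGroup_def RCOSETS_def)
  then have "x \<in> C" using rcos_self[OF _ H] by simp
  then have r: "coset_rep C \<in> C" unfolding coset_rep_def by (rule someI)
  show "coset_rep C \<in> carrier G"
    using r x r_coset_subset_G[OF subgroup.subset[OF H]] by blast
  show "C = H #>\<^bsub>G\<^esub> coset_rep C"
    using r x repr_independence[OF _ x(1) H, of "coset_rep C"] by simp
qed

text \<open>An axiomatic form of the group of lifts: \<open>\<tau>\<close> embeds the translations,
  \<open>R\<close> is the action on the fundamental group, and \<open>torsion_free\<close> is the
  form in which the rigidity of bounded displacement enters the algebra.\<close>

locale lattice_extension = G: group G + E: group E
  for G :: "('g, 'c) monoid_scheme" and E :: "('e, 'd) monoid_scheme" +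
  fixes \<pi> :: "'e \<Rightarrow> 'g" and \<tau> :: "int^'n \<Rightarrow> 'e" and R :: "'g \<Rightarrow> int^'n^'n"
  assumes finite_G: "finite (carrier G)"
    and pi_hom: "\<pi> \<in> hom E G" and pi_surj: "\<pi> ` carrier E = carrier G"
    and tau_hom: "\<tau> \<in> hom Zn E" and tau_inj: "inj \<tau>"
    and pi_ker: "\<And>F. F \<in> carrier E \<Longrightarrow> \<pi> F = \<one>\<^bsub>G\<^esub> \<longleftrightarrow> F \<in> range \<tau>"
    and tau_conj: "\<And>F v. F \<in> carrier E \<Longrightarrow> F \<otimes>\<^bsub>E\<^esub> \<tau> v = \<tau> (R (\<pi> F) *v v) \<otimes>\<^bsub>E\<^esub> F"
    and torsion_free: "\<And>F k. F \<in> carrier E \<Longrightarrow> R (\<pi> F) = mat 1 \<Longrightarrow> k > (0::nat) \<Longrightarrow>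
       F [^]\<^bsub>E\<^esub> k = \<one>\<^bsub>E\<^esub> \<Longrightarrow> F = \<one>\<^bsub>E\<^esub>"
begin

lemma tau_closed [simp, intro]: "\<tau> v \<in> carrier E"
  using tau_hom by (auto simp: hom_def Zn_def)

lemma tau_add: "\<tau> (v + w) = \<tau> v \<otimes>\<^bsub>E\<^esub> \<tau> w"
  using tau_hom by (auto simp: hom_def Zn_def)

lemma tau_0 [simp]: "\<tau> 0 = \<one>\<^bsub>E\<^esub>"
  using tau_add[of 0 0] E.r_cancel_one[of "\<tau> 0" "\<tau> 0"] by simp

lemma pi_closed [simp, intro]: "F \<in> carrier E \<Longrightarrow> \<pi> F \<in> carrier G"
  using pi_hom by (auto simp: hom_def)

lemma pi_mult [simp]: "F \<in> carrier E \<Longrightarrow> H \<in> carrier E \<Longrightarrow> \<pi> (F \<otimes>\<^bsub>E\<^esub> H) = \<pi> F \<otimes>\<^bsub>G\<^esub> \<pi> H"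
  using pi_hom by (auto simp: hom_def)

lemma pi_group_hom: "group_hom E G \<pi>"
  by (simp add: group_hom_def group_hom_axioms_def pi_hom G.is_group E.is_group)

lemma pi_one [simp]: "\<pi> \<one>\<^bsub>E\<^esub> = \<one>\<^bsub>G\<^esub>"
  by (rule group_hom.hom_one [OF pi_group_hom])

lemma pi_inv [simp]: "F \<in> carrier E \<Longrightarrow> \<pi> (inv\<^bsub>E\<^esub> F) = inv\<^bsub>G\<^esub> (\<pi> F)"
  by (rule group_hom.hom_inv [OF pi_group_hom])

lemma pi_tau [simp]: "\<pi> (\<tau> v) = \<one>\<^bsub>G\<^esub>"
  using pi_ker by auto

text \<open>\<open>tau_conj\<close> determines \<open>R\<close> on lattice vectors because
  \<open>\<tau>\<close> is injective, and conjugating by a product composes the two matrices.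
  Surjectivity of \<open>\<pi>\<close> supplies the elements to conjugate by.\<close>

lemma R_mult:
  assumes "g \<in> carrier G" "h \<in> carrier G"
  shows "R (g \<otimes>\<^bsub>G\<^esub> h) = R g ** R h"
proof -
  obtain F H where F: "F \<in> carrier E" "\<pi> F = g" and H: "H \<in> carrier E" "\<pi> H = h"
    using assms pi_surj by (metis imageE)
  have "R (g \<otimes>\<^bsub>G\<^esub> h) *v v = (R g ** R h) *v v" for v
  proof -
    have "\<tau> (R (g \<otimes>\<^bsub>G\<^esub> h) *v v) \<otimes>\<^bsub>E\<^esub> (F \<otimes>\<^bsub>E\<^esub> H) = F \<otimes>\<^bsub>E\<^esub> (H \<otimes>\<^bsub>E\<^esub> \<tau> v)"
      using tau_conj[of "F \<otimes>\<^bsub>E\<^esub> H" v] F H by (simp add: E.m_assoc)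
    also have "\<dots> = F \<otimes>\<^bsub>E\<^esub> \<tau> (R h *v v) \<otimes>\<^bsub>E\<^esub> H"
      unfolding tau_conj[OF H(1)] H(2) using F(1) H(1) by (simp add: E.m_assoc)
    also have "\<dots> = \<tau> (R g *v (R h *v v)) \<otimes>\<^bsub>E\<^esub> (F \<otimes>\<^bsub>E\<^esub> H)"
      unfolding tau_conj[OF F(1)] F(2) using F(1) H(1) by (simp add: E.m_assoc)
    finally have "\<tau> (R (g \<otimes>\<^bsub>G\<^esub> h) *v v) = \<tau> (R g *v (R h *v v))"
      using F H by (simp add: E.right_cancel)
    then show ?thesis using tau_inj by (simp add: inj_eq matrix_vector_mul_assoc)
  qed
  then show ?thesis by (simp add: matrix_eq)
qed

lemma R_one [simp]: "R \<one>\<^bsub>G\<^esub> = mat 1"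
proof -
  have "R \<one>\<^bsub>G\<^esub> *v v = mat 1 *v v" for v
    using tau_conj[of "\<one>\<^bsub>E\<^esub>" v] tau_inj by (simp add: inj_eq)
  then show ?thesis by (simp add: matrix_eq)
qed

section \<open>Kernel of the action on the lattice and its preimage\<close>

definition A :: "'g set" where "A = {g \<in> carrier G. R g = mat 1}"

lemma R_inv:
  assumes "g \<in> carrier G"
  shows "R (inv\<^bsub>G\<^esub> g) ** R g = mat 1" "R g ** R (inv\<^bsub>G\<^esub> g) = mat 1"
  using assms by (simp_all flip: R_mult)

lemma A_normal: "A \<lhd> G"
proof (rule G.normal_invI)
  show "subgroup A G"
  proof (rule G.subgroupI)
    show "inv\<^bsub>G\<^esub> a \<in> A" if "a \<in> A" for a
      using that R_inv(1)[of a] by (auto simp: A_def)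
    show "a \<otimes>\<^bsub>G\<^esub> b \<in> A" if "a \<in> A" "b \<in> A" for a b
      using that by (auto simp: A_def R_mult)
  qed (use R_one in \<open>auto simp: A_def\<close>)
  show "x \<otimes>\<^bsub>G\<^esub> h \<otimes>\<^bsub>G\<^esub> inv\<^bsub>G\<^esub> x \<in> A" if "x \<in> carrier G" "h \<in> A" for x h
    using that R_inv(2)[of x] by (auto simp: A_def R_mult)
qed

lemma A_subgroup: "subgroup A G"
  using A_normal by (rule normal_imp_subgroup)

lemma A_carrier: "a \<in> A \<Longrightarrow> a \<in> carrier G"
  by (simp add: A_def)

lemma finite_A: "finite A"
  using finite_G by (rule finite_subset [rotated]) (auto simp: A_def)

lemma card_A: "card A > 0"
  using finite_A subgroup.one_closed[OF A_subgroup] by (auto simp: card_gt_0_iff)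

definition L :: "'e set" where "L = {F \<in> carrier E. \<pi> F \<in> A}"

lemma L_carrier: "F \<in> L \<Longrightarrow> F \<in> carrier E"
  by (simp add: L_def)

lemma L_mult: "F \<in> L \<Longrightarrow> H \<in> L \<Longrightarrow> F \<otimes>\<^bsub>E\<^esub> H \<in> L"
  using subgroup.m_closed[OF A_subgroup] by (simp add: L_def)

lemma L_inv: "F \<in> L \<Longrightarrow> inv\<^bsub>E\<^esub> F \<in> L"
  using subgroup.m_inv_closed[OF A_subgroup] by (simp add: L_def)

lemma L_tau: "\<tau> v \<in> L"
  using subgroup.one_closed[OF A_subgroup] by (simp add: L_def)

lemma L_conj: "H \<in> carrier E \<Longrightarrow> F \<in> L \<Longrightarrow> H \<otimes>\<^bsub>E\<^esub> F \<otimes>\<^bsub>E\<^esub> inv\<^bsub>E\<^esub> H \<in> L"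
  using normal.inv_op_closed2[OF A_normal] by (simp add: L_def)

lemma L_commute: "F \<in> L \<Longrightarrow> F \<otimes>\<^bsub>E\<^esub> \<tau> v = \<tau> v \<otimes>\<^bsub>E\<^esub> F"
  using tau_conj[of F v] by (simp add: L_def A_def)

lemma same_fibre:
  assumes "F \<in> carrier E" "H \<in> carrier E" "\<pi> F = \<pi> H"
  shows "\<exists>t. F = \<tau> t \<otimes>\<^bsub>E\<^esub> H"
proof -
  have "F \<otimes>\<^bsub>E\<^esub> inv\<^bsub>E\<^esub> H \<in> range \<tau>"
    using assms pi_ker[of "F \<otimes>\<^bsub>E\<^esub> inv\<^bsub>E\<^esub> H"] by simp
  then show ?thesis
    using assms by (metis E.inv_closed E.inv_solve_right' E.m_closed rangeE)
qed

section \<open>Transfer to the lattice of translations\<close>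

definition sec :: "'g \<Rightarrow> 'e" where "sec g = (SOME F. F \<in> carrier E \<and> \<pi> F = g)"

lemma sec: "g \<in> carrier G \<Longrightarrow> sec g \<in> carrier E" "g \<in> carrier G \<Longrightarrow> \<pi> (sec g) = g"
proof -
  assume "g \<in> carrier G"
  then have "\<exists>F. F \<in> carrier E \<and> \<pi> F = g" using pi_surj by (metis imageE)
  then have "sec g \<in> carrier E \<and> \<pi> (sec g) = g" unfolding sec_def by (rule someI_ex)
  then show "sec g \<in> carrier E" "\<pi> (sec g) = g" by auto
qed

text \<open>The translation by which left multiplication by \<open>F\<close> misses the chosen
  section: the summand of the transfer, with the cosets of the translations indexed by their images
  in \<open>G\<close>.\<close>

definition shift :: "'e \<Rightarrow> 'g \<Rightarrow> int^'n"
  where "shift F a = (SOME t. F \<otimes>\<^bsub>E\<^esub> sec a = \<tau> t \<otimes>\<^bsub>E\<^esub> sec (\<pi> F \<otimes>\<^bsub>G\<^esub> a))"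

lemma shift:
  assumes "F \<in> carrier E" "a \<in> carrier G"
  shows "F \<otimes>\<^bsub>E\<^esub> sec a = \<tau> (shift F a) \<otimes>\<^bsub>E\<^esub> sec (\<pi> F \<otimes>\<^bsub>G\<^esub> a)"
proof -
  have "\<exists>t. F \<otimes>\<^bsub>E\<^esub> sec a = \<tau> t \<otimes>\<^bsub>E\<^esub> sec (\<pi> F \<otimes>\<^bsub>G\<^esub> a)"
    using assms by (intro same_fibre) (simp_all add: sec)
  then show ?thesis unfolding shift_def by (rule someI_ex)
qed

lemma shift_eqI:
  assumes "F \<in> carrier E" "a \<in> carrier G" "F \<otimes>\<^bsub>E\<^esub> sec a = \<tau> t \<otimes>\<^bsub>E\<^esub> sec (\<pi> F \<otimes>\<^bsub>G\<^esub> a)"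
  shows "shift F a = t"
proof -
  have "\<tau> (shift F a) = \<tau> t"
    using shift[OF assms(1,2)] assms by (metis E.right_cancel G.m_closed pi_closed sec(1) tau_closed)
  then show ?thesis using tau_inj by (simp add: inj_eq)
qed

text \<open>The transfer from L to the central subgroup of translations, in additive notation.\<close>
definition transfer :: "'e \<Rightarrow> int^'n" where "transfer F = (\<Sum>a\<in>A. shift F a)"

text \<open>Translations are central in \<open>L\<close>, so \<open>shift H a\<close> can be moved
  past \<open>F\<close>; the remaining sum is reindexed by left multiplication with
  \<open>\<pi> H\<close>, a permutation of \<open>A\<close>.\<close>

lemma transfer_mult:
  assumes "F \<in> L" "H \<in> L"
  shows "transfer (F \<otimes>\<^bsub>E\<^esub> H) = transfer F + transfer H"
proof -
  have FH: "F \<in> carrier E" "H \<in> carrier E" "\<pi> F \<in> A" "\<pi> H \<in> A" using assms by (auto simp: L_def)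
  have "shift (F \<otimes>\<^bsub>E\<^esub> H) a = shift F (\<pi> H \<otimes>\<^bsub>G\<^esub> a) + shift H a" if a: "a \<in> A" for a
  proof (rule shift_eqI)
    have ac: "a \<in> carrier G" "\<pi> H \<otimes>\<^bsub>G\<^esub> a \<in> carrier G" using a FH by (auto simp: A_carrier)
    have "F \<otimes>\<^bsub>E\<^esub> H \<otimes>\<^bsub>E\<^esub> sec a = F \<otimes>\<^bsub>E\<^esub> (\<tau> (shift H a) \<otimes>\<^bsub>E\<^esub> sec (\<pi> H \<otimes>\<^bsub>G\<^esub> a))"
      unfolding shift[OF FH(2) ac(1), symmetric] using FH ac by (simp add: E.m_assoc sec)
    also have "\<dots> = \<tau> (shift H a) \<otimes>\<^bsub>E\<^esub> (F \<otimes>\<^bsub>E\<^esub> sec (\<pi> H \<otimes>\<^bsub>G\<^esub> a))"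
      using FH ac L_commute[OF assms(1)] by (metis E.m_assoc sec(1) tau_closed)
    also have "\<dots> = \<tau> (shift H a) \<otimes>\<^bsub>E\<^esub> (\<tau> (shift F (\<pi> H \<otimes>\<^bsub>G\<^esub> a)) \<otimes>\<^bsub>E\<^esub> sec (\<pi> F \<otimes>\<^bsub>G\<^esub> (\<pi> H \<otimes>\<^bsub>G\<^esub> a)))"
      unfolding shift[OF FH(1) ac(2)] ..
    also have "\<dots> = \<tau> (shift F (\<pi> H \<otimes>\<^bsub>G\<^esub> a) + shift H a) \<otimes>\<^bsub>E\<^esub> sec (\<pi> (F \<otimes>\<^bsub>E\<^esub> H) \<otimes>\<^bsub>G\<^esub> a)"
      using FH ac by (simp add: sec A_carrier G.m_assoc add.commute[of "shift F (\<pi> H \<otimes>\<^bsub>G\<^esub> a)"] tau_add E.m_assoc)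
    finally show "F \<otimes>\<^bsub>E\<^esub> H \<otimes>\<^bsub>E\<^esub> sec a = \<tau> (shift F (\<pi> H \<otimes>\<^bsub>G\<^esub> a) + shift H a) \<otimes>\<^bsub>E\<^esub> sec (\<pi> (F \<otimes>\<^bsub>E\<^esub> H) \<otimes>\<^bsub>G\<^esub> a)" .
  qed (use FH a A_carrier in auto)
  then have "transfer (F \<otimes>\<^bsub>E\<^esub> H) = (\<Sum>a\<in>A. shift F (\<pi> H \<otimes>\<^bsub>G\<^esub> a)) + transfer H"
    by (simp add: transfer_def sum.distrib)
  also have "(\<Sum>a\<in>A. shift F (\<pi> H \<otimes>\<^bsub>G\<^esub> a)) = transfer F"
    unfolding transfer_def
  proof (rule sum.reindex_bij_witness[of _ "\<lambda>a. inv\<^bsub>G\<^esub> (\<pi> H) \<otimes>\<^bsub>G\<^esub> a" "\<lambda>a. \<pi> H \<otimes>\<^bsub>G\<^esub> a"])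
    fix a assume a: "a \<in> A"
    show "inv\<^bsub>G\<^esub> \<pi> H \<otimes>\<^bsub>G\<^esub> (\<pi> H \<otimes>\<^bsub>G\<^esub> a) = a" "\<pi> H \<otimes>\<^bsub>G\<^esub> (inv\<^bsub>G\<^esub> \<pi> H \<otimes>\<^bsub>G\<^esub> a) = a"
      using FH A_carrier[OF a] by (simp_all flip: G.m_assoc)
    show "\<pi> H \<otimes>\<^bsub>G\<^esub> a \<in> A" "inv\<^bsub>G\<^esub> \<pi> H \<otimes>\<^bsub>G\<^esub> a \<in> A"
      using FH a subgroup.m_closed[OF A_subgroup] subgroup.m_inv_closed[OF A_subgroup] by auto
  qed simp
  finally show ?thesis .
qed

lemma transfer_tau: "transfer (\<tau> v) = of_nat (card A) *s v"
proof -
  have "shift (\<tau> v) a = v" if "a \<in> A" for a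
    using that A_carrier by (intro shift_eqI) auto
  then have "transfer (\<tau> v) = (\<Sum>a\<in>A. v)" by (simp add: transfer_def)
  then show ?thesis by (simp only: vec_eq_iff sum_component) simp
qed

lemma transfer_one [simp]: "transfer \<one>\<^bsub>E\<^esub> = 0"
  using transfer_tau[of 0] by simp

lemma transfer_inv: "F \<in> L \<Longrightarrow> transfer (inv\<^bsub>E\<^esub> F) = - transfer F"
  using transfer_mult[OF L_inv, of F F] by (simp add: L_carrier eq_neg_iff_add_eq_0)

lemma L_one: "\<one>\<^bsub>E\<^esub> \<in> L"
  using L_tau[of 0] by simp

lemma L_pow: "F \<in> L \<Longrightarrow> F [^]\<^bsub>E\<^esub> (k::nat) \<in> L"
  by (induction k) (simp_all add: L_one L_mult)

lemma transfer_pow: "F \<in> L \<Longrightarrow> transfer (F [^]\<^bsub>E\<^esub> (k::nat)) = of_nat k *s transfer F"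
  by (induction k) (simp_all add: transfer_mult L_pow algebra_simps)

text \<open>The order of \<open>A\<close> kills \<open>\<pi> F\<close>, so the power is some
  translation \<open>\<tau> z\<close>. The transfers of the two sides are \<open>card A\<close>
  times \<open>transfer F\<close> and \<open>card A\<close> times \<open>z\<close>, and the factor
  cancels.\<close>

lemma L_pow_card:
  assumes F: "F \<in> L"
  shows "F [^]\<^bsub>E\<^esub> card A = \<tau> (transfer F)"
proof -
  interpret AG: group "G\<lparr>carrier := A\<rparr>"
    using A_subgroup by (rule subgroup.subgroup_is_group) (rule G.is_group)
  have "\<pi> F [^]\<^bsub>G\<lparr>carrier := A\<rparr>\<^esub> card A = \<one>\<^bsub>G\<^esub>"
    using AG.pow_order_eq_1[of "\<pi> F"] F by (simp add: order_def L_def)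
  then have "\<pi> (F [^]\<^bsub>E\<^esub> card A) = \<one>\<^bsub>G\<^esub>"
    using F by (simp add: group_hom.hom_nat_pow[OF pi_group_hom] L_carrier flip: G.nat_pow_consistent)
  then obtain z where z: "F [^]\<^bsub>E\<^esub> card A = \<tau> z"
    using pi_ker[of "F [^]\<^bsub>E\<^esub> card A"] F by (auto simp: L_carrier)
  then have "int (card A) *s z = int (card A) *s transfer F"
    using transfer_pow[OF F, of "card A"] transfer_tau[of z] by simp
  then have "z = transfer F" using card_A by (simp add: vec_eq_iff)
  then show ?thesis using z by simp
qed

text \<open>If two transfers agree, \<open>L_pow_card\<close> shows that the quotient of the
  elements has finite order, and torsion freeness makes it trivial. Being embedded in a lattice,
  \<open>L\<close> is abelian.\<close>

lemma transfer_inj: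
  assumes "F \<in> L" "H \<in> L" "transfer F = transfer H"
  shows "F = H"
proof -
  let ?D = "F \<otimes>\<^bsub>E\<^esub> inv\<^bsub>E\<^esub> H"
  have D: "?D \<in> L" using assms by (simp add: L_mult L_inv)
  have "?D [^]\<^bsub>E\<^esub> card A = \<one>\<^bsub>E\<^esub>"
    unfolding L_pow_card[OF D] using assms by (simp add: transfer_mult L_inv transfer_inv)
  moreover have "R (\<pi> ?D) = mat 1" using D unfolding L_def A_def by blast
  ultimately have "?D = \<one>\<^bsub>E\<^esub>" using torsion_free[OF L_carrier[OF D] _ card_A] by blast
  then show ?thesis
    using assms by (metis E.inv_closed E.inv_equality E.inv_inv L_carrier)
qed

lemma conj_pow:
  assumes "H \<in> carrier E" "F \<in> carrier E"
  shows "(H \<otimes>\<^bsub>E\<^esub> F \<otimes>\<^bsub>E\<^esub> inv\<^bsub>E\<^esub> H) [^]\<^bsub>E\<^esub> (k::nat) = H \<otimes>\<^bsub>E\<^esub> F [^]\<^bsub>E\<^esub> k \<otimes>\<^bsub>E\<^esub> inv\<^bsub>E\<^esub> H"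
proof (induction k)
  case (Suc k)
  have "inv\<^bsub>E\<^esub> H \<otimes>\<^bsub>E\<^esub> (H \<otimes>\<^bsub>E\<^esub> X) = X" if "X \<in> carrier E" for X
    using assms that by (simp flip: E.m_assoc)
  then show ?case using Suc assms by (simp add: E.m_assoc)
qed (use assms in simp)

text \<open>\<open>L_pow_card\<close> expresses the transfer as a power, and powers commute with
  conjugation; no coset representatives have to be followed.\<close>

lemma transfer_conj:
  assumes H: "H \<in> carrier E" and F: "F \<in> L"
  shows "transfer (H \<otimes>\<^bsub>E\<^esub> F \<otimes>\<^bsub>E\<^esub> inv\<^bsub>E\<^esub> H) = R (\<pi> H) *v transfer F"
proof -
  have "\<tau> (transfer (H \<otimes>\<^bsub>E\<^esub> F \<otimes>\<^bsub>E\<^esub> inv\<^bsub>E\<^esub> H)) = H \<otimes>\<^bsub>E\<^esub> \<tau> (transfer F) \<otimes>\<^bsub>E\<^esub> inv\<^bsub>E\<^esub> H"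
    using conj_pow[OF H L_carrier[OF F], of "card A"] by (simp add: L_pow_card[OF F] L_pow_card[OF L_conj[OF H F]])
  also have "\<dots> = \<tau> (R (\<pi> H) *v transfer F)"
    using H by (simp add: tau_conj E.m_assoc)
  finally show ?thesis using tau_inj by (simp add: inj_eq)
qed

section \<open>Coordinates on the preimage lattice and the induced extension data\<close>

lemma ex_basis: "\<exists>B :: int^'n^'n. det B \<noteq> 0 \<and> transfer ` L = range ((*v) B)"
proof -
  obtain B :: "int^'n^'n" where "det B \<noteq> 0" "transfer ` L = range ((*v) B)"
  proof (rule finite_index_sublattice_basis [of "transfer ` L" "int (card A)"])
    show "v + w \<in> transfer ` L" if "v \<in> transfer ` L" "w \<in> transfer ` L" for v w
      using that by (auto simp flip: transfer_mult intro: L_mult)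
    show "- v \<in> transfer ` L" if "v \<in> transfer ` L" for v
      using that by (auto simp flip: transfer_inv intro: L_inv)
    show "int (card A) *s v \<in> transfer ` L" for v
      using L_tau[of v] transfer_tau[of v] by (metis image_eqI)
  qed (use card_A in auto)
  then show ?thesis by blast
qed

definition B :: "int^'n^'n" where "B = (SOME B. det B \<noteq> 0 \<and> transfer ` L = range ((*v) B))"

lemma det_B: "det B \<noteq> 0" and range_B: "transfer ` L = range ((*v) B)"
  using someI_ex[OF ex_basis] unfolding B_def by (rule conjunct1, rule conjunct2)

text \<open>Coordinates on \<open>L\<close> in the basis \<open>B\<close> of its transfer image. It
  is on this larger lattice, rather than on the translations, that the quotient group is made to
  act.\<close>

definition \<Theta> :: "int^'n \<Rightarrow> 'e" where "\<Theta> v = (SOME F. F \<in> L \<and> transfer F = B *v v)"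

lemma Theta: "\<Theta> v \<in> L" "transfer (\<Theta> v) = B *v v"
proof -
  have "\<exists>F. F \<in> L \<and> transfer F = B *v v" using range_B by (metis imageE rangeI)
  then have "\<Theta> v \<in> L \<and> transfer (\<Theta> v) = B *v v" unfolding \<Theta>_def by (rule someI_ex)
  then show "\<Theta> v \<in> L" "transfer (\<Theta> v) = B *v v" by auto
qed

lemma Theta_add: "\<Theta> (v + w) = \<Theta> v \<otimes>\<^bsub>E\<^esub> \<Theta> w"
  by (rule transfer_inj) (simp_all add: Theta L_mult transfer_mult matrix_vector_right_distrib)

lemma Theta_inj: "\<Theta> v = \<Theta> w \<longleftrightarrow> v = w"
  using Theta(2) inj_int_matrix[OF det_B] by metis

lemma Theta_surj: "F \<in> L \<Longrightarrow> \<exists>v. \<Theta> v = F"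
  using range_B Theta transfer_inj by (metis imageI rangeE)

definition \<alpha> :: "int^'n \<Rightarrow> 'g" where "\<alpha> v = \<pi> (\<Theta> v)"

lemma alpha_A: "\<alpha> v \<in> A"
  using Theta(1) by (simp add: \<alpha>_def L_def)

lemma alpha_add: "\<alpha> (v + w) = \<alpha> v \<otimes>\<^bsub>G\<^esub> \<alpha> w"
  by (simp add: \<alpha>_def Theta_add Theta L_carrier)

lemma alpha_surj: "range \<alpha> = A"
proof
  show "A \<subseteq> range \<alpha>"
  proof
    fix a assume a: "a \<in> A"
    then have "sec a \<in> L" by (simp add: L_def sec A_carrier)
    then obtain v where "\<Theta> v = sec a" using Theta_surj by blast
    then have "\<alpha> v = a" using a by (simp add: \<alpha>_def sec A_carrier)
    then show "a \<in> range \<alpha>" by blast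
  qed
qed (use alpha_A in auto)

lemma ex_P:
  assumes g: "g \<in> carrier G"
  shows "\<exists>M. B ** M = R g ** B"
proof -
  have "R g *v (B *v v) \<in> range ((*v) B)" for v
  proof -
    have "R g *v (B *v v) = transfer (sec g \<otimes>\<^bsub>E\<^esub> \<Theta> v \<otimes>\<^bsub>E\<^esub> inv\<^bsub>E\<^esub> (sec g))"
      using g by (simp add: transfer_conj sec Theta)
    also have "\<dots> \<in> range ((*v) B)"
      unfolding range_B[symmetric] using g by (intro imageI L_conj) (auto simp: sec Theta)
    finally show ?thesis .
  qed
  then show ?thesis using ex_intertwining_int_matrix[OF det_B] by metis
qed

text \<open>Conjugation on \<open>L\<close> in the coordinates \<open>\<Theta>\<close>, that is,
  \<open>R g\<close> conjugated by \<open>B\<close>; it is integral because \<open>L\<close> is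
  normal.\<close>

definition P :: "'g \<Rightarrow> int^'n^'n" where "P g = (SOME M. B ** M = R g ** B)"

lemma P: "g \<in> carrier G \<Longrightarrow> B ** P g = R g ** B"
  unfolding P_def by (rule someI_ex) (rule ex_P)

lemma P_eqI: "g \<in> carrier G \<Longrightarrow> B ** M = R g ** B \<Longrightarrow> P g = M"
  using P int_matrix_cancel_left[OF det_B] by metis

lemma P_mult:
  assumes "g \<in> carrier G" "h \<in> carrier G"
  shows "P (g \<otimes>\<^bsub>G\<^esub> h) = P g ** P h"
proof (rule P_eqI)
  have "B ** (P g ** P h) = R g ** (B ** P h)"
    by (simp only: matrix_mul_assoc P[OF assms(1)])
  then show "B ** (P g ** P h) = R (g \<otimes>\<^bsub>G\<^esub> h) ** B"
    using assms by (simp only: matrix_mul_assoc P R_mult)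
qed (use assms in simp)

lemma P_A: "a \<in> A \<Longrightarrow> P a = mat 1"
  by (rule P_eqI) (simp_all add: A_def)

lemma Theta_conj:
  assumes "g \<in> carrier G"
  shows "\<Theta> (P g *v v) = sec g \<otimes>\<^bsub>E\<^esub> \<Theta> v \<otimes>\<^bsub>E\<^esub> inv\<^bsub>E\<^esub> (sec g)"
  by (rule transfer_inj)
    (use assms in \<open>simp_all add: Theta L_conj sec transfer_conj matrix_vector_mul_assoc P\<close>)

lemma alpha_conj:
  assumes "g \<in> carrier G"
  shows "\<alpha> (P g *v v) = g \<otimes>\<^bsub>G\<^esub> \<alpha> v \<otimes>\<^bsub>G\<^esub> inv\<^bsub>G\<^esub> g"
  using assms by (simp add: \<alpha>_def Theta_conj sec Theta L_carrier)

lemmas coset_rep = coset_rep_factor_group[OF G.is_group A_subgroup]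

lemma coset_rep_mult:
  assumes "C \<in> carrier (G Mod A)" "D \<in> carrier (G Mod A)"
  obtains a where "a \<in> A" "coset_rep (C <#>\<^bsub>G\<^esub> D) = a \<otimes>\<^bsub>G\<^esub> (coset_rep C \<otimes>\<^bsub>G\<^esub> coset_rep D)"
    "C <#>\<^bsub>G\<^esub> D \<in> carrier (G Mod A)"
proof -
  have CD: "C <#>\<^bsub>G\<^esub> D \<in> carrier (G Mod A)"
    using monoid.m_closed[OF group.is_monoid[OF normal.factorgroup_is_group[OF A_normal]] assms] by simp
  have "C <#>\<^bsub>G\<^esub> D = A #>\<^bsub>G\<^esub> (coset_rep C \<otimes>\<^bsub>G\<^esub> coset_rep D)"
    using normal.rcos_sum[OF A_normal coset_rep(1)[OF assms(1)] coset_rep(1)[OF assms(2)]]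
      coset_rep(2)[OF assms(1)] coset_rep(2)[OF assms(2)] by simp
  moreover have "coset_rep (C <#>\<^bsub>G\<^esub> D) \<in> C <#>\<^bsub>G\<^esub> D"
    using coset_rep[OF CD] G.rcos_self[OF _ A_subgroup] by blast
  ultimately have "coset_rep (C <#>\<^bsub>G\<^esub> D) \<in> A #>\<^bsub>G\<^esub> (coset_rep C \<otimes>\<^bsub>G\<^esub> coset_rep D)" by simp
  then show thesis using that CD by (auto simp: r_coset_def)
qed

theorem extension_data:
  "\<exists>A. A \<lhd> G \<and> (\<forall>a\<in>A. \<forall>b\<in>A. a \<otimes>\<^bsub>G\<^esub> b = b \<otimes>\<^bsub>G\<^esub> a) \<and>
      (\<exists>\<rho>. \<rho> \<in> hom (G Mod A) (GLZ :: (int^'n^'n) monoid) \<and> inj_on \<rho> (carrier (G Mod A)) \<and>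
        (\<exists>\<alpha>. \<alpha> \<in> hom (Zn :: (int^'n) monoid) (G\<lparr>carrier := A\<rparr>) \<and> \<alpha> ` UNIV = A \<and>
          (\<forall>C\<in>carrier (G Mod A). \<forall>v. \<alpha> (\<rho> C *v v) = conj_act G C (\<alpha> v)) \<and>
          (\<exists>c. cocycle2 (G Mod A) Zn (\<lambda>C v. \<rho> C *v v) c \<and>
               coboundary2 (G Mod A) (G\<lparr>carrier := A\<rparr>) (conj_act G)
                 (\<lambda>C1 C2. ext_cocycle G C1 C2 \<otimes>\<^bsub>G\<^esub> inv\<^bsub>G\<^esub> (\<alpha> (c C1 C2))))))"
proof (intro exI[of _ A] conjI exI[of _ "\<lambda>C. P (coset_rep C)"] exI[of _ \<alpha>] ballI allI)
  let ?Q = "G Mod A" and ?r = "coset_rep :: 'g set \<Rightarrow> 'g"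
  interpret Q: group ?Q by (rule normal.factorgroup_is_group[OF A_normal])
  show "A \<lhd> G" by (rule A_normal)
  show "a \<otimes>\<^bsub>G\<^esub> b = b \<otimes>\<^bsub>G\<^esub> a" if ab: "a \<in> A" "b \<in> A" for a b
  proof -
    obtain v w where "a = \<alpha> v" "b = \<alpha> w" using ab unfolding alpha_surj[symmetric] by blast
    then show ?thesis using alpha_add[of v w] alpha_add[of w v] by (simp add: add.commute)
  qed
  show "(\<lambda>C. P (?r C)) \<in> hom ?Q GLZ"
  proof (rule homI)
    show "P (?r C) \<in> carrier GLZ" if "C \<in> carrier ?Q" for C
    proof -
      let ?g = "?r C"
      have g: "?g \<in> carrier G" by (rule coset_rep(1)[OF that])
      have "P ?g ** P (inv\<^bsub>G\<^esub> ?g) = mat 1" "P (inv\<^bsub>G\<^esub> ?g) ** P ?g = mat 1"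
        using g P_A[OF subgroup.one_closed[OF A_subgroup]] by (simp_all flip: P_mult)
      then show ?thesis by (auto simp: GLZ_def invertible_def)
    qed
    show "P (?r (C \<otimes>\<^bsub>?Q\<^esub> D)) = P (?r C) \<otimes>\<^bsub>GLZ\<^esub> P (?r D)"
      if CD: "C \<in> carrier ?Q" "D \<in> carrier ?Q" for C D
    proof -
      obtain a where "a \<in> A" "?r (C <#>\<^bsub>G\<^esub> D) = a \<otimes>\<^bsub>G\<^esub> (?r C \<otimes>\<^bsub>G\<^esub> ?r D)"
        using coset_rep_mult[OF CD] by blast
      then show ?thesis
        using coset_rep(1)[OF CD(1)] coset_rep(1)[OF CD(2)] by (simp add: P_mult P_A A_carrier GLZ_def)
    qed
  qed
  \<comment> \<open>Cancelling \<open>B\<close> recovers \<open>R\<close> from \<open>P\<close>, and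
    \<open>A\<close> is the kernel of \<open>R\<close>.\<close>
  show "inj_on (\<lambda>C. P (?r C)) (carrier ?Q)"
  proof (rule inj_onI)
    fix C D assume CD: "C \<in> carrier ?Q" "D \<in> carrier ?Q" "P (?r C) = P (?r D)"
    have r: "?r C \<in> carrier G" "?r D \<in> carrier G" using CD coset_rep(1) by auto
    have "R (?r C) ** B = R (?r D) ** B" using P[OF r(1)] P[OF r(2)] CD(3) by simp
    then have "R (?r C) = R (?r D)" by (rule int_matrix_cancel_right[OF det_B])
    then have "?r C \<otimes>\<^bsub>G\<^esub> inv\<^bsub>G\<^esub> (?r D) \<in> A"
      using r by (simp add: A_def R_mult R_inv)
    moreover have "?r C = ?r C \<otimes>\<^bsub>G\<^esub> inv\<^bsub>G\<^esub> (?r D) \<otimes>\<^bsub>G\<^esub> ?r D"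
      using r by (simp add: G.m_assoc)
    ultimately have "?r C \<in> A #>\<^bsub>G\<^esub> ?r D" unfolding r_coset_def by blast
    then have "A #>\<^bsub>G\<^esub> ?r D = A #>\<^bsub>G\<^esub> ?r C"
      using G.repr_independence[OF _ r(2) A_subgroup] by blast
    then show "C = D" using coset_rep(2)[OF CD(1)] coset_rep(2)[OF CD(2)] by simp
  qed
  show "\<alpha> \<in> hom Zn (G\<lparr>carrier := A\<rparr>)"
    by (rule homI) (simp_all add: alpha_A Zn_def alpha_add)
  show "\<alpha> ` UNIV = A" by (rule alpha_surj)
  show "\<alpha> (P (?r C) *v v) = conj_act G C (\<alpha> v)" if "C \<in> carrier ?Q" for C v
    using alpha_conj[OF coset_rep(1)[OF that]] by (simp add: conj_act_def)
  \<comment> \<open>Lifting the same coset representatives to \<open>E\<close> gives a section whose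
    cocycle \<open>z\<close> lies exactly over the extension cocycle. Hence the required coboundary
    is witnessed by a constant cochain.\<close>
  define S where "S = (\<lambda>C. sec (?r C))"
  define z where "z = (\<lambda>C D. S C \<otimes>\<^bsub>E\<^esub> S D \<otimes>\<^bsub>E\<^esub> inv\<^bsub>E\<^esub> (S (C <#>\<^bsub>G\<^esub> D)))"
  have S: "S C \<in> carrier E" "\<pi> (S C) = ?r C" if "C \<in> carrier ?Q" for C
    using coset_rep(1)[OF that] by (simp_all add: S_def sec)
  have Qc: "C <#>\<^bsub>G\<^esub> D \<in> carrier ?Q" if "C \<in> carrier ?Q" "D \<in> carrier ?Q" for C D
    using Q.m_closed[OF that] by simp
  have piz: "\<pi> (z C D) = ext_cocycle G C D" if "C \<in> carrier ?Q" "D \<in> carrier ?Q" for C D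
    using that by (simp add: z_def ext_cocycle_def S Qc)
  have z: "z C D \<in> L" if CD: "C \<in> carrier ?Q" "D \<in> carrier ?Q" for C D
  proof -
    obtain a where a: "a \<in> A" "?r (C <#>\<^bsub>G\<^esub> D) = a \<otimes>\<^bsub>G\<^esub> (?r C \<otimes>\<^bsub>G\<^esub> ?r D)"
      using coset_rep_mult[OF CD] by blast
    have "ext_cocycle G C D = inv\<^bsub>G\<^esub> a"
      unfolding ext_cocycle_def a(2)
      using a(1) coset_rep(1)[OF CD(1)] coset_rep(1)[OF CD(2)]
      by (simp add: A_carrier G.inv_mult_group flip: G.m_assoc) (simp add: A_carrier G.m_assoc)
    then have "\<pi> (z C D) \<in> A"
      using piz[OF CD] subgroup.m_inv_closed[OF A_subgroup a(1)] by simp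
    then show ?thesis using CD by (simp add: L_def z_def S Qc)
  qed
  obtain c where c: "\<And>C D. C \<in> carrier ?Q \<Longrightarrow> D \<in> carrier ?Q \<Longrightarrow> \<Theta> (c C D) = z C D"
    using Theta_surj[OF z] by metis
  have ac: "\<alpha> (c C D) = ext_cocycle G C D" if "C \<in> carrier ?Q" "D \<in> carrier ?Q" for C D
    using that by (simp add: \<alpha>_def c piz)
  have "cocycle2 ?Q Zn (\<lambda>C v. P (?r C) *v v) c"
    unfolding cocycle2_def
  proof (intro conjI ballI)
    fix x y w assume xyw: "x \<in> carrier ?Q" "y \<in> carrier ?Q" "w \<in> carrier ?Q"
    note [simp] = S(1)[OF xyw(1)] S(1)[OF xyw(2)] S(1)[OF xyw(3)] S(1)[OF Qc[OF xyw(1,2)]]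
      S(1)[OF Qc[OF xyw(2,3)]] S(1)[OF Qc[OF Qc[OF xyw(1,2)] xyw(3)]] S(1)[OF Qc[OF xyw(1) Qc[OF xyw(2,3)]]]
    have assoc: "x <#>\<^bsub>G\<^esub> y <#>\<^bsub>G\<^esub> w = x <#>\<^bsub>G\<^esub> (y <#>\<^bsub>G\<^esub> w)"
      using Q.m_assoc[OF xyw] by simp
    have canc: "inv\<^bsub>E\<^esub> a \<otimes>\<^bsub>E\<^esub> (a \<otimes>\<^bsub>E\<^esub> b) = b" if "a \<in> carrier E" "b \<in> carrier E" for a b
      using that by (simp flip: E.m_assoc)
    have "\<Theta> (P (?r x) *v c y w + c x (y <#>\<^bsub>G\<^esub> w)) = S x \<otimes>\<^bsub>E\<^esub> z y w \<otimes>\<^bsub>E\<^esub> inv\<^bsub>E\<^esub> (S x) \<otimes>\<^bsub>E\<^esub> z x (y <#>\<^bsub>G\<^esub> w)"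
    proof -
      have "sec (?r x) = S x" by (simp add: S_def)
      then show ?thesis
        using Theta_conj[OF coset_rep(1)[OF xyw(1)], of "c y w"] xyw by (simp add: Theta_add c Qc)
    qed
    also have "\<dots> = z x y \<otimes>\<^bsub>E\<^esub> z (x <#>\<^bsub>G\<^esub> y) w"
      by (simp add: z_def E.m_assoc assoc canc)
    also have "\<dots> = \<Theta> (c x y + c (x <#>\<^bsub>G\<^esub> y) w)"
      using xyw by (simp add: Theta_add c Qc)
    finally show "(P (?r x) *v c y w) \<otimes>\<^bsub>Zn\<^esub> c x (y \<otimes>\<^bsub>?Q\<^esub> w) = c x y \<otimes>\<^bsub>Zn\<^esub> c (x \<otimes>\<^bsub>?Q\<^esub> y) w"
      by (simp add: Theta_inj Zn_def)
  qed (simp add: Zn_def)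
  moreover have "coboundary2 ?Q (G\<lparr>carrier := A\<rparr>) (conj_act G)
      (\<lambda>C1 C2. ext_cocycle G C1 C2 \<otimes>\<^bsub>G\<^esub> inv\<^bsub>G\<^esub> \<alpha> (c C1 C2))"
    unfolding coboundary2_def
  proof (intro exI[of _ "\<lambda>_. \<one>\<^bsub>G\<^esub>"] conjI ballI)
    fix x y assume xy: "x \<in> carrier ?Q" "y \<in> carrier ?Q"
    have "inv\<^bsub>G\<lparr>carrier := A\<rparr>\<^esub> \<one>\<^bsub>G\<^esub> = \<one>\<^bsub>G\<^esub>"
      using G.m_inv_consistent[OF A_subgroup subgroup.one_closed[OF A_subgroup]] by simp
    moreover have "ext_cocycle G x y \<in> carrier G"
      using alpha_A[of "c x y"] A_carrier xy by (simp add: ac)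
    ultimately show "ext_cocycle G x y \<otimes>\<^bsub>G\<^esub> inv\<^bsub>G\<^esub> \<alpha> (c x y)
       = conj_act G x \<one>\<^bsub>G\<^esub> \<otimes>\<^bsub>G\<lparr>carrier := A\<rparr>\<^esub> inv\<^bsub>G\<lparr>carrier := A\<rparr>\<^esub> \<one>\<^bsub>G\<^esub> \<otimes>\<^bsub>G\<lparr>carrier := A\<rparr>\<^esub> \<one>\<^bsub>G\<^esub>"
      using xy by (simp add: ac conj_act_def coset_rep)
  qed (use subgroup.one_closed[OF A_subgroup] in simp)
  ultimately show "\<exists>c. cocycle2 ?Q Zn (\<lambda>C v. P (?r C) *v v) c \<and>
       coboundary2 ?Q (G\<lparr>carrier := A\<rparr>) (conj_act G) (\<lambda>C1 C2. ext_cocycle G C1 C2 \<otimes>\<^bsub>G\<^esub> inv\<^bsub>G\<^esub> \<alpha> (c C1 C2))"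
    by blast
qed

end

section \<open>Lifting torus actions to Euclidean space\<close>

definition torus_cover :: "real^'n \<Rightarrow> complex^'n" where
  "torus_cover x = (\<chi> i. cis (2 * pi * x $ i))"

lemma torus_cover_nth [simp]: "torus_cover x $ i = cis (2 * pi * x $ i)"
  by (simp add: torus_cover_def)

lemma torus_cover_in_torus [simp]: "torus_cover x \<in> torus"
  by (simp add: torus_def)

lemma torus_cover_surj:
  assumes "z \<in> torus"
  obtains x where "torus_cover x = z"
proof
  show "torus_cover (\<chi> i. Arg (z $ i) / (2 * pi)) = z"
    unfolding vec_eq_iff
  proof
    fix i
    have "cmod (z $ i) = 1" using assms by (simp add: torus_def)
    moreover from this have "z $ i \<noteq> 0" by auto
    ultimately show "torus_cover (\<chi> i. Arg (z $ i) / (2 * pi)) $ i = z $ i"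
      using cis_Arg[of "z $ i"] by (auto simp: sgn_div_norm)
  qed
qed

lemma torus_cover_eq_iff: "torus_cover x = torus_cover y \<longleftrightarrow> (\<exists>v. x = y + rvec v)"
proof -
  have cis: "cis (2 * pi * a) = cis (2 * pi * b) \<longleftrightarrow> (\<exists>n. a = b + of_int n)" for a b
  proof -
    have "cis (2 * pi * a) = cis (2 * pi * b) \<longleftrightarrow> (\<exists>n::int. 2 * pi * a = 2 * pi * b + 2 * pi * of_int n)"
      using sin_cos_eq_iff[of "2 * pi * a" "2 * pi * b"] by (auto simp: complex_eq_iff)
    also have "\<dots> \<longleftrightarrow> (\<exists>n::int. 2 * pi * a = 2 * pi * (b + of_int n))" by (simp add: distrib_left)
    finally show ?thesis by simp
  qed
  have "torus_cover x = torus_cover y \<longleftrightarrow> (\<forall>i. \<exists>n. x $ i = y $ i + of_int n)"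
    by (simp add: vec_eq_iff cis)
  also have "\<dots> \<longleftrightarrow> (\<exists>f. \<forall>i. x $ i = y $ i + of_int (f i))" by (rule choice_iff)
  also have "\<dots> \<longleftrightarrow> (\<exists>v. x = y + rvec v)"
  proof
    assume "\<exists>f. \<forall>i. x $ i = y $ i + of_int (f i)"
    then obtain f where "\<forall>i. x $ i = y $ i + of_int (f i)" ..
    then show "\<exists>v. x = y + rvec v" by (intro exI[of _ "\<chi> i. f i"]) (simp add: vec_eq_iff)
  next
    assume "\<exists>v. x = y + rvec v"
    then obtain v where "x = y + rvec v" ..
    then show "\<exists>f. \<forall>i. x $ i = y $ i + of_int (f i)" by (intro exI[of _ "\<lambda>i. v $ i"]) simp
  qed
  finally show ?thesis .
qed

lemma torus_cover_add_rvec [simp]: "torus_cover (x + rvec v) = torus_cover x"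
  using torus_cover_eq_iff by blast

lemma continuous_on_torus_cover: "continuous_on S torus_cover"
  unfolding torus_cover_def by (intro continuous_intros)

text \<open>Coordinatewise, a nowhere vanishing function on a contractible space has a continuous
  logarithm; modulus one makes it purely imaginary, and its imaginary part is the angle.\<close>

lemma torus_map_lift:
  fixes \<psi> :: "complex^'n \<Rightarrow> complex^'n"
  assumes cont: "continuous_on torus \<psi>" and im: "\<psi> ` torus \<subseteq> torus"
  obtains F :: "real^'n \<Rightarrow> real^'n" where "continuous_on UNIV F" "\<And>x. torus_cover (F x) = \<psi> (torus_cover x)"
proof -
  have "\<exists>g. continuous_on UNIV g \<and> (\<forall>x. cis (2 * pi * g x) = \<psi> (torus_cover x) $ i)" for i
  proof -
    have norm1: "cmod (\<psi> (torus_cover x) $ i) = 1" for x :: "real^'n"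
    proof -
      have "\<psi> (torus_cover x) \<in> torus" using im torus_cover_in_torus[of x] by blast
      then show ?thesis by (simp add: torus_def)
    qed
    have "continuous_on UNIV (\<lambda>x::real^'n. \<psi> (torus_cover x) $ i)"
      by (intro continuous_intros continuous_on_compose2[OF cont continuous_on_torus_cover]) auto
    then obtain g where g: "continuous_on UNIV g" "\<And>x::real^'n. \<psi> (torus_cover x) $ i = exp (g x)"
      using continuous_logarithm_on_contractible[of UNIV "\<lambda>x::real^'n. \<psi> (torus_cover x) $ i"] norm1
      by (metis UNIV_I contractible_UNIV norm_zero zero_neq_one)
    have "Re (g x) = 0" for x using norm1[of x] g(2)[of x] by simp
    then have "cis (2 * pi * (Im (g x) / (2 * pi))) = \<psi> (torus_cover x) $ i" for x
      using g(2)[of x] by (simp add: exp_eq_polar)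
    moreover have "continuous_on UNIV (\<lambda>x. Im (g x) / (2 * pi))"
      by (intro continuous_intros g(1)) auto
    ultimately show ?thesis by blast
  qed
  then obtain f where f: "\<And>i. continuous_on UNIV (f i)" "\<And>i x. cis (2 * pi * f i x) = \<psi> (torus_cover x) $ i"
    by metis
  show thesis
  proof
    show "continuous_on UNIV (\<lambda>x. \<chi> i. f i x)" by (intro continuous_on_vec_lambda f)
    show "torus_cover (\<chi> i. f i x) = \<psi> (torus_cover x)" for x by (simp add: vec_eq_iff f)
  qed
qed

text \<open>The difference is continuous with integer coordinates, hence constant because Euclidean
  space is connected.\<close>

lemma torus_lifts_differ_by_translation:
  fixes F H :: "real^'n \<Rightarrow> real^'m"
  assumes "continuous_on UNIV F" "continuous_on UNIV H"
    and "\<And>x. torus_cover (F x) = torus_cover (H x)"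
  obtains v where "\<And>x. F x = H x + rvec v"
proof -
  have "\<forall>x. \<exists>v. F x = H x + rvec v"
    using assms(3) by (simp add: torus_cover_eq_iff)
  from choice[OF this] obtain d where d: "\<And>x. F x = H x + rvec (d x)"
    by blast
  have "\<exists>c. \<forall>x. d x $ i = c" for i
  proof -
    have "(\<lambda>x. (F x - H x) $ i) constant_on UNIV"
    proof (rule continuous_discrete_range_constant[OF connected_UNIV])
      show "continuous_on UNIV (\<lambda>x. (F x - H x) $ i)"
        by (intro continuous_intros assms)
      fix x
      have "1 \<le> norm ((F y - H y) $ i - (F x - H x) $ i)" if "(F y - H y) $ i \<noteq> (F x - H x) $ i" for y
      proof -
        have "1 \<le> \<bar>d y $ i - d x $ i\<bar>" using that by (simp add: d)
        then have "1 \<le> real_of_int \<bar>d y $ i - d x $ i\<bar>" by linarith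
        then show ?thesis by (simp add: d)
      qed
      then show "\<exists>e>0. \<forall>y. y \<in> UNIV \<and> (F y - H y) $ i \<noteq> (F x - H x) $ i \<longrightarrow>
          e \<le> norm ((F y - H y) $ i - (F x - H x) $ i)"
        by (intro exI[of _ 1]) auto
    qed
    then obtain c where "\<And>x. (F x - H x) $ i = c" by (auto simp: constant_on_def)
    then have "real_of_int (d x $ i) = c" for x by (simp add: d)
    then have "d x $ i = \<lfloor>c\<rfloor>" for x by (metis floor_of_int)
    then show ?thesis by blast
  qed
  then obtain c where "\<And>i x. d x $ i = c i" by metis
  then have "d x = (\<chi> i. c i)" for x by (simp add: vec_eq_iff)
  then show thesis using that d by metis
qed

section \<open>The extension formed by all lifts of an action\<close>

locale torus_action = G: group G
  for G :: "('g, 'c) monoid_scheme" +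
  fixes \<phi> :: "'g \<Rightarrow> complex^'n \<Rightarrow> complex^'n"
  assumes fin: "finite (carrier G)" and act: "effective_torus_action G \<phi>"
begin

definition lifts :: "'g \<Rightarrow> (real^'n \<Rightarrow> real^'n) \<Rightarrow> bool" where
  "lifts g F \<longleftrightarrow> g \<in> carrier G \<and> continuous_on UNIV F \<and> (\<forall>x. torus_cover (F x) = \<phi> g (torus_cover x))"

lemma phi_mult: "g \<in> carrier G \<Longrightarrow> h \<in> carrier G \<Longrightarrow> z \<in> torus \<Longrightarrow> \<phi> (g \<otimes>\<^bsub>G\<^esub> h) z = \<phi> g (\<phi> h z)"
  and phi_one: "z \<in> torus \<Longrightarrow> \<phi> \<one>\<^bsub>G\<^esub> z = z"
  and phi_effective: "g \<in> carrier G \<Longrightarrow> (\<And>z. z \<in> torus \<Longrightarrow> \<phi> g z = z) \<Longrightarrow> g = \<one>\<^bsub>G\<^esub>"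
  using act by (auto simp: effective_torus_action_def)

lemma ex_lift:
  assumes "g \<in> carrier G"
  obtains F where "lifts g F"
proof -
  obtain \<psi> where "homeomorphism torus torus (\<phi> g) \<psi>"
    using act assms by (auto simp: effective_torus_action_def)
  then have "continuous_on torus (\<phi> g)" "\<phi> g ` torus \<subseteq> torus"
    by (auto simp: homeomorphism_def)
  then obtain F where "continuous_on UNIV F" "\<And>x. torus_cover (F x) = \<phi> g (torus_cover x)"
    using torus_map_lift by blast
  then show thesis using that assms by (auto simp: lifts_def)
qed

lemma lifts_mult:
  assumes "lifts g F" "lifts h H"
  shows "lifts (g \<otimes>\<^bsub>G\<^esub> h) (F \<circ> H)"
proof -
  have "continuous_on UNIV (F \<circ> H)"
    using assms unfolding lifts_def by (meson continuous_on_compose continuous_on_subset top_greatest)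
  then show ?thesis
    using assms phi_mult by (simp add: lifts_def)
qed

lemma lifts_one: "lifts \<one>\<^bsub>G\<^esub> id"
  by (simp add: lifts_def phi_one)

lemma lifts_translate: "lifts g F \<Longrightarrow> lifts g (\<lambda>x. F x + rvec v)"
  by (auto simp: lifts_def intro!: continuous_intros)

lemma lifts_translate_arg:
  assumes "lifts g F"
  shows "lifts g (\<lambda>x. F (x + rvec v))"
proof -
  have "continuous_on UNIV F" using assms by (simp add: lifts_def)
  then have "continuous_on UNIV (\<lambda>x. F (x + rvec v))"
    by (rule continuous_on_compose2) (auto intro!: continuous_intros)
  then show ?thesis using assms by (simp add: lifts_def)
qed

lemma lifts_differ:
  assumes "lifts g F" "lifts g H"
  obtains v where "\<And>x. F x = H x + rvec v"
  using assms torus_lifts_differ_by_translation[of F H] by (auto simp: lifts_def)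

text \<open>Effectiveness enters here: two group elements with a common lift act alike on the torus.
  This makes \<open>lifted\<close> well defined.\<close>

lemma lifts_unique:
  assumes "lifts g F" "lifts h F"
  shows "g = h"
proof -
  have gh: "g \<in> carrier G" "h \<in> carrier G" using assms by (auto simp: lifts_def)
  have eq: "\<phi> g z = \<phi> h z" if "z \<in> torus" for z
    using assms torus_cover_surj[OF that] unfolding lifts_def by metis
  have "inv\<^bsub>G\<^esub> h \<otimes>\<^bsub>G\<^esub> g = \<one>\<^bsub>G\<^esub>"
  proof (rule phi_effective)
    fix z :: "complex^'n" assume z: "z \<in> torus"
    have "\<phi> (inv\<^bsub>G\<^esub> h \<otimes>\<^bsub>G\<^esub> g) z = \<phi> (inv\<^bsub>G\<^esub> h \<otimes>\<^bsub>G\<^esub> h) z"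
      using gh z by (simp only: phi_mult G.inv_closed eq)
    then show "\<phi> (inv\<^bsub>G\<^esub> h \<otimes>\<^bsub>G\<^esub> g) z = z" using gh z by (simp add: phi_one)
  qed (use gh in simp)
  then show ?thesis using gh by (metis G.inv_closed G.inv_equality G.inv_inv)
qed

text \<open>The elements are bare maps, not pairs: by \<open>lifts_unique\<close> each map
  determines the group element that it lifts.\<close>

definition lift_group :: "(real^'n \<Rightarrow> real^'n) monoid" where
  "lift_group = \<lparr>carrier = {F. \<exists>g. lifts g F}, mult = (\<circ>), one = id\<rparr>"

lemma lift_group_simps [simp]:
  "F \<in> carrier lift_group \<longleftrightarrow> (\<exists>g. lifts g F)"
  "F \<otimes>\<^bsub>lift_group\<^esub> H = F \<circ> H" "\<one>\<^bsub>lift_group\<^esub> = id"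
  by (simp_all add: lift_group_def)

lemma group_lift_group: "group lift_group"
proof (rule groupI)
  fix F assume "F \<in> carrier lift_group"
  then obtain g where F: "lifts g F" by auto
  then have g: "g \<in> carrier G" by (simp add: lifts_def)
  \<comment> \<open>Any lift of the inverse inverts \<open>F\<close> up to a translation, which is
    then absorbed into the lift.\<close>
  obtain H where H: "lifts (inv\<^bsub>G\<^esub> g) H" using ex_lift[of "inv\<^bsub>G\<^esub> g"] g by auto
  have "lifts \<one>\<^bsub>G\<^esub> (H \<circ> F)" using lifts_mult[OF H F] g by simp
  then obtain v where v: "\<And>x. id x = (H \<circ> F) x + rvec v" using lifts_differ[OF lifts_one] by blast
  have "(\<lambda>x. H x + rvec v) \<circ> F = id" using v by (auto simp: fun_eq_iff)
  then show "\<exists>y\<in>carrier lift_group. y \<otimes>\<^bsub>lift_group\<^esub> F = \<one>\<^bsub>lift_group\<^esub>"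
    using lifts_translate[OF H, of v] by (intro bexI[of _ "\<lambda>x. H x + rvec v"]) auto
next
  fix F H assume "F \<in> carrier lift_group" "H \<in> carrier lift_group"
  then show "F \<otimes>\<^bsub>lift_group\<^esub> H \<in> carrier lift_group" using lifts_mult by simp blast
next
  show "\<one>\<^bsub>lift_group\<^esub> \<in> carrier lift_group" using lifts_one by simp blast
qed (simp_all add: comp_assoc)

definition lifted :: "(real^'n \<Rightarrow> real^'n) \<Rightarrow> 'g" where "lifted F = (THE g. lifts g F)"

lemma lifted_eq: "lifts g F \<Longrightarrow> lifted F = g"
  unfolding lifted_def using lifts_unique by blast

text \<open>Precomposing a lift with a lattice translation gives another lift of the same element,
  so the two differ by an integer vector, additive in the translation. All lifts share the matrix
  because they differ by translations.\<close>

lemma ex_linear_part: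
  assumes "g \<in> carrier G"
  shows "\<exists>M. \<forall>F. lifts g F \<longrightarrow> (\<forall>x v. F (x + rvec v) = F x + rvec (M *v v))"
proof -
  obtain F where F: "lifts g F" using ex_lift[OF assms] by blast
  have "\<exists>w. \<forall>x. F (x + rvec v) = F x + rvec w" for v
    using lifts_differ[OF lifts_translate_arg[OF F] F] by metis
  then obtain w where w: "\<And>v x. F (x + rvec v) = F x + rvec (w v)" by metis
  have "w (u + v) = w u + w v" for u v
    using w[of 0 "u + v"] w[of "rvec v" u] w[of 0 v] by (simp add: rvec_add add_ac flip: rvec_inject)
  then obtain M where M: "\<And>v. w v = M *v v" using additive_int_matrix by blast
  have "H (x + rvec v) = H x + rvec (M *v v)" if H: "lifts g H" for H x v
  proof -
    obtain t where "\<And>x. H x = F x + rvec t" using lifts_differ[OF H F] by blast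
    then show ?thesis by (simp add: w M)
  qed
  then show ?thesis by blast
qed

definition linear_part :: "'g \<Rightarrow> int^'n^'n" where
  "linear_part g = (SOME M. \<forall>F. lifts g F \<longrightarrow> (\<forall>x v. F (x + rvec v) = F x + rvec (M *v v)))"

lemma linear_part:
  assumes "lifts g F"
  shows "F (x + rvec v) = F x + rvec (linear_part g *v v)"
proof -
  have "g \<in> carrier G" using assms by (simp add: lifts_def)
  from someI_ex[OF ex_linear_part[OF this]] show ?thesis
    using assms unfolding linear_part_def by blast
qed

text \<open>The displacement is periodic, so all its values are taken on the unit cube, which is
  compact.\<close>

lemma periodic_displacement_bounded:
  fixes F :: "real^'n \<Rightarrow> real^'n"
  assumes cont: "continuous_on UNIV F" and per: "\<And>x v. F (x + rvec v) = F x + rvec v"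
  obtains D where "\<And>x. norm (F x - x) \<le> D"
proof -
  have "compact ((\<lambda>x. F x - x) ` cbox 0 (\<chi> i. 1))"
    by (intro compact_continuous_image compact_cbox continuous_intros continuous_on_subset[OF cont]) auto
  then obtain D where D: "\<And>x. x \<in> cbox 0 (\<chi> i. 1) \<Longrightarrow> norm (F x - x) \<le> D"
    using compact_imp_bounded bounded_iff by (metis (no_types, lifting) image_eqI)
  have "norm (F x - x) \<le> D" for x
  proof -
    define v where "v = (\<chi> i. \<lfloor>x $ i\<rfloor>)"
    have "F x - x = F (x - rvec v) - (x - rvec v)"
      using per[of "x - rvec v" v] by simp
    moreover have "x - rvec v \<in> cbox 0 (\<chi> i. 1)"
      by (auto simp: mem_box_cart v_def) linarith
    ultimately show ?thesis using D by metis
  qed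
  then show thesis using that by blast
qed

lemma lift_group_pow: "F [^]\<^bsub>lift_group\<^esub> (k::nat) = F ^^ k"
  by (induction k) (simp_all add: lift_group_def funpow_Suc_right del: funpow.simps(2))

sublocale lattice_extension G lift_group lifted "\<lambda>v x. x + rvec v" linear_part
proof (intro lattice_extension.intro lattice_extension_axioms.intro group_lift_group fin)
  show "group G" by (rule G.is_group)
  show "lifted \<in> hom lift_group G"
  proof (rule homI)
    fix F assume "F \<in> carrier lift_group"
    then obtain g where g: "lifts g F" by auto
    then have "g \<in> carrier G" by (simp add: lifts_def)
    with g show "lifted F \<in> carrier G" by (simp add: lifted_eq)
  next
    fix F H assume "F \<in> carrier lift_group" "H \<in> carrier lift_group"
    then obtain g h where "lifts g F" "lifts h H" by auto
    then show "lifted (F \<otimes>\<^bsub>lift_group\<^esub> H) = lifted F \<otimes>\<^bsub>G\<^esub> lifted H"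
      using lifted_eq lifts_mult by (metis lift_group_simps(2))
  qed
  then show "lifted ` carrier lift_group = carrier G"
  proof (intro equalityI subsetI)
    fix g assume "g \<in> carrier G"
    then obtain F where "lifts g F" using ex_lift by blast
    then show "g \<in> lifted ` carrier lift_group" by (intro image_eqI[of _ _ F]) (auto simp: lifted_eq)
  qed (auto simp: hom_def)
  have lt: "lifts \<one>\<^bsub>G\<^esub> (\<lambda>x. x + rvec v)" for v
    using lifts_translate[OF lifts_one, of v] by simp
  then show "(\<lambda>v x. x + rvec v) \<in> hom Zn lift_group"
    by (intro homI) (auto simp: Zn_def fun_eq_iff rvec_add add_ac)
  show "inj (\<lambda>(v :: int^'n) x. x + rvec v)"
  proof (rule injI)
    fix v w :: "int^'n" assume "(\<lambda>x. x + rvec v) = (\<lambda>x. x + rvec w)"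
    from fun_cong[OF this, of 0] show "v = w" by simp
  qed
  show "lifted F = \<one>\<^bsub>G\<^esub> \<longleftrightarrow> F \<in> range (\<lambda>v x. x + rvec v)" if "F \<in> carrier lift_group" for F
  proof
    assume "lifted F = \<one>\<^bsub>G\<^esub>"
    then have "lifts \<one>\<^bsub>G\<^esub> F" using that lifted_eq by auto
    then obtain v where "\<And>x. F x = id x + rvec v" using lifts_differ[OF _ lifts_one] by blast
    then have "F = (\<lambda>x. x + rvec v)" by (simp add: fun_eq_iff)
    then show "F \<in> range (\<lambda>v x. x + rvec v)" by blast
  qed (use lt lifted_eq in auto)
  show "F \<otimes>\<^bsub>lift_group\<^esub> (\<lambda>x. x + rvec v) = (\<lambda>x. x + rvec (linear_part (lifted F) *v v)) \<otimes>\<^bsub>lift_group\<^esub> F"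
    if "F \<in> carrier lift_group" for F v
    using that linear_part lifted_eq by (auto simp: fun_eq_iff)
  \<comment> \<open>A trivial linear part makes the displacement of the lift bounded; a lift of
    finite order is then the identity by the rigidity theorem.\<close>
  show "F = \<one>\<^bsub>lift_group\<^esub>" if F: "F \<in> carrier lift_group" "linear_part (lifted F) = mat 1"
    "0 < k" "F [^]\<^bsub>lift_group\<^esub> k = \<one>\<^bsub>lift_group\<^esub>" for F and k :: nat
  proof -
    obtain g where g: "lifts g F" using F(1) by auto
    then have cont: "continuous_on UNIV F" by (simp add: lifts_def)
    have "F (x + rvec v) = F x + rvec v" for x v
      using linear_part[OF g, of x v] F(2) by (simp add: lifted_eq[OF g])
    then obtain D where D: "\<And>x. norm (F x - x) \<le> D"
      using periodic_displacement_bounded[OF cont] by blast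
    then have "F = id"
      using finite_order_bounded_displacement[OF cont _ F(3) D] F(4)
      unfolding lift_group_pow lift_group_simps(3) by blast
    then show ?thesis by simp
  qed
qed

end

section \<open>Affine actions on the torus\<close>

lemma prod_cis: "(\<Prod>i\<in>S. cis (f i)) = cis (\<Sum>i\<in>S. f i)"
  by (induction S rule: infinite_finite_induct) (simp_all add: cis_mult)

text \<open>The action is the descent to the torus of the affine maps with linear part
  \<open>M g\<close> and translation part \<open>\<beta> g\<close>. Since \<open>torus_cover\<close>
  forgets lattice vectors, composition up to \<open>rvec v\<close> is enough.\<close>

lemma affine_torus_action:
  fixes M :: "'g \<Rightarrow> int^'n^'n" and \<beta> :: "'g \<Rightarrow> real^'n"
  assumes "group G"
    and M_mult: "\<And>g h. g \<in> carrier G \<Longrightarrow> h \<in> carrier G \<Longrightarrow> M (g \<otimes>\<^bsub>G\<^esub> h) = M g ** M h"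
    and M_one: "M \<one>\<^bsub>G\<^esub> = mat 1"
    and \<beta>_mult: "\<And>g h. g \<in> carrier G \<Longrightarrow> h \<in> carrier G \<Longrightarrow>
       \<exists>v. \<beta> g + rmat (M g) *v \<beta> h = \<beta> (g \<otimes>\<^bsub>G\<^esub> h) + rvec v"
    and faithful: "\<And>g. g \<in> carrier G \<Longrightarrow> M g = mat 1 \<Longrightarrow> \<beta> g \<in> range rvec \<Longrightarrow> g = \<one>\<^bsub>G\<^esub>"
  shows "\<exists>\<phi> :: 'g \<Rightarrow> complex^'n \<Rightarrow> complex^'n. effective_torus_action G \<phi>"
proof -
  interpret G: group G by fact
  \<comment> \<open>The affine map in circle coordinates: an integer matrix acts by
    monomials.\<close>
  define \<phi> :: "'g \<Rightarrow> complex^'n \<Rightarrow> complex^'n"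
    where "\<phi> = (\<lambda>g z. \<chi> i. cis (2 * pi * \<beta> g $ i) * (\<Prod>j\<in>UNIV. z $ j powi (M g $ i $ j)))"
  have cover: "\<phi> g (torus_cover x) = torus_cover (\<beta> g + rmat (M g) *v x)" for g x
  proof -
    have "\<phi> g (torus_cover x) $ i = torus_cover (\<beta> g + rmat (M g) *v x) $ i" for i
      by (simp add: \<phi>_def cis_power_int prod_cis cis_mult matrix_vector_mult_def distrib_left
          sum_distrib_left mult_ac)
    then show ?thesis by (simp add: vec_eq_iff)
  qed
  have cont: "continuous_on torus (\<phi> g)" for g
  proof -
    have "z $ j \<noteq> 0" if "z \<in> torus" for z :: "complex^'n" and j
      using that by (auto simp: torus_def dest!: spec[of _ j])
    then show ?thesis
      unfolding \<phi>_def by (intro continuous_intros) auto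
  qed
  have into: "\<phi> g z \<in> torus" if "z \<in> torus" for g z
    using torus_cover_surj[OF that] cover by (metis torus_cover_in_torus)
  have mult: "\<phi> (g \<otimes>\<^bsub>G\<^esub> h) z = \<phi> g (\<phi> h z)"
    if gh: "g \<in> carrier G" "h \<in> carrier G" and z: "z \<in> torus" for g h z
  proof -
    obtain x where x: "torus_cover x = z" using torus_cover_surj[OF z] .
    obtain v where v: "\<beta> g + rmat (M g) *v \<beta> h = \<beta> (g \<otimes>\<^bsub>G\<^esub> h) + rvec v"
      using \<beta>_mult[OF gh] by blast
    have "\<phi> g (\<phi> h z) = torus_cover (\<beta> g + rmat (M g) *v (\<beta> h + rmat (M h) *v x))"
      by (simp add: cover flip: x)
    also have "\<beta> g + rmat (M g) *v (\<beta> h + rmat (M h) *v x)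
        = (\<beta> g + rmat (M g) *v \<beta> h) + rmat (M (g \<otimes>\<^bsub>G\<^esub> h)) *v x"
      by (simp add: matrix_vector_right_distrib matrix_vector_mul_assoc M_mult gh rmat_mult)
    also have "\<dots> = \<beta> (g \<otimes>\<^bsub>G\<^esub> h) + rmat (M (g \<otimes>\<^bsub>G\<^esub> h)) *v x + rvec v"
      unfolding v by simp
    finally show ?thesis by (simp add: cover flip: x)
  qed
  have one: "\<phi> \<one>\<^bsub>G\<^esub> z = z" if z: "z \<in> torus" for z
  proof -
    obtain x where x: "torus_cover x = z" using torus_cover_surj[OF z] .
    obtain v where "\<beta> \<one>\<^bsub>G\<^esub> = rvec v" using \<beta>_mult[of "\<one>\<^bsub>G\<^esub>" "\<one>\<^bsub>G\<^esub>"] by (auto simp: M_one)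
    then show ?thesis by (simp add: cover M_one add.commute[of "rvec v"] flip: x)
  qed
  have inv: "\<phi> (inv\<^bsub>G\<^esub> g) (\<phi> g z) = z" "\<phi> g (\<phi> (inv\<^bsub>G\<^esub> g) z) = z"
    if "g \<in> carrier G" "z \<in> torus" for g z
    using that by (simp_all add: one flip: mult)
  have homeo: "homeomorphism torus torus (\<phi> g) (\<phi> (inv\<^bsub>G\<^esub> g))" if "g \<in> carrier G" for g
    using inv[OF that] into cont by (intro homeomorphismI) auto
  have eff: "g = \<one>\<^bsub>G\<^esub>" if g: "g \<in> carrier G" and triv: "\<And>z. z \<in> torus \<Longrightarrow> \<phi> g z = z" for g
  proof -
    have ev: "\<exists>v. \<beta> g + rmat (M g) *v x = x + rvec v" for x
      using triv[of "torus_cover x"] by (simp add: cover torus_cover_eq_iff)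
    from ev[of 0] have b: "\<beta> g \<in> range rvec" by auto
    then obtain w where w: "\<beta> g = rvec w" by auto
    have "M g $ i $ j = mat 1 $ i $ j" for i j
    proof (rule ccontr)
      define k where "k = M g $ i $ j - mat 1 $ i $ j"
      assume "M g $ i $ j \<noteq> mat 1 $ i $ j"
      then have k: "k \<noteq> 0" by (simp add: k_def)
      \<comment> \<open>Chosen so that \<open>k * t\<close> is one half: a vector with entry
        \<open>t\<close> at \<open>j\<close> then has \<open>i\<close>-th displacement one half more
        than the integer \<open>w $ i\<close>, which no lattice vector allows.\<close>
      define t where "t = 1 / (2 * real_of_int k)"
      obtain v where v: "\<beta> g + rmat (M g) *v axis j t = axis j t + rvec v" using ev by blast
      have "(rmat (M g) *v axis j t) $ i = M g $ i $ j * t"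
        by (simp add: matrix_vector_mult_def axis_def if_distrib [of "\<lambda>x. _ * x"] cong: if_cong)
      moreover have "axis j t $ i = real_of_int (mat 1 $ i $ j) * t"
        by (simp add: axis_def mat_def)
      ultimately have "real_of_int (w $ i) + M g $ i $ j * t = real_of_int (mat 1 $ i $ j) * t + v $ i"
        using arg_cong[OF v, of "\<lambda>x. x $ i"] by (simp add: w)
      then have "real_of_int k * t = real_of_int (v $ i - w $ i)"
        by (simp add: k_def algebra_simps)
      then have "real_of_int (2 * (v $ i - w $ i)) = 1" using k by (simp add: t_def)
      then have "2 * (v $ i - w $ i) = 1" by (simp only: of_int_eq_1_iff)
      then show False by presburger
    qed
    then have "M g = mat 1" by (simp add: vec_eq_iff)
    then show ?thesis using faithful g b by blast
  qed
  have "effective_torus_action G \<phi>"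
    unfolding effective_torus_action_def using homeo mult one eff by blast
  then show ?thesis by blast
qed

section \<open>Affine actions built from extension data\<close>

lemma torus_action_of_extension_data:
  fixes G :: "('g, 'c) monoid_scheme" and \<rho> :: "'g set \<Rightarrow> int^'n^'n" and \<alpha> :: "int^'n \<Rightarrow> 'g"
  assumes "group G" and fin: "finite (carrier G)" and A: "A \<lhd> G"
    and comm: "\<And>a b. a \<in> A \<Longrightarrow> b \<in> A \<Longrightarrow> a \<otimes>\<^bsub>G\<^esub> b = b \<otimes>\<^bsub>G\<^esub> a"
    and \<rho>: "\<rho> \<in> hom (G Mod A) GLZ" "inj_on \<rho> (carrier (G Mod A))"
    and \<alpha>: "\<alpha> \<in> hom Zn (G\<lparr>carrier := A\<rparr>)" "range \<alpha> = A"
    and equiv: "\<And>C v. C \<in> carrier (G Mod A) \<Longrightarrow> \<alpha> (\<rho> C *v v) = conj_act G C (\<alpha> v)"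
    and coc: "cocycle2 (G Mod A) Zn (\<lambda>C v. \<rho> C *v v) c"
    and cob: "coboundary2 (G Mod A) (G\<lparr>carrier := A\<rparr>) (conj_act G)
                 (\<lambda>C1 C2. ext_cocycle G C1 C2 \<otimes>\<^bsub>G\<^esub> inv\<^bsub>G\<^esub> (\<alpha> (c C1 C2)))"
  shows "\<exists>\<phi> :: 'g \<Rightarrow> complex^'n \<Rightarrow> complex^'n. effective_torus_action G \<phi>"
proof -
  interpret G: group G by fact
  let ?Q = "G Mod A" and ?r = "coset_rep :: 'g set \<Rightarrow> 'g"
  interpret Q: group ?Q by (rule normal.factorgroup_is_group[OF A])
  have sub: "subgroup A G" using A by (rule normal_imp_subgroup)
  note Aclosed = subgroup.m_closed[OF sub] subgroup.m_inv_closed[OF sub] subgroup.one_closed[OF sub]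
  have Ac: "a \<in> carrier G" if "a \<in> A" for a using subgroup.mem_carrier[OF sub that] .
  have finA: "finite A" using fin subgroup.subset[OF sub] finite_subset by blast
  have alphaA: "\<alpha> v \<in> A" for v using \<alpha>(2) by blast
  have alpha_add: "\<alpha> (v + w) = \<alpha> v \<otimes>\<^bsub>G\<^esub> \<alpha> w" for v w
    using \<alpha>(1) by (simp add: hom_def Zn_def)
  have alpha0: "\<alpha> 0 = \<one>\<^bsub>G\<^esub>"
    using alpha_add[of 0 0] G.r_cancel_one[of "\<alpha> 0" "\<alpha> 0"] Ac[OF alphaA] by simp
  have alpha_neg: "\<alpha> (- v) = inv\<^bsub>G\<^esub> (\<alpha> v)" for v
    using alpha_add[of "- v" v] alpha0 G.inv_equality[of "\<alpha> (- v)" "\<alpha> v"] Ac[OF alphaA] by simp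
  have Qmult: "C \<otimes>\<^bsub>?Q\<^esub> D = C <#>\<^bsub>G\<^esub> D" for C D by simp
  have Qc: "C <#>\<^bsub>G\<^esub> D \<in> carrier ?Q" if "C \<in> carrier ?Q" "D \<in> carrier ?Q" for C D
    using Q.m_closed[OF that] by simp
  have cosQ: "A #>\<^bsub>G\<^esub> g \<in> carrier ?Q" if "g \<in> carrier G" for g
    using that by (auto simp: FactGroup_def RCOSETS_def)
  note rep = coset_rep_factor_group[OF \<open>group G\<close> sub]
  have cos_mult: "A #>\<^bsub>G\<^esub> (g \<otimes>\<^bsub>G\<^esub> h) = (A #>\<^bsub>G\<^esub> g) <#>\<^bsub>G\<^esub> (A #>\<^bsub>G\<^esub> h)"
    if "g \<in> carrier G" "h \<in> carrier G" for g h
    using normal.rcos_sum[OF A that] by simp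
  have conjA: "conj_act G C a \<in> A" if "C \<in> carrier ?Q" "a \<in> A" for C a
    unfolding conj_act_def using normal.inv_op_closed2[OF A rep(1)[OF that(1)] that(2)] .

  have rho_mult: "\<rho> (C <#>\<^bsub>G\<^esub> D) = \<rho> C ** \<rho> D" if "C \<in> carrier ?Q" "D \<in> carrier ?Q" for C D
    using \<rho>(1) that by (simp add: hom_def GLZ_def)
  \<comment> \<open>An invertible idempotent is the identity.\<close>
  have rho_one: "\<rho> A = mat 1"
  proof -
    have "A \<in> carrier ?Q" using Q.one_closed by simp
    then have "\<rho> A \<in> carrier GLZ" using \<rho>(1) by (auto simp: hom_def)
    then obtain N where N: "N ** \<rho> A = mat 1" by (auto simp: GLZ_def invertible_def)
    have "\<rho> A ** \<rho> A = \<rho> A" using rho_mult[of A A] Q.one_closed Q.l_one[OF Q.one_closed] by simp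
    then show ?thesis using N by (metis matrix_mul_assoc matrix_mul_lid)
  qed

  obtain k where k: "\<And>C. C \<in> carrier ?Q \<Longrightarrow> k C \<in> A"
    and kk: "\<And>C D. C \<in> carrier ?Q \<Longrightarrow> D \<in> carrier ?Q \<Longrightarrow>
       ext_cocycle G C D \<otimes>\<^bsub>G\<^esub> inv\<^bsub>G\<^esub> (\<alpha> (c C D))
       = conj_act G C (k D) \<otimes>\<^bsub>G\<^esub> inv\<^bsub>G\<^esub> (k (C <#>\<^bsub>G\<^esub> D)) \<otimes>\<^bsub>G\<^esub> k C"
  proof -
    from cob obtain h where h: "\<forall>C\<in>carrier ?Q. h C \<in> A"
      "\<And>C D. C \<in> carrier ?Q \<Longrightarrow> D \<in> carrier ?Q \<Longrightarrow>
        ext_cocycle G C D \<otimes>\<^bsub>G\<^esub> inv\<^bsub>G\<^esub> (\<alpha> (c C D))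
        = conj_act G C (h D) \<otimes>\<^bsub>G\<^esub> inv\<^bsub>G\<lparr>carrier := A\<rparr>\<^esub> (h (C <#>\<^bsub>G\<^esub> D)) \<otimes>\<^bsub>G\<^esub> h C"
      unfolding coboundary2_def by auto
    then show thesis using Qc by (intro that[of h]) (simp_all add: G.m_inv_consistent[OF sub])
  qed
  \<comment> \<open>Correcting the representatives by the cochain \<open>k\<close> absorbs the
    coboundary: the cocycle of the section \<open>u\<close> is exactly \<open>\<alpha>\<close>
    applied to \<open>c\<close>.\<close>
  define u where "u = (\<lambda>C. inv\<^bsub>G\<^esub> (k C) \<otimes>\<^bsub>G\<^esub> ?r C)"
  have uc: "u C \<in> carrier G" if "C \<in> carrier ?Q" for C
    using that by (simp add: u_def k Ac rep)
  have u_alpha: "u C \<otimes>\<^bsub>G\<^esub> \<alpha> v = \<alpha> (\<rho> C *v v) \<otimes>\<^bsub>G\<^esub> u C" if C: "C \<in> carrier ?Q" for C v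
  proof -
    note [simp] = rep(1)[OF C] Ac[OF k[OF C]] Ac[OF alphaA]
    have "u C \<otimes>\<^bsub>G\<^esub> \<alpha> v = inv\<^bsub>G\<^esub> (k C) \<otimes>\<^bsub>G\<^esub> (\<alpha> (\<rho> C *v v) \<otimes>\<^bsub>G\<^esub> ?r C)"
      by (simp add: equiv[OF C] conj_act_def u_def G.m_assoc)
    also have "\<dots> = inv\<^bsub>G\<^esub> (k C) \<otimes>\<^bsub>G\<^esub> \<alpha> (\<rho> C *v v) \<otimes>\<^bsub>G\<^esub> ?r C"
      by (simp add: G.m_assoc)
    also have "inv\<^bsub>G\<^esub> (k C) \<otimes>\<^bsub>G\<^esub> \<alpha> (\<rho> C *v v) = \<alpha> (\<rho> C *v v) \<otimes>\<^bsub>G\<^esub> inv\<^bsub>G\<^esub> (k C)"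
      by (rule comm) (simp_all add: alphaA k C Aclosed)
    finally show ?thesis by (simp add: u_def G.m_assoc)
  qed
  have u_mult: "u C \<otimes>\<^bsub>G\<^esub> u D = \<alpha> (c C D) \<otimes>\<^bsub>G\<^esub> u (C <#>\<^bsub>G\<^esub> D)"
    if CD: "C \<in> carrier ?Q" "D \<in> carrier ?Q" for C D
  proof -
    define a x l m where "a = k C" and "x = conj_act G C (k D)" and "l = k (C <#>\<^bsub>G\<^esub> D)" and "m = \<alpha> (c C D)"
    have mem: "a \<in> A" "x \<in> A" "l \<in> A" "m \<in> A" "k D \<in> A"
      using CD k conjA alphaA Qc by (auto simp: a_def x_def l_def m_def)
    note [simp] = mem[THEN Ac] rep(1)[OF CD(1)] rep(1)[OF CD(2)] rep(1)[OF Qc[OF CD]]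
    let ?e = "ext_cocycle G C D"
    have e: "?e \<in> carrier G" by (simp add: ext_cocycle_def)
    have "?e \<otimes>\<^bsub>G\<^esub> inv\<^bsub>G\<^esub> m = x \<otimes>\<^bsub>G\<^esub> inv\<^bsub>G\<^esub> l \<otimes>\<^bsub>G\<^esub> a"
      using kk[OF CD] by (simp add: a_def x_def l_def m_def)
    then have em: "?e = x \<otimes>\<^bsub>G\<^esub> inv\<^bsub>G\<^esub> l \<otimes>\<^bsub>G\<^esub> a \<otimes>\<^bsub>G\<^esub> m"
      using e G.inv_solve_right'[of "x \<otimes>\<^bsub>G\<^esub> inv\<^bsub>G\<^esub> l \<otimes>\<^bsub>G\<^esub> a" ?e m] by simp
    have "?e \<otimes>\<^bsub>G\<^esub> ?r (C <#>\<^bsub>G\<^esub> D) = ?r C \<otimes>\<^bsub>G\<^esub> ?r D"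
      by (simp add: ext_cocycle_def G.m_assoc)
    moreover have "?r C \<otimes>\<^bsub>G\<^esub> inv\<^bsub>G\<^esub> (k D) = inv\<^bsub>G\<^esub> x \<otimes>\<^bsub>G\<^esub> ?r C"
      by (simp add: x_def conj_act_def G.inv_mult_group G.m_assoc)
    ultimately have "u C \<otimes>\<^bsub>G\<^esub> u D = inv\<^bsub>G\<^esub> a \<otimes>\<^bsub>G\<^esub> (inv\<^bsub>G\<^esub> x \<otimes>\<^bsub>G\<^esub> (?e \<otimes>\<^bsub>G\<^esub> ?r (C <#>\<^bsub>G\<^esub> D)))"
      by (simp add: u_def a_def[symmetric] G.m_assoc) (simp flip: G.m_assoc)
    also have "\<dots> = inv\<^bsub>G\<^esub> a \<otimes>\<^bsub>G\<^esub> ((inv\<^bsub>G\<^esub> l \<otimes>\<^bsub>G\<^esub> a) \<otimes>\<^bsub>G\<^esub> (m \<otimes>\<^bsub>G\<^esub> ?r (C <#>\<^bsub>G\<^esub> D)))"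
      unfolding em using G.m_assoc[of "inv\<^bsub>G\<^esub> x" x] by (simp add: G.m_assoc flip: G.m_assoc[of "inv\<^bsub>G\<^esub> x" x])
    also have "inv\<^bsub>G\<^esub> l \<otimes>\<^bsub>G\<^esub> a = a \<otimes>\<^bsub>G\<^esub> inv\<^bsub>G\<^esub> l"
      by (rule comm) (simp_all add: mem Aclosed)
    also have "inv\<^bsub>G\<^esub> a \<otimes>\<^bsub>G\<^esub> (a \<otimes>\<^bsub>G\<^esub> inv\<^bsub>G\<^esub> l \<otimes>\<^bsub>G\<^esub> (m \<otimes>\<^bsub>G\<^esub> ?r (C <#>\<^bsub>G\<^esub> D))) = (inv\<^bsub>G\<^esub> l \<otimes>\<^bsub>G\<^esub> m) \<otimes>\<^bsub>G\<^esub> ?r (C <#>\<^bsub>G\<^esub> D)"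
      by (simp flip: G.m_assoc)
    also have "inv\<^bsub>G\<^esub> l \<otimes>\<^bsub>G\<^esub> m = m \<otimes>\<^bsub>G\<^esub> inv\<^bsub>G\<^esub> l"
      by (rule comm) (simp_all add: mem Aclosed)
    finally have "u C \<otimes>\<^bsub>G\<^esub> u D = m \<otimes>\<^bsub>G\<^esub> (inv\<^bsub>G\<^esub> l \<otimes>\<^bsub>G\<^esub> ?r (C <#>\<^bsub>G\<^esub> D))"
      by (simp add: G.m_assoc)
    then show ?thesis by (simp only: u_def l_def m_def)
  qed
  have "\<exists>v. g = \<alpha> v \<otimes>\<^bsub>G\<^esub> u (A #>\<^bsub>G\<^esub> g)" if g: "g \<in> carrier G" for g
  proof -
    let ?C = "A #>\<^bsub>G\<^esub> g"
    have C: "?C \<in> carrier ?Q" by (rule cosQ[OF g])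
    have "g \<in> A #>\<^bsub>G\<^esub> ?r ?C" using rep(2)[OF C] G.rcos_self[OF g sub] by simp
    then obtain a where a: "a \<in> A" "g = a \<otimes>\<^bsub>G\<^esub> ?r ?C" by (auto simp: r_coset_def)
    have "a \<otimes>\<^bsub>G\<^esub> k ?C \<in> A" using a k[OF C] Aclosed by simp
    then obtain v where v: "\<alpha> v = a \<otimes>\<^bsub>G\<^esub> k ?C" using \<alpha>(2) by (metis rangeE)
    have "\<alpha> v \<otimes>\<^bsub>G\<^esub> u ?C = g"
      unfolding v u_def using a(1) Ac[OF k[OF C]] rep(1)[OF C]
      by (subst a(2)) (simp add: Ac G.m_assoc flip: G.m_assoc[of "k ?C" "inv\<^bsub>G\<^esub> (k ?C)"])
    then show ?thesis by metis
  qed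
  then obtain V where V: "\<And>g. g \<in> carrier G \<Longrightarrow> g = \<alpha> (V g) \<otimes>\<^bsub>G\<^esub> u (A #>\<^bsub>G\<^esub> g)" by metis

  \<comment> \<open>The lattice vectors that have to act trivially. Since \<open>\<alpha>\<close>
    has finite image, they have finite index, and Euclidean space modulo this lattice, in the basis
    \<open>B\<close>, is the torus acted upon.\<close>
  define K where "K = {v. \<alpha> v = \<one>\<^bsub>G\<^esub>}"
  obtain B :: "int^'n^'n" where B: "det B \<noteq> 0" "K = range ((*v) B)"
  proof (rule finite_index_sublattice_basis [of K "int (card A)"])
    show "v + w \<in> K" if "v \<in> K" "w \<in> K" for v w using that by (simp add: K_def alpha_add)
    show "- v \<in> K" if "v \<in> K" for v using that by (simp add: K_def alpha_neg)
    show "int (card A) \<noteq> 0" using finA Aclosed(3) by auto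
    show "int (card A) *s v \<in> K" for v
    proof -
      interpret AG: group "G\<lparr>carrier := A\<rparr>"
        using sub by (rule subgroup.subgroup_is_group) (rule G.is_group)
      have pow: "\<alpha> (int j *s v) = \<alpha> v [^]\<^bsub>G\<^esub> j" for j
      proof (induction j)
        case (Suc j)
        have "int (Suc j) *s v = int j *s v + v" by (simp add: vec_eq_iff algebra_simps)
        then have "\<alpha> (int (Suc j) *s v) = \<alpha> v [^]\<^bsub>G\<^esub> j \<otimes>\<^bsub>G\<^esub> \<alpha> v"
          by (simp only: alpha_add Suc.IH)
        then show ?case by simp
      qed (simp add: alpha0)
      have "\<alpha> v [^]\<^bsub>G\<lparr>carrier := A\<rparr>\<^esub> card A = \<one>\<^bsub>G\<^esub>"
        using AG.pow_order_eq_1[of "\<alpha> v"] alphaA by (simp add: order_def)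
      then show ?thesis by (simp add: K_def pow flip: G.nat_pow_consistent)
    qed
  qed
  \<comment> \<open>By equivariance the kernel of \<open>\<alpha>\<close> is stable under
    \<open>\<rho>\<close>; \<open>M\<close> is the action in its basis.\<close>
  have "\<exists>M. B ** M = \<rho> C ** B" if C: "C \<in> carrier ?Q" for C
  proof -
    have "\<rho> C *v (B *v v) \<in> range ((*v) B)" for v
    proof -
      have "B *v v \<in> K" using B by blast
      then have "\<alpha> (\<rho> C *v (B *v v)) = \<one>\<^bsub>G\<^esub>"
        using rep(1)[OF C] by (simp add: K_def equiv[OF C] conj_act_def)
      then show ?thesis unfolding B(2)[symmetric] by (simp add: K_def)
    qed
    then show ?thesis using ex_intertwining_int_matrix[OF B(1)] by metis
  qed
  then obtain M where M: "\<And>C. C \<in> carrier ?Q \<Longrightarrow> B ** M C = \<rho> C ** B" by metis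

  define b where "b = (\<lambda>C. (1 / real (card (carrier ?Q))) *\<^sub>R (\<Sum>D\<in>carrier ?Q. rvec (c C D)))"
  have finQ: "finite (carrier ?Q)"
    using fin by (simp add: FactGroup_def RCOSETS_def r_coset_def)
  have cardQ: "card (carrier ?Q) > 0" using finQ Q.one_closed by (auto simp: card_gt_0_iff)
  \<comment> \<open>The cocycle identity is summed over its last argument. Multiplication by
    \<open>D\<close> permutes the quotient group, so the shifted sum is again a multiple of
    \<open>b C\<close>.\<close>
  have b_mult: "b C + rmat (\<rho> C) *v b D = b (C <#>\<^bsub>G\<^esub> D) + rvec (c C D)"
    if CD: "C \<in> carrier ?Q" "D \<in> carrier ?Q" for C D
  proof -
    let ?n = "real (card (carrier ?Q))"
    have "rmat (\<rho> C) *v rvec (c D E) + rvec (c C (D <#>\<^bsub>G\<^esub> E)) = rvec (c C D) + rvec (c (C <#>\<^bsub>G\<^esub> D) E)"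
      if "E \<in> carrier ?Q" for E
      using coc CD that by (simp add: cocycle2_def Zn_def rmat_mult_rvec flip: rvec_add)
    then have "(\<Sum>E\<in>carrier ?Q. rmat (\<rho> C) *v rvec (c D E)) + (\<Sum>E\<in>carrier ?Q. rvec (c C (D <#>\<^bsub>G\<^esub> E)))
       = (\<Sum>E\<in>carrier ?Q. rvec (c C D)) + (\<Sum>E\<in>carrier ?Q. rvec (c (C <#>\<^bsub>G\<^esub> D) E))"
      unfolding sum.distrib[symmetric] by (intro sum.cong refl)
    moreover have "(\<Sum>E\<in>carrier ?Q. rvec (c C (D <#>\<^bsub>G\<^esub> E))) = (\<Sum>E\<in>carrier ?Q. rvec (c C E))"
    proof (rule sum.reindex_bij_witness[of _ "\<lambda>E. inv\<^bsub>?Q\<^esub> D \<otimes>\<^bsub>?Q\<^esub> E" "\<lambda>E. D \<otimes>\<^bsub>?Q\<^esub> E"])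
      fix E assume E: "E \<in> carrier ?Q"
      show "inv\<^bsub>?Q\<^esub> D \<otimes>\<^bsub>?Q\<^esub> (D \<otimes>\<^bsub>?Q\<^esub> E) = E" "D \<otimes>\<^bsub>?Q\<^esub> (inv\<^bsub>?Q\<^esub> D \<otimes>\<^bsub>?Q\<^esub> E) = E"
        using E CD by (simp_all only: Q.m_assoc[symmetric] Q.inv_closed Q.l_inv Q.r_inv Q.l_one)
      show "D \<otimes>\<^bsub>?Q\<^esub> E \<in> carrier ?Q" "inv\<^bsub>?Q\<^esub> D \<otimes>\<^bsub>?Q\<^esub> E \<in> carrier ?Q"
        using E CD Q.m_closed Q.inv_closed by blast+
    qed (simp only: Qmult)
    moreover have "(\<Sum>E\<in>carrier ?Q. rvec (c C' E)) = ?n *\<^sub>R b C'" for C'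
      using cardQ by (simp add: b_def)
    moreover have "(\<Sum>E\<in>carrier ?Q. rmat (\<rho> C) *v rvec (c D E)) = rmat (\<rho> C) *v (\<Sum>E\<in>carrier ?Q. rvec (c D E))"
      using linear_sum[OF matrix_vector_mul_linear] by metis
    moreover have "(\<Sum>E\<in>carrier ?Q. rvec (c C D)) = ?n *\<^sub>R rvec (c C D)"
      by (rule sum_constant_scaleR)
    ultimately have "?n *\<^sub>R (rmat (\<rho> C) *v b D + b C) = ?n *\<^sub>R (rvec (c C D) + b (C <#>\<^bsub>G\<^esub> D))"
      by (simp only: matrix_vector_mult_scaleR scaleR_add_right)
    then show ?thesis using cardQ by (simp add: add.commute)
  qed

  have "invertible (rmat B)" using B(1) by (simp add: invertible_det_nz det_rmat)
  then obtain B' where B': "rmat B ** B' = mat 1" "B' ** rmat B = mat 1" by (auto simp: invertible_def)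
  have B_inj: "x = y" if "rmat B *v x = rmat B *v y" for x y
    using arg_cong[OF that, of "(*v) B'"] B' by (simp add: matrix_vector_mul_assoc)
  let ?C = "\<lambda>g. A #>\<^bsub>G\<^esub> g"
  \<comment> \<open>The element \<open>\<alpha> (V g)\<close> times its representative acts with
    translation part \<open>V g\<close> plus the averaged cocycle. Applying \<open>B'\<close>
    expresses this in the basis of the kernel, so that kernel vectors become integer
    vectors.\<close>
  define \<beta> where "\<beta> = (\<lambda>g. B' *v (rvec (V g) + b (?C g)))"
  have \<beta>: "rmat B *v \<beta> g = rvec (V g) + b (?C g)" for g
    using B' by (simp add: \<beta>_def matrix_vector_mul_assoc)
  have BM: "rmat B *v (rmat (M C) *v x) = rmat (\<rho> C) *v (rmat B *v x)" if "C \<in> carrier ?Q" for C x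
    using M[OF that] by (simp add: matrix_vector_mul_assoc flip: rmat_mult)
  show ?thesis
  proof (rule affine_torus_action [where M = "\<lambda>g. M (?C g)" and \<beta> = \<beta>])
    show "group G" by fact
    fix g h assume gh: "g \<in> carrier G" "h \<in> carrier G"
    let ?D = "?C g <#>\<^bsub>G\<^esub> ?C h"
    note Cg = cosQ[OF gh(1)] and Ch = cosQ[OF gh(2)]
    have "B ** (M (?C g) ** M (?C h)) = \<rho> (?C g) ** (B ** M (?C h))"
      by (simp only: matrix_mul_assoc M[OF Cg])
    also have "\<dots> = B ** M ?D"
      by (simp only: matrix_mul_assoc M[OF Ch] M[OF Qc[OF Cg Ch]] rho_mult[OF Cg Ch])
    finally show "M (?C (g \<otimes>\<^bsub>G\<^esub> h)) = M (?C g) ** M (?C h)"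
      using int_matrix_cancel_left[OF B(1)] cos_mult[OF gh] by metis
    \<comment> \<open>Moving \<open>\<alpha> (V h)\<close> across a representative and merging the
      two representatives gives a second lattice vector for the product; it differs from the chosen
      one by a kernel vector.\<close>
    let ?s = "V g + \<rho> (?C g) *v V h + c (?C g) (?C h)"
    note [simp] = Ac[OF alphaA] uc[OF Cg] uc[OF Ch] uc[OF Qc[OF Cg Ch]]
    have "\<alpha> (V (g \<otimes>\<^bsub>G\<^esub> h)) \<otimes>\<^bsub>G\<^esub> u ?D = g \<otimes>\<^bsub>G\<^esub> h"
      using V[of "g \<otimes>\<^bsub>G\<^esub> h"] gh by (simp add: cos_mult)
    also have "\<dots> = (\<alpha> (V g) \<otimes>\<^bsub>G\<^esub> u (?C g)) \<otimes>\<^bsub>G\<^esub> (\<alpha> (V h) \<otimes>\<^bsub>G\<^esub> u (?C h))"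
      using V[OF gh(1)] V[OF gh(2)] by simp
    also have "\<dots> = \<alpha> (V g) \<otimes>\<^bsub>G\<^esub> ((u (?C g) \<otimes>\<^bsub>G\<^esub> \<alpha> (V h)) \<otimes>\<^bsub>G\<^esub> u (?C h))"
      by (simp add: G.m_assoc)
    also have "\<dots> = \<alpha> (V g) \<otimes>\<^bsub>G\<^esub> (\<alpha> (\<rho> (?C g) *v V h) \<otimes>\<^bsub>G\<^esub> (u (?C g) \<otimes>\<^bsub>G\<^esub> u (?C h)))"
      unfolding u_alpha[OF Cg] by (simp add: G.m_assoc)
    also have "\<dots> = \<alpha> ?s \<otimes>\<^bsub>G\<^esub> u ?D"
      unfolding u_mult[OF Cg Ch] by (simp add: alpha_add G.m_assoc)
    finally have "\<alpha> (V (g \<otimes>\<^bsub>G\<^esub> h)) = \<alpha> ?s" by simp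
    then have "?s - V (g \<otimes>\<^bsub>G\<^esub> h) \<in> K"
      by (simp add: K_def alpha_add alpha_neg diff_conv_add_uminus del: add_uminus_conv_diff)
    then obtain w where w: "?s - V (g \<otimes>\<^bsub>G\<^esub> h) = B *v w" using B(2) by auto
    have "rmat B *v (\<beta> g + rmat (M (?C g)) *v \<beta> h) = rmat B *v (\<beta> (g \<otimes>\<^bsub>G\<^esub> h) + rvec w)"
    proof -
      have "rmat B *v (\<beta> g + rmat (M (?C g)) *v \<beta> h)
          = rvec (V g) + rmat (\<rho> (?C g)) *v rvec (V h) + (b (?C g) + rmat (\<rho> (?C g)) *v b (?C h))"
        by (simp add: matrix_vector_right_distrib BM[OF Cg] \<beta>)
      also have "\<dots> = rvec ?s + b ?D"
        unfolding b_mult[OF Cg Ch] by (simp add: rvec_add rmat_mult_rvec)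
      also have "?s = V (g \<otimes>\<^bsub>G\<^esub> h) + B *v w" using w by (simp add: algebra_simps)
      also have "rvec (V (g \<otimes>\<^bsub>G\<^esub> h) + B *v w) + b ?D = rmat B *v (\<beta> (g \<otimes>\<^bsub>G\<^esub> h) + rvec w)"
        by (simp add: matrix_vector_right_distrib \<beta> cos_mult[OF gh] rvec_add rmat_mult_rvec)
      finally show ?thesis .
    qed
    then show "\<exists>v. \<beta> g + rmat (M (?C g)) *v \<beta> h = \<beta> (g \<otimes>\<^bsub>G\<^esub> h) + rvec v"
      using B_inj by blast
  next
    have AQ: "A \<in> carrier ?Q" using Q.one_closed by simp
    have A1: "?C \<one>\<^bsub>G\<^esub> = A" using G.coset_mult_one[OF subgroup.subset[OF sub]] .
    have "B ** M A = B ** mat 1" using M[OF AQ] by (simp add: rho_one)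
    then show "M (?C \<one>\<^bsub>G\<^esub>) = mat 1" unfolding A1 by (rule int_matrix_cancel_left[OF B(1)])
    fix g assume g: "g \<in> carrier G" "M (?C g) = mat 1" "\<beta> g \<in> range rvec"
    have "mat 1 ** B = \<rho> (?C g) ** B" using M[OF cosQ[OF g(1)]] g(2) by simp
    then have "\<rho> (?C g) = \<rho> A"
      using int_matrix_cancel_right[OF B(1)] rho_one by metis
    then have CA: "?C g = A" using \<rho>(2) cosQ[OF g(1)] AQ by (metis inj_onD)
    have AA: "A <#>\<^bsub>G\<^esub> A = A" using Q.l_one[OF Q.one_closed] by simp
    \<comment> \<open>The cocycle need not be normalised: \<open>b A\<close> is \<open>c A A\<close>
      and the representative \<open>u A\<close> is its image under \<open>\<alpha>\<close>, so it is
      \<open>V g + c A A\<close> that has to lie in the kernel.\<close>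
    have bA: "b A = rvec (c A A)" using b_mult[OF AQ AQ] by (simp add: AA rho_one)
    obtain w where "\<beta> g = rvec w" using g(3) by auto
    then have "rvec (V g + c A A) = rvec (B *v w)"
      using \<beta>[of g] by (simp add: CA bA rvec_add rmat_mult_rvec)
    then have "V g + c A A \<in> K" unfolding rvec_inject B(2) by auto
    then have "\<alpha> (V g) \<otimes>\<^bsub>G\<^esub> \<alpha> (c A A) = \<one>\<^bsub>G\<^esub>" by (simp add: K_def alpha_add)
    moreover have "u A = \<alpha> (c A A)"
      using u_mult[OF AQ AQ] uc[OF AQ] Ac[OF alphaA] by (simp add: AA)
    ultimately show "g = \<one>\<^bsub>G\<^esub>" using V[OF g(1)] by (simp add: CA)
  qed
qed

theorem theorem1p3:
  fixes G :: "('g, 'c) monoid_scheme"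
  assumes "group G" and "finite (carrier G)"
  shows "(\<exists>\<phi> :: 'g \<Rightarrow> complex^'n \<Rightarrow> complex^'n. effective_torus_action G \<phi>) \<longleftrightarrow>
    (\<exists>A. A \<lhd> G \<and> (\<forall>a\<in>A. \<forall>b\<in>A. a \<otimes>\<^bsub>G\<^esub> b = b \<otimes>\<^bsub>G\<^esub> a) \<and>
      (\<exists>\<rho>. \<rho> \<in> hom (G Mod A) (GLZ :: (int^'n^'n) monoid) \<and> inj_on \<rho> (carrier (G Mod A)) \<and>
        (\<exists>\<alpha>. \<alpha> \<in> hom (Zn :: (int^'n) monoid) (G\<lparr>carrier := A\<rparr>) \<and> \<alpha> ` UNIV = A \<and>
          (\<forall>C\<in>carrier (G Mod A). \<forall>v. \<alpha> (\<rho> C *v v) = conj_act G C (\<alpha> v)) \<and>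
          (\<exists>c. cocycle2 (G Mod A) Zn (\<lambda>C v. \<rho> C *v v) c \<and>
               coboundary2 (G Mod A) (G\<lparr>carrier := A\<rparr>) (conj_act G)
                 (\<lambda>C1 C2. ext_cocycle G C1 C2 \<otimes>\<^bsub>G\<^esub> inv\<^bsub>G\<^esub> (\<alpha> (c C1 C2)))))))"
    (is "?act \<longleftrightarrow> ?data")
proof
  assume ?act
  then obtain \<phi> :: "'g \<Rightarrow> complex^'n \<Rightarrow> complex^'n" where "effective_torus_action G \<phi>" ..
  then interpret torus_action G \<phi>
    using assms by (intro torus_action.intro torus_action_axioms.intro)
  show ?data by (rule extension_data)
next
  assume ?data
  then obtain A \<rho> \<alpha> c where *: "A \<lhd> G" "\<forall>a\<in>A. \<forall>b\<in>A. a \<otimes>\<^bsub>G\<^esub> b = b \<otimes>\<^bsub>G\<^esub> a"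
      "\<rho> \<in> hom (G Mod A) (GLZ :: (int^'n^'n) monoid)" "inj_on \<rho> (carrier (G Mod A))"
      "\<alpha> \<in> hom (Zn :: (int^'n) monoid) (G\<lparr>carrier := A\<rparr>)" "\<alpha> ` UNIV = A"
      "\<forall>C\<in>carrier (G Mod A). \<forall>v. \<alpha> (\<rho> C *v v) = conj_act G C (\<alpha> v)"
      "cocycle2 (G Mod A) Zn (\<lambda>C v. \<rho> C *v v) c"
      "coboundary2 (G Mod A) (G\<lparr>carrier := A\<rparr>) (conj_act G)
         (\<lambda>C1 C2. ext_cocycle G C1 C2 \<otimes>\<^bsub>G\<^esub> inv\<^bsub>G\<^esub> (\<alpha> (c C1 C2)))"
    by (elim exE conjE)
  show ?act
    by (rule torus_action_of_extension_data[OF assms *(1) _ *(3-6) _ *(8,9)]) (use *(2,7) in blast)+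
qed

end
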